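(* Let $R=k[x_1][x_2;\tau_2,\delta_2]\cdots[x_n;\tau_n,\delta_n]$ be an iterated skew polynomial algebra over an infinite field $k$, where $n\ge 1$, each $\tau_i$ is a $k$-algebra automorphism and each $\delta_i$ is a $k$-linear $\tau_i$-derivation of $k[x_1][x_2;\tau_2,\delta_2]\cdots[x_{i-1};\tau_{i-1},\delta_{i-1}]$, and either $\delta_n=0$ or $\tau_n=\mathrm{Id}$. Then $Q(R)$ is not affine over $k$.
   Context: All rings are associative with unit. For a ring $S$, an automorphism $\tau$ of $S$ and a $\tau$-derivation $\delta$ (additive with $\delta(rs)=\tau(r)\delta(s)+\delta(r)s$), the skew polynomial ring $S[y;\tau,\delta]$ is free as a left $S$-module on the powers of $y$, with $ys=\tau(s)y+\delta(s)$ for $s\in S$. When $n=1$, $R=k[x_1]$ is the ordinary polynomial ring (with $\tau_1=\mathrm{Id}$, $\delta_1=0$). $R$ is a noetherian domain and $Q(R)$ denotes its division ring of fractions. A division algebra is affine over a central subfield $F$ if it is finitely generated as an $F$-algebra. *)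

theory Defs
  imports Complex_Main
begin

text \<open>
  All rings below are subrings (given as sets) of one associative ring with unit, the type
  \<open>'a\<close>; no commutativity is assumed. Maps \<open>\<tau>\<close>, \<open>\<delta>\<close> on a subring \<open>S\<close> are functions on \<open>'a\<close>
  of which only the values on \<open>S\<close> matter.
\<close>

definition subring :: "'a::ring_1 set \<Rightarrow> bool" where
  "subring S \<longleftrightarrow>
     1 \<in> S \<and> (\<forall>a\<in>S. \<forall>b\<in>S. a - b \<in> S) \<and> (\<forall>a\<in>S. \<forall>b\<in>S. a * b \<in> S)"

definition subfield :: "'a::division_ring set \<Rightarrow> bool" where
  "subfield K \<longleftrightarrow>
     subring K \<and> (\<forall>a\<in>K. \<forall>b\<in>K. a * b = b * a) \<and> (\<forall>a\<in>K. inverse a \<in> K)"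

definition ring_automorphism_on :: "'a::ring_1 set \<Rightarrow> ('a \<Rightarrow> 'a) \<Rightarrow> bool" where
  "ring_automorphism_on S \<tau> \<longleftrightarrow>
     bij_betw \<tau> S S \<and> \<tau> 1 = 1 \<and>
     (\<forall>r\<in>S. \<forall>s\<in>S. \<tau> (r + s) = \<tau> r + \<tau> s) \<and>
     (\<forall>r\<in>S. \<forall>s\<in>S. \<tau> (r * s) = \<tau> r * \<tau> s)"

definition skew_derivation_on ::
    "'a::ring_1 set \<Rightarrow> ('a \<Rightarrow> 'a) \<Rightarrow> ('a \<Rightarrow> 'a) \<Rightarrow> bool" where
  "skew_derivation_on S \<tau> \<delta> \<longleftrightarrow>
     (\<forall>s\<in>S. \<delta> s \<in> S) \<and>
     (\<forall>r\<in>S. \<forall>s\<in>S. \<delta> (r + s) = \<delta> r + \<delta> s) \<and>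
     (\<forall>r\<in>S. \<forall>s\<in>S. \<delta> (r * s) = \<tau> r * \<delta> s + \<delta> r * s)"

definition linear_over_on :: "'a::ring_1 set \<Rightarrow> 'a set \<Rightarrow> ('a \<Rightarrow> 'a) \<Rightarrow> bool" where
  "linear_over_on K S f \<longleftrightarrow>
     (\<forall>r\<in>S. \<forall>s\<in>S. f (r + s) = f r + f s) \<and> (\<forall>c\<in>K. \<forall>s\<in>S. f (c * s) = c * f s)"

text \<open>
  \<open>skew_polynomial_ring S y \<tau> \<delta> T\<close> says \<open>T = S[y; \<tau>, \<delta>]\<close>. The last conjunct expresses that
  \<open>T\<close> is free as a left \<open>S\<close>-module on the powers of \<open>y\<close>: \<open>c\<close> is the finitely supported
  family of left coefficients of \<open>t\<close>.
\<close>

definition skew_polynomial_ring ::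
    "'a::ring_1 set \<Rightarrow> 'a \<Rightarrow> ('a \<Rightarrow> 'a) \<Rightarrow> ('a \<Rightarrow> 'a) \<Rightarrow> 'a set \<Rightarrow> bool" where
  "skew_polynomial_ring S y \<tau> \<delta> T \<longleftrightarrow>
     subring S \<and> subring T \<and> S \<subseteq> T \<and> y \<in> T \<and>
     ring_automorphism_on S \<tau> \<and> skew_derivation_on S \<tau> \<delta> \<and>
     (\<forall>s\<in>S. y * s = \<tau> s * y + \<delta> s) \<and>
     (\<forall>t\<in>T. \<exists>!c :: nat \<Rightarrow> 'a.
        range c \<subseteq> S \<and> finite {i. c i \<noteq> 0} \<and> t = (\<Sum>i | c i \<noteq> 0. c i * y ^ i))"

text \<open>
  \<open>R i\<close> is \<open>K[x\<^sub>1][x\<^sub>2; \<tau>\<^sub>2, \<delta>\<^sub>2] \<dots> [x\<^sub>i; \<tau>\<^sub>i, \<delta>\<^sub>i]\<close> for \<open>i \<le> n\<close>, with \<open>R 0 = K\<close>. The clause for \<open>i = 1\<close>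
  makes \<open>R 1\<close> the ordinary polynomial ring \<open>K[x\<^sub>1]\<close>. Since all \<open>\<tau>\<^sub>i\<close> and \<open>\<delta>\<^sub>i\<close> are \<open>K\<close>-linear,
  every \<open>x\<^sub>i\<close> commutes with \<open>K\<close>, so \<open>K\<close> is central in \<open>R n\<close>.
\<close>

definition iterated_skew_polynomial_algebra ::
    "'a::division_ring set \<Rightarrow> nat \<Rightarrow> (nat \<Rightarrow> 'a) \<Rightarrow> (nat \<Rightarrow> 'a \<Rightarrow> 'a) \<Rightarrow> (nat \<Rightarrow> 'a \<Rightarrow> 'a)
      \<Rightarrow> (nat \<Rightarrow> 'a set) \<Rightarrow> bool" where
  "iterated_skew_polynomial_algebra K n x \<tau> \<delta> R \<longleftrightarrow>
     subfield K \<and> R 0 = K \<and>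
     (\<forall>s\<in>K. \<tau> 1 s = s \<and> \<delta> 1 s = 0) \<and>
     (\<forall>i\<in>{1..n}. skew_polynomial_ring (R (i - 1)) (x i) (\<tau> i) (\<delta> i) (R i) \<and>
        linear_over_on K (R (i - 1)) (\<tau> i) \<and> linear_over_on K (R (i - 1)) (\<delta> i))"

text \<open>
  The whole type \<open>'a\<close> is the division ring of fractions of its subring \<open>R\<close>. For a noetherian
  domain \<open>R\<close> (left and right Ore) the left and the right ring of fractions coincide, so every
  element is a fraction on both sides.
\<close>

definition division_ring_of_fractions :: "'a::division_ring set \<Rightarrow> bool" where
  "division_ring_of_fractions R \<longleftrightarrow>
     subring R \<and>
     (\<forall>q. (\<exists>a\<in>R. \<exists>b\<in>R. b \<noteq> 0 \<and> q = a * inverse b) \<and>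
          (\<exists>a\<in>R. \<exists>b\<in>R. b \<noteq> 0 \<and> q = inverse b * a))"

text \<open>
  The whole type \<open>'a\<close> is finitely generated as an algebra over its central subfield \<open>F\<close>: the
  \<open>F\<close>-subalgebra generated by \<open>A\<close> is the smallest subring containing \<open>F\<close> and \<open>A\<close>.
\<close>

definition affine_over :: "'a::division_ring set \<Rightarrow> bool" where
  "affine_over F \<longleftrightarrow> (\<exists>A. finite A \<and> subring hull (F \<union> A) = UNIV)"

end

theory Submission
  imports Defs "HOL-Library.Function_Algebras" "HOL-Library.Infinite_Set"
    "HOL-Computational_Algebra.Primes"
begin

text \<open>
  Write \<open>E\<close> for the division ring of fractions, \<open>S\<close> for \<open>R (n - 1)\<close>, \<open>y\<close> for \<open>x n\<close> and \<open>D \<subseteq> E\<close> for the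
  division ring of fractions of \<open>S\<close>. The hypothesis on \<open>\<tau> n\<close> and \<open>\<delta> n\<close> makes their extensions to \<open>D\<close>
  visible inside \<open>E\<close>: if \<open>\<delta> n = 0\<close>, then \<open>\<tau> n\<close> extends to \<open>d \<mapsto> y d y\<inverse>\<close>, and if \<open>\<tau> n = id\<close>, then
  \<open>\<delta> n\<close> extends to \<open>d \<mapsto> y d - d y\<close>. So \<open>E\<close> consists of the fractions of \<open>A = D[y; T, \<Delta>]\<close>, a ring in
  which all left ideals are principal.

  For \<open>c \<in> K\<close> let \<open>V\<^sub>c\<close> be the simple module \<open>A/A(y - c)\<close>. Let \<open>E\<close> be generated by \<open>K\<close> and finitely
  many elements. Their denominators have finitely many atomic factors. If none of these factors
  annihilates a nonzero element of \<open>V\<^sub>c\<close>, then the generators lie in the localization of \<open>A\<close> at the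
  products of atoms that act injectively on \<open>V\<^sub>c\<close>; but this ring does not contain the inverse of
  \<open>y - c\<close>. Hence for every \<open>c\<close> one of the finitely many atoms \<open>p\<close> annihilates a nonzero element of
  \<open>V\<^sub>c\<close>, which means \<open>V\<^sub>c \<cong> A/Ap\<close> (\<open>finitely_many_singular_atoms\<close>). An isomorphism between \<open>V\<^sub>c\<close> and
  \<open>V\<^sub>c'\<close> (for \<open>c, c' \<noteq> 0\<close> if \<open>\<delta> n = 0\<close>) is a nonzero \<open>d \<in> D\<close> with \<open>y d y\<inverse> = (c/c') d\<close>, respectively \<open>y d - d y = (c - c') d\<close>
  (\<open>singular_atom_eigenvector\<close>): an eigenvector whose eigenvalue lies in the group \<open>K\<^sup>*\<close>,
  respectively \<open>(K, +)\<close>.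

  This group is not finitely generated because \<open>K\<close> is infinite, so it contains a sequence each of
  whose members lies outside some subgroup that contains all earlier members. By the pigeonhole
  principle, infinitely many members \<open>c\<close> belong to the same atom; the resulting eigenvectors again
  have eigenvalues each of which lies outside a subgroup containing the earlier ones. Eigenvectors
  for distinct eigenvalues are linearly independent, and therefore no eigenvector lies in the
  division subring generated by the earlier ones (\<open>separating_division_subring\<close>). So \<open>E\<close> has an
  infinite strictly ascending chain of division subrings that contain \<open>K\<close>.

  Such a chain is impossible (\<open>division_subring_acc\<close>). A division subring \<open>F\<close> is determined by the
  sub-bimodule of \<open>E \<otimes>\<^sub>K E\<close> generated by the elements \<open>d \<otimes> 1 - 1 \<otimes> d\<close> with \<open>d \<in> F\<close>, as \<open>d \<otimes> 1\<close> and
  \<open>1 \<otimes> d\<close> have the same image in \<open>E \<otimes>\<^sub>F E\<close> only if \<open>d \<in> F\<close>. After multiplication by denominators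
  these generators lie in \<open>R n \<otimes>\<^sub>K R n\<close>, and this bimodule is noetherian: it arises from \<open>K\<close> by
  \<open>2 n\<close> skew polynomial extensions, to each of which the Hilbert basis theorem applies
  (\<open>noetherian_polys\<close>).
\<close>

section \<open>The Hilbert basis theorem for groups with operators\<close>

text \<open>
  All noetherian objects below (left ideals of a ring, bimodules) are abelian groups with a set
  \<open>\<Omega>\<close> of operators, so that one form of the Hilbert basis theorem covers left and right
  multiplications at once.
\<close>

definition submod :: "('m \<Rightarrow> 'm) set \<Rightarrow> 'm::ab_group_add set \<Rightarrow> bool" where
  "submod \<Omega> P \<longleftrightarrow> 0 \<in> P \<and> (\<forall>p\<in>P. \<forall>q\<in>P. p - q \<in> P) \<and> (\<forall>\<omega>\<in>\<Omega>. \<forall>p\<in>P. \<omega> p \<in> P)"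

definition noetherian :: "('m \<Rightarrow> 'm) set \<Rightarrow> 'm::ab_group_add set \<Rightarrow> bool" where
  "noetherian \<Omega> N \<longleftrightarrow> submod \<Omega> N \<and>
     (\<forall>P. (\<forall>i. submod \<Omega> (P i) \<and> P i \<subseteq> N \<and> P i \<subseteq> P (Suc i)) \<longrightarrow>
          (\<exists>m. \<forall>i\<ge>m. P i = P m))"

definition additive_on :: "'m::ab_group_add set \<Rightarrow> ('m \<Rightarrow> 'm) \<Rightarrow> bool" where
  "additive_on M f \<longleftrightarrow> (\<forall>u\<in>M. \<forall>v\<in>M. f (u - v) = f u - f v)"

lemma submodD:
  assumes "submod \<Omega> P"
  shows submod_zero: "0 \<in> P"
    and submod_diff: "\<And>p q. p \<in> P \<Longrightarrow> q \<in> P \<Longrightarrow> p - q \<in> P"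
    and submod_op: "\<And>\<omega> p. \<omega> \<in> \<Omega> \<Longrightarrow> p \<in> P \<Longrightarrow> \<omega> p \<in> P"
  using assms unfolding submod_def by auto

lemma submod_add:
  assumes "submod \<Omega> P" "p \<in> P" "q \<in> P"
  shows "p + q \<in> P"
proof -
  have "0 - q \<in> P" using assms submodD by blast
  then have "p - (0 - q) \<in> P" using assms submodD by blast
  then show ?thesis by simp
qed

lemma submod_antimono: "submod \<Omega>' P \<Longrightarrow> \<Omega> \<subseteq> \<Omega>' \<Longrightarrow> submod \<Omega> P"
  unfolding submod_def by blast

lemma additive_onD: "additive_on M f \<Longrightarrow> u \<in> M \<Longrightarrow> v \<in> M \<Longrightarrow> f (u - v) = f u - f v"
  unfolding additive_on_def by blast

lemma additive_on_zero: "additive_on M f \<Longrightarrow> 0 \<in> M \<Longrightarrow> f 0 = 0"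
  using additive_onD[of M f 0 0] by simp

lemma additive_on_add:
  assumes "additive_on M f" "submod \<Omega> M" "u \<in> M" "v \<in> M"
  shows "f (u + v) = f u + f v"
proof -
  have m: "0 - v \<in> M" "0 \<in> M" using assms(2,4) submodD by blast+
  have "f (u - (0 - v)) = f u - (f 0 - f v)"
    using additive_onD[OF assms(1)] assms(3,4) m by metis
  then show ?thesis using additive_on_zero[OF assms(1) m(2)] by simp
qed

lemma noetherian_chain:
  assumes "noetherian \<Omega> N" "\<And>i. submod \<Omega> (P i)" "\<And>i. P i \<subseteq> N" "\<And>i. P i \<subseteq> P (Suc i)"
  obtains m where "\<And>i. i \<ge> m \<Longrightarrow> P i = P m"
proof -
  have "\<exists>m. \<forall>i\<ge>m. P i = P m" 
    using assms unfolding noetherian_def by blast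
  then show ?thesis using that by blast
qed

text \<open>
  Fewer subgroups are stable under more operators.
\<close>

lemma noetherian_more_operators:
  assumes "noetherian \<Omega> N" "\<Omega> \<subseteq> \<Omega>'" "submod \<Omega>' N"
  shows "noetherian \<Omega>' N"
  unfolding noetherian_def
proof (intro conjI allI impI)
  fix P assume "\<forall>i. submod \<Omega>' (P i) \<and> P i \<subseteq> N \<and> P i \<subseteq> P (Suc i)"
  then have "\<And>i. submod \<Omega> (P i)" "\<And>i. P i \<subseteq> N" "\<And>i. P i \<subseteq> P (Suc i)"
    using submod_antimono assms(2) by blast+
  then show "\<exists>m. \<forall>i\<ge>m. P i = P m" using noetherian_chain[OF assms(1)] by metis
qed (rule assms(3))

lemma noetherian_simple:
  assumes "submod \<Omega> N" "\<And>P. submod \<Omega> P \<Longrightarrow> P \<subseteq> N \<Longrightarrow> P = {0} \<or> P = N"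
  shows "noetherian \<Omega> N"
  unfolding noetherian_def
proof (intro conjI allI impI)
  fix P assume P: "\<forall>i. submod \<Omega> (P i) \<and> P i \<subseteq> N \<and> P i \<subseteq> P (Suc i)"
  have mono: "P i \<subseteq> P j" if "i \<le> j" for i j
    using lift_Suc_mono_le[of P i j] P that by blast
  show "\<exists>m. \<forall>i\<ge>m. P i = P m"
  proof (cases "\<exists>m. P m = N")
    case True
    then obtain m where "P m = N" by blast
    then show ?thesis using mono P by (metis subset_antisym)
  next
    case False
    then have "P i = {0}" for i using assms(2) P by blast
    then show ?thesis by simp
  qed
qed (use assms in auto)

text \<open>
  The sums \<open>n\<^sub>0 + y n\<^sub>1 + \<dots> + y\<^sup>j\<^sup>-\<^sup>1 n\<^sub>j\<^sub>-\<^sub>1\<close>: as \<open>y\<close> is an operator, its powers stand to the left of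
  their coefficients.
\<close>

primrec poly_below :: "('m \<Rightarrow> 'm) \<Rightarrow> 'm::ab_group_add set \<Rightarrow> nat \<Rightarrow> 'm set" where
  "poly_below y N 0 = {0}"
| "poly_below y N (Suc j) = {(y ^^ j) n + w | n w. n \<in> N \<and> w \<in> poly_below y N j}"

definition lead_coeffs :: "('m \<Rightarrow> 'm) \<Rightarrow> 'm::ab_group_add set \<Rightarrow> nat \<Rightarrow> 'm set \<Rightarrow> 'm set" where
  "lead_coeffs y N j P = {n \<in> N. \<exists>w\<in>poly_below y N j. (y ^^ j) n + w \<in> P}"

text \<open>
  The abstract form of a skew polynomial extension: \<open>\<Omega>\<close> contains the multiplications by a ring, and
  \<open>y\<close> is the multiplication by a new variable. Condition \<open>swap_out\<close> moves an operator to the right of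
  \<open>y\<close>, modulo \<open>\<Omega>\<close>, and \<open>swap_in\<close> reaches every prescribed operator there. The relation
  \<open>y s = \<tau> s y + \<delta> s\<close> is an instance of \<open>swap_in\<close> for left actions and of \<open>swap_out\<close> for right actions;
  the other condition results from replacing \<open>s\<close> by \<open>\<tau>\<inverse> s\<close>. The identities are demanded on an ambient
  group \<open>M\<close> only, because for bimodules they hold for additive functions only.
\<close>

locale skew_operator =
  fixes \<Omega> :: "('m::ab_group_add \<Rightarrow> 'm) set" and y :: "'m \<Rightarrow> 'm" and M N :: "'m set"
  assumes noeth: "noetherian \<Omega> N"
    and ambient: "submod (insert y \<Omega>) M"
    and N_sub: "N \<subseteq> M"
    and additive: "\<And>\<omega>. \<omega> \<in> insert y \<Omega> \<Longrightarrow> additive_on M \<omega>"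
    and swap_out: "\<And>\<omega>. \<omega> \<in> \<Omega> \<Longrightarrow> \<exists>\<omega>'\<in>\<Omega>. \<exists>\<omega>''\<in>\<Omega>. \<forall>v\<in>M. \<omega> (y v) = y (\<omega>' v) + \<omega>'' v"
    and swap_in: "\<And>\<omega>. \<omega> \<in> \<Omega> \<Longrightarrow> \<exists>\<omega>'\<in>\<Omega>. \<exists>\<omega>''\<in>\<Omega>. \<forall>v\<in>M. \<omega>' (y v) = y (\<omega> v) + \<omega>'' v"
begin

abbreviation "PB \<equiv> poly_below y N"
abbreviation "LC \<equiv> lead_coeffs y N"

lemma N_submod: "submod \<Omega> N"
  using noeth unfolding noetherian_def by blast

lemma M_add: "u \<in> M \<Longrightarrow> v \<in> M \<Longrightarrow> u + v \<in> M"
  and M_y: "v \<in> M \<Longrightarrow> y v \<in> M"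
  and M_op: "\<omega> \<in> \<Omega> \<Longrightarrow> v \<in> M \<Longrightarrow> \<omega> v \<in> M"
  and M_zero: "0 \<in> M"
  using ambient submod_add[OF ambient] unfolding submod_def by auto

lemma op_add: "\<omega> \<in> insert y \<Omega> \<Longrightarrow> u \<in> M \<Longrightarrow> v \<in> M \<Longrightarrow> \<omega> (u + v) = \<omega> u + \<omega> v"
  using additive_on_add[OF additive ambient] by blast

lemma op_diff: "\<omega> \<in> insert y \<Omega> \<Longrightarrow> u \<in> M \<Longrightarrow> v \<in> M \<Longrightarrow> \<omega> (u - v) = \<omega> u - \<omega> v"
  using additive additive_onD by blast

lemma op_zero: "\<omega> \<in> insert y \<Omega> \<Longrightarrow> \<omega> 0 = 0"
  using additive additive_on_zero M_zero by blast

lemma M_pow: "v \<in> M \<Longrightarrow> (y ^^ j) v \<in> M"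
  by (induction j) (auto intro: M_y)

lemma pow_diff: "u \<in> M \<Longrightarrow> v \<in> M \<Longrightarrow> (y ^^ j) (u - v) = (y ^^ j) u - (y ^^ j) v"
  by (induction j) (auto simp: op_diff M_pow)

lemma pow_zero: "(y ^^ j) 0 = 0"
  by (induction j) (auto simp: op_zero)

lemma PB_sub: "PB j \<subseteq> M"
proof (induction j)
  case (Suc j)
  then show ?case using N_sub M_pow M_add by (auto simp: subset_iff)
qed (simp add: M_zero)

lemma PB_SucI: "n \<in> N \<Longrightarrow> w \<in> PB j \<Longrightarrow> (y ^^ j) n + w \<in> PB (Suc j)"
  by auto

lemma PB_zero: "0 \<in> PB j"
proof (induction j)
  case (Suc j)
  have "0 = (y ^^ j) 0 + 0" by (simp add: pow_zero)
  then show ?case using Suc PB_SucI submod_zero[OF N_submod] by metis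
qed simp

lemma PB_diff: "u \<in> PB j \<Longrightarrow> v \<in> PB j \<Longrightarrow> u - v \<in> PB j"
proof (induction j arbitrary: u v)
  case (Suc j)
  then obtain n w n' w' where *: "u = (y ^^ j) n + w" "v = (y ^^ j) n' + w'"
    "n \<in> N" "n' \<in> N" "w \<in> PB j" "w' \<in> PB j" by auto
  have "u - v = (y ^^ j) (n - n') + (w - w')"
    using * subsetD[OF N_sub] by (simp add: pow_diff)
  then show ?case using PB_SucI[of "n - n'" "w - w'" j] * Suc.IH submod_diff[OF N_submod] by metis
qed simp

lemma PB_add: "u \<in> PB j \<Longrightarrow> v \<in> PB j \<Longrightarrow> u + v \<in> PB j"
  using PB_diff[of u j "0 - v"] PB_diff[of 0 j v] PB_zero by simp

lemma PB_Suc: "PB j \<subseteq> PB (Suc j)"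
proof
  fix w assume "w \<in> PB j"
  moreover have "w = (y ^^ j) 0 + w" by (simp add: pow_zero)
  ultimately show "w \<in> PB (Suc j)" using PB_SucI submod_zero[OF N_submod] by metis
qed

lemma PB_mono: "i \<le> j \<Longrightarrow> PB i \<subseteq> PB j"
  using lift_Suc_mono_le[of PB i j] PB_Suc by blast

lemma PB_monom: "n \<in> N \<Longrightarrow> (y ^^ j) n \<in> PB (Suc j)"
  using PB_SucI[OF _ PB_zero[of j], of n] by simp

lemma PB_y: "v \<in> PB j \<Longrightarrow> y v \<in> PB (Suc j)"
proof (induction j arbitrary: v)
  case 0
  then show ?case using op_zero[of y] PB_zero[of "Suc 0"] by (simp del: poly_below.simps(2))
next
  case (Suc j)
  then obtain n w where *: "v = (y ^^ j) n + w" "n \<in> N" "w \<in> PB j" by auto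
  then have "y v = (y ^^ Suc j) n + y w"
    using N_sub PB_sub M_pow by (simp add: op_add subset_iff)
  then show ?case using * Suc.IH PB_SucI by metis
qed

text \<open>
  Moving \<open>\<omega>\<close> past one more \<open>y\<close> produces a lower-order term \<open>\<omega>''\<close> applied to a monomial of the
  previous degree, so the two statements need each other in the induction.
\<close>

lemma op_monom: "\<omega> \<in> \<Omega> \<Longrightarrow> \<exists>\<omega>'\<in>\<Omega>. \<forall>n\<in>N. \<omega> ((y ^^ j) n) - (y ^^ j) (\<omega>' n) \<in> PB j"
  and PB_op: "\<omega> \<in> \<Omega> \<Longrightarrow> v \<in> PB j \<Longrightarrow> \<omega> v \<in> PB j"
proof (induction j arbitrary: \<omega> v)
  case 0
  { case 1 then show ?case by auto
  next
    case 2 then show ?case using op_zero by auto }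
next
  case (Suc j)
  have monom: "\<omega> ((y ^^ j) n) \<in> PB (Suc j)" if \<omega>: "\<omega> \<in> \<Omega>" and n: "n \<in> N" for \<omega> n
  proof -
    obtain \<omega>' where *: "\<omega>' \<in> \<Omega>" "\<omega> ((y ^^ j) n) - (y ^^ j) (\<omega>' n) \<in> PB j"
      using Suc.IH(1)[OF \<omega>] n by blast
    moreover have "\<omega>' n \<in> N" using * n submod_op[OF N_submod] by blast
    moreover have "\<omega> ((y ^^ j) n) = (y ^^ j) (\<omega>' n) + (\<omega> ((y ^^ j) n) - (y ^^ j) (\<omega>' n))" by simp
    ultimately show ?thesis using PB_SucI by metis
  qed
  { case 1
    obtain \<omega>1 \<omega>2 where 2: "\<omega>1 \<in> \<Omega>" "\<omega>2 \<in> \<Omega>" "\<And>v. v \<in> M \<Longrightarrow> \<omega> (y v) = y (\<omega>1 v) + \<omega>2 v"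
      using swap_out[OF 1] by blast
    obtain \<omega>3 where 3: "\<omega>3 \<in> \<Omega>" "\<And>n. n \<in> N \<Longrightarrow> \<omega>1 ((y ^^ j) n) - (y ^^ j) (\<omega>3 n) \<in> PB j"
      using Suc.IH(1)[OF 2(1)] by blast
    have "\<omega> ((y ^^ Suc j) n) - (y ^^ Suc j) (\<omega>3 n) \<in> PB (Suc j)" if n: "n \<in> N" for n
    proof -
      have m: "(y ^^ j) n \<in> M" "\<omega>1 ((y ^^ j) n) \<in> M" "(y ^^ j) (\<omega>3 n) \<in> M"
        using n N_sub 2 3 M_pow M_op by blast+
      have "\<omega> ((y ^^ Suc j) n) - (y ^^ Suc j) (\<omega>3 n)
          = y (\<omega>1 ((y ^^ j) n) - (y ^^ j) (\<omega>3 n)) + \<omega>2 ((y ^^ j) n)"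
        using m by (simp add: op_diff 2(3))
      then show ?thesis
        using PB_add[OF PB_y[OF 3(2)[OF n]] monom[OF 2(2) n]] by metis
    qed
    then show ?case using 3(1) by blast
  next
    case 2
    then obtain n w where *: "v = (y ^^ j) n + w" "n \<in> N" "w \<in> PB j" by auto
    then have "\<omega> v = \<omega> ((y ^^ j) n) + \<omega> w"
      using N_sub PB_sub M_pow 2 by (simp add: op_add subset_iff)
    moreover have "\<omega> w \<in> PB (Suc j)" using Suc.IH(2) 2 * PB_Suc by blast
    ultimately show ?case using monom[OF 2(1) *(2)] PB_add by metis }
qed

text \<open>
  The counterpart of \<open>op_monom\<close> in which the operator next to the coefficient is prescribed. It
  makes the leading coefficients closed under \<open>\<Omega>\<close>.
\<close>

lemma op_monom_back: "\<omega> \<in> \<Omega> \<Longrightarrow> \<exists>\<omega>'\<in>\<Omega>. \<forall>n\<in>N. \<omega>' ((y ^^ j) n) - (y ^^ j) (\<omega> n) \<in> PB j"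
proof (induction j)
  case 0
  then show ?case by auto
next
  case (Suc j)
  obtain \<omega>1 where 1: "\<omega>1 \<in> \<Omega>" "\<And>n. n \<in> N \<Longrightarrow> \<omega>1 ((y ^^ j) n) - (y ^^ j) (\<omega> n) \<in> PB j"
    using Suc by blast
  obtain \<omega>2 \<omega>3 where 2: "\<omega>2 \<in> \<Omega>" "\<omega>3 \<in> \<Omega>" "\<And>v. v \<in> M \<Longrightarrow> \<omega>2 (y v) = y (\<omega>1 v) + \<omega>3 v"
    using swap_in[OF 1(1)] by blast
  have "\<omega>2 ((y ^^ Suc j) n) - (y ^^ Suc j) (\<omega> n) \<in> PB (Suc j)" if n: "n \<in> N" for n
  proof -
    have m: "(y ^^ j) n \<in> M" "\<omega>1 ((y ^^ j) n) \<in> M" "(y ^^ j) (\<omega> n) \<in> M"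
      using n N_sub 1 Suc.prems M_pow M_op by blast+
    have "\<omega>2 ((y ^^ Suc j) n) - (y ^^ Suc j) (\<omega> n)
        = y (\<omega>1 ((y ^^ j) n) - (y ^^ j) (\<omega> n)) + \<omega>3 ((y ^^ j) n)"
      using m by (simp add: op_diff 2(3))
    then show ?thesis
      using PB_add[OF PB_y[OF 1(2)[OF n]] PB_op[OF 2(2) PB_monom[OF n]]] by metis
  qed
  then show ?case using 2(1) by blast
qed

definition polys :: "'m set" where "polys = (\<Union>j. PB j)"

lemma polys_submod: "submod (insert y \<Omega>) polys"
  unfolding submod_def polys_def
proof (intro conjI ballI)
  show "0 \<in> (\<Union>j. PB j)" using PB_zero by blast
next
  fix p q assume "p \<in> (\<Union>j. PB j)" "q \<in> (\<Union>j. PB j)"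
  then obtain i j where "p \<in> PB i" "q \<in> PB j" by blast
  then have "p \<in> PB (max i j)" "q \<in> PB (max i j)"
    using PB_mono[of i "max i j"] PB_mono[of j "max i j"] by (meson max.cobounded1 max.cobounded2 subsetD)+
  then show "p - q \<in> (\<Union>j. PB j)" using PB_diff by blast
next
  fix \<omega> p assume \<omega>: "\<omega> \<in> insert y \<Omega>" and "p \<in> (\<Union>j. PB j)"
  then obtain j where "p \<in> PB j" by blast
  then have "\<omega> p \<in> PB j \<or> \<omega> p \<in> PB (Suc j)" using \<omega> PB_y PB_op by (metis insertE)
  then show "\<omega> p \<in> (\<Union>j. PB j)" by blast
qed

lemma N_polys: "N \<subseteq> polys"
proof -
  have "PB (Suc 0) \<subseteq> polys" unfolding polys_def by blast
  then show ?thesis using PB_monom[of _ 0] by (simp del: poly_below.simps add: subset_iff)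
qed

lemma polys_sub: "polys \<subseteq> M"
  unfolding polys_def using PB_sub by blast

lemma LC_submod:
  assumes P: "submod (insert y \<Omega>) P" "P \<subseteq> polys"
  shows "submod \<Omega> (LC j P)"
  unfolding submod_def
proof (intro conjI ballI)
  show "0 \<in> LC j P"
    unfolding lead_coeffs_def
    using submod_zero[OF N_submod] submod_zero[OF P(1)] PB_zero[of j] pow_zero by force
next
  fix p q assume "p \<in> LC j P" "q \<in> LC j P"
  then obtain w w' where *: "p \<in> N" "q \<in> N" "w \<in> PB j" "w' \<in> PB j"
     "(y ^^ j) p + w \<in> P" "(y ^^ j) q + w' \<in> P" unfolding lead_coeffs_def by blast
  have "(y ^^ j) (p - q) + (w - w') = ((y ^^ j) p + w) - ((y ^^ j) q + w')"
    using * subsetD[OF N_sub] by (simp add: pow_diff)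
  then have "(y ^^ j) (p - q) + (w - w') \<in> P" using * submod_diff[OF P(1)] by metis
  then show "p - q \<in> LC j P"
    unfolding lead_coeffs_def using * PB_diff submod_diff[OF N_submod] by blast
next
  fix \<omega> p assume \<omega>: "\<omega> \<in> \<Omega>" and "p \<in> LC j P"
  then obtain w where *: "p \<in> N" "w \<in> PB j" "(y ^^ j) p + w \<in> P"
    unfolding lead_coeffs_def by blast
  obtain \<omega>' where 1: "\<omega>' \<in> \<Omega>" "\<omega>' ((y ^^ j) p) - (y ^^ j) (\<omega> p) \<in> PB j"
    using op_monom_back[OF \<omega>] * by blast
  have "\<omega>' ((y ^^ j) p + w) = \<omega>' ((y ^^ j) p) + \<omega>' w"
    using 1 * N_sub PB_sub M_pow by (simp add: op_add subset_iff)
  also have "\<dots> = (y ^^ j) (\<omega> p) + ((\<omega>' ((y ^^ j) p) - (y ^^ j) (\<omega> p)) + \<omega>' w)" by simp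
  finally have "(y ^^ j) (\<omega> p) + ((\<omega>' ((y ^^ j) p) - (y ^^ j) (\<omega> p)) + \<omega>' w) \<in> P"
    using submod_op[OF P(1)] 1 * by (metis insert_iff)
  moreover have "(\<omega>' ((y ^^ j) p) - (y ^^ j) (\<omega> p)) + \<omega>' w \<in> PB j"
    using 1 * PB_op PB_add by blast
  ultimately show "\<omega> p \<in> LC j P"
    unfolding lead_coeffs_def using submod_op[OF N_submod \<omega> *(1)] by blast
qed

lemma LC_Suc:
  assumes P: "submod (insert y \<Omega>) P"
  shows "LC j P \<subseteq> LC (Suc j) P"
proof
  fix n assume "n \<in> LC j P"
  then obtain w where *: "n \<in> N" "w \<in> PB j" "(y ^^ j) n + w \<in> P"
    unfolding lead_coeffs_def by blast
  have "y ((y ^^ j) n + w) = (y ^^ Suc j) n + y w"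
    using * N_sub PB_sub M_pow by (simp add: op_add subset_iff)
  then have "(y ^^ Suc j) n + y w \<in> P" using submod_op[OF P] * by (metis insertI1)
  then show "n \<in> LC (Suc j) P"
    unfolding lead_coeffs_def using * PB_y by blast
qed

lemma LC_mono: "P \<subseteq> P' \<Longrightarrow> LC j P \<subseteq> LC j P'"
  unfolding lead_coeffs_def by blast

text \<open>
  Subtract from an element of \<open>P'\<close> an element of \<open>P\<close> with the same leading term and use induction
  on the degree.
\<close>

lemma LC_determines:
  assumes P: "submod (insert y \<Omega>) P" and P': "submod (insert y \<Omega>) P'" "P' \<subseteq> polys"
    and sub: "P \<subseteq> P'" and eq: "\<And>j. LC j P' \<subseteq> LC j P"
  shows "P' \<subseteq> P"
proof -
  have "P' \<inter> PB j \<subseteq> P" for j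
  proof (induction j)
    case 0
    then show ?case using submod_zero[OF P] by auto
  next
    case (Suc j)
    show ?case
    proof
      fix p assume "p \<in> P' \<inter> PB (Suc j)"
      then obtain n w where *: "p \<in> P'" "p = (y ^^ j) n + w" "n \<in> N" "w \<in> PB j" by auto
      then have "n \<in> LC j P" using eq[of j] unfolding lead_coeffs_def by blast
      then obtain w' where w': "w' \<in> PB j" "(y ^^ j) n + w' \<in> P"
        unfolding lead_coeffs_def by blast
      have "w - w' = p - ((y ^^ j) n + w')" using * by simp
      then have "w - w' \<in> P'" using * w' sub submod_diff[OF P'(1)] by (metis subsetD)
      then have "w - w' \<in> P" using Suc PB_diff * w' by blast
      then have "((y ^^ j) n + w') + (w - w') \<in> P" using w' submod_add[OF P] by blast
      then show "p \<in> P" using * by simp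
    qed
  qed
  then show ?thesis using P'(2) unfolding polys_def by blast
qed

text \<open>
  The Hilbert basis theorem. The leading coefficients of degree \<open>j\<close> in the \<open>i\<close>-th member of the chain
  increase with both \<open>i\<close> and \<open>j\<close>. The diagonal sequence becomes constant, which settles all large
  degrees, and each of the finitely many small degrees has its own chain in \<open>N\<close>.
\<close>

theorem noetherian_polys: "noetherian (insert y \<Omega>) polys"
  unfolding noetherian_def
proof (intro conjI allI impI)
  show "submod (insert y \<Omega>) polys" by (rule polys_submod)
next
  fix P assume "\<forall>i. submod (insert y \<Omega>) (P i) \<and> P i \<subseteq> polys \<and> P i \<subseteq> P (Suc i)"
  then have P: "\<And>i. submod (insert y \<Omega>) (P i)" "\<And>i. P i \<subseteq> polys" "\<And>i. P i \<subseteq> P (Suc i)"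
    by simp_all
  have mono: "P i \<subseteq> P j" if "i \<le> j" for i j
    using lift_Suc_mono_le[of P i j, OF P(3) that] .
  have LCj: "LC i Q \<subseteq> LC j Q" if "i \<le> j" "submod (insert y \<Omega>) Q" for i j Q
    using lift_Suc_mono_le[of "\<lambda>i. LC i Q" i j, OF LC_Suc[OF that(2)] that(1)] .
  have LCsub: "LC j Q \<subseteq> N" for j Q unfolding lead_coeffs_def by blast
  have LCP: "submod \<Omega> (LC j (P i))" for i j by (rule LC_submod[OF P(1) P(2)])
  have LCi: "LC j (P i) \<subseteq> LC j (P (Suc i))" for i j by (rule LC_mono[OF P(3)])
  have diag: "LC i (P i) \<subseteq> LC (Suc i) (P (Suc i))" for i
    using LCi[of i i] LC_Suc[OF P(1), of i "Suc i"] by (rule order_trans)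
  obtain m where m: "\<And>i. i \<ge> m \<Longrightarrow> LC i (P i) = LC m (P m)"
    by (rule noetherian_chain[OF noeth, of "\<lambda>i. LC i (P i)", OF LCP LCsub diag]) (rule that)
  have "\<exists>k. \<forall>i\<ge>k. LC j (P i) = LC j (P k)" for j
    by (rule noetherian_chain[OF noeth, of "\<lambda>i. LC j (P i)", OF LCP LCsub LCi]) blast
  then obtain k where k: "\<And>j i. i \<ge> k j \<Longrightarrow> LC j (P i) = LC j (P (k j))" by metis
  define h where "h = Max (insert m (k ` {..<m}))"
  have hm: "m \<le> h" unfolding h_def by simp
  have hk: "k j \<le> h" if "j < m" for j unfolding h_def using that by (intro Max_ge) auto
  have "P i = P h" if i: "i \<ge> h" for i
  proof -
    have "LC j (P i) \<subseteq> LC j (P h)" for j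
    proof (cases "j < m")
      case True
      then show ?thesis using k[of j i] k[of j h] hk[of j] i by simp
    next
      case False
      define g where "g = max i j"
      have "LC j (P i) \<subseteq> LC j (P g)" by (rule LC_mono[OF mono]) (simp add: g_def)
      also have "\<dots> \<subseteq> LC g (P g)" by (rule LCj[OF _ P(1)]) (simp add: g_def)
      also have "\<dots> = LC m (P m)" by (rule m) (use hm i in \<open>simp add: g_def\<close>)
      also have "\<dots> \<subseteq> LC m (P h)" using LC_mono[OF mono[OF hm]] .
      also have "\<dots> \<subseteq> LC j (P h)" by (rule LCj[OF _ P(1)]) (use False in simp)
      finally show ?thesis .
    qed
    then show ?thesis using LC_determines[OF P(1) P(1) P(2) mono[OF i]] mono[OF i]
      by (metis subset_antisym)
  qed
  then show "\<exists>m. \<forall>i\<ge>m. P i = P m" by blast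
qed

end

section \<open>Skew extensions acting on operator groups\<close>

lemma subringI:
  assumes "1 \<in> S" "\<And>a b. a \<in> S \<Longrightarrow> b \<in> S \<Longrightarrow> a - b \<in> S" "\<And>a b. a \<in> S \<Longrightarrow> b \<in> S \<Longrightarrow> a * b \<in> S"
  shows "subring S"
  using assms unfolding subring_def by blast

lemma subringD:
  assumes "subring S"
  shows subring_one: "1 \<in> S"
    and subring_diff: "\<And>a b. a \<in> S \<Longrightarrow> b \<in> S \<Longrightarrow> a - b \<in> S"
    and subring_mult: "\<And>a b. a \<in> S \<Longrightarrow> b \<in> S \<Longrightarrow> a * b \<in> S"
  using assms unfolding subring_def by auto

lemma subring_zero: "subring S \<Longrightarrow> 0 \<in> S"
  using subring_diff[of S 1 1] subring_one[of S] by simp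

lemma subring_minus: "subring S \<Longrightarrow> a \<in> S \<Longrightarrow> - a \<in> S"
  using subring_diff[of S 0 a] subring_zero[of S] by simp

lemma subring_add: "subring S \<Longrightarrow> a \<in> S \<Longrightarrow> b \<in> S \<Longrightarrow> a + b \<in> S"
  using subring_diff[of S a "- b"] subring_minus[of S b] by simp

lemma subring_power: "subring S \<Longrightarrow> a \<in> S \<Longrightarrow> a ^ n \<in> S"
  by (induction n) (auto intro: subring_one subring_mult)

lemma subring_hull: "subring (subring hull X)"
  by (rule hull_in) (auto simp: subring_def)

text \<open>
  An action of a ring by left or by right multiplications, that is, by a homomorphism or an
  antihomomorphism, which commutes with a set \<open>\<Omega>\<close> of further operators. For bimodules, \<open>\<Omega>\<close> will be
  the multiplications on the other side.
\<close>

locale ring_action =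
  fixes act :: "'a::ring_1 \<Rightarrow> 'm::ab_group_add \<Rightarrow> 'm" and M :: "'m set" and \<Omega> :: "('m \<Rightarrow> 'm) set"
  assumes M: "submod (\<Omega> \<union> range act) M"
    and additive: "\<And>\<omega>. \<omega> \<in> \<Omega> \<union> range act \<Longrightarrow> additive_on M \<omega>"
    and act_add: "\<And>a b v. v \<in> M \<Longrightarrow> act (a + b) v = act a v + act b v"
    and act_mult: "(\<forall>a b. \<forall>v\<in>M. act (a * b) v = act a (act b v)) \<or>
                   (\<forall>a b. \<forall>v\<in>M. act (a * b) v = act b (act a v))"
    and commute: "\<And>\<omega> a v. \<omega> \<in> \<Omega> \<Longrightarrow> v \<in> M \<Longrightarrow> \<omega> (act a v) = act a (\<omega> v)"
begin

lemma act_zero: "v \<in> M \<Longrightarrow> act 0 v = 0"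
  using act_add[of v 0 0] by simp

lemma act_minus: "v \<in> M \<Longrightarrow> act (- a) v = - act a v"
  using act_add[of v a "- a"] act_zero[of v] by (simp add: eq_neg_iff_add_eq_0 add.commute)

lemma act_diff: "v \<in> M \<Longrightarrow> act (a - b) v = act a v - act b v"
  using act_add[of v a "- b"] act_minus[of v b] by simp

lemma stabilizer_subring:
  assumes N: "submod (\<Omega> \<union> act ` S) N" "N \<subseteq> M" "1 \<in> S"
  shows "subring {r. \<forall>v\<in>N. act r v \<in> N}"
  unfolding subring_def
proof (intro conjI ballI)
  show "1 \<in> {r. \<forall>v\<in>N. act r v \<in> N}" using submod_op[OF N(1)] N(3) by blast
next
  fix a b assume ab: "a \<in> {r. \<forall>v\<in>N. act r v \<in> N}" "b \<in> {r. \<forall>v\<in>N. act r v \<in> N}"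
  show "a - b \<in> {r. \<forall>v\<in>N. act r v \<in> N}"
    using ab act_diff N(2) submod_diff[OF N(1)] by (auto simp: subset_iff)
  show "a * b \<in> {r. \<forall>v\<in>N. act r v \<in> N}"
    using ab act_mult N(2) by (auto simp: subset_iff)
qed

text \<open>
  The defining relation is one of the two swapping conditions, and surjectivity of \<open>T\<close> supplies the
  other. The polynomials in \<open>y\<close> are then stable under all ring elements that are generated by \<open>S\<close>
  and \<open>y\<close>.
\<close>

lemma noetherian_extension:
  assumes S: "subring S" and T: "bij_betw T S S" and \<Delta>: "\<And>s. s \<in> S \<Longrightarrow> \<Delta> s \<in> S"
    and rel: "\<And>s. s \<in> S \<Longrightarrow> y * s = T s * y + \<Delta> s"
    and N: "noetherian (\<Omega> \<union> act ` S) N" "N \<subseteq> M"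
    and S': "insert y S \<subseteq> S'" "S' \<subseteq> subring hull (insert y S)"
  shows "\<exists>N'. N \<subseteq> N' \<and> N' \<subseteq> M \<and> noetherian (\<Omega> \<union> act ` S') N'"
proof -
  have TS: "T s \<in> S" if "s \<in> S" for s using T that unfolding bij_betw_def by blast
  have Tinv: "\<exists>s'\<in>S. T s' = s" if "s \<in> S" for s using T that unfolding bij_betw_def by force
  have zero: "act 0 \<in> \<Omega> \<union> act ` S" using subring_zero[OF S] by blast
  have swap: "act (T s) (act y v) = act y (act s v) + act (- \<Delta> s) v
       \<and> act (T s * y) v = act (T s) (act y v) \<and> act (y * s) v = act y (act s v)"
    if l: "\<forall>a b. \<forall>v\<in>M. act (a * b) v = act a (act b v)" and "s \<in> S" "v \<in> M" for s v
  proof -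
    have "act (y * s) v = act (T s * y) v + act (\<Delta> s) v"
      using rel[OF \<open>s \<in> S\<close>] act_add[OF \<open>v \<in> M\<close>] by simp
    then show ?thesis using l that act_minus by simp
  qed
  have swap': "act s (act y v) = act y (act (T s) v) + act (\<Delta> s) v"
    if r: "\<forall>a b. \<forall>v\<in>M. act (a * b) v = act b (act a v)" and "s \<in> S" "v \<in> M" for s v
  proof -
    have "act (y * s) v = act (T s * y) v + act (\<Delta> s) v"
      using rel[OF \<open>s \<in> S\<close>] act_add[OF \<open>v \<in> M\<close>] by simp
    then show ?thesis using r that by simp
  qed
  have comm: "\<forall>v\<in>M. \<omega> (act y v) = act y (\<omega> v) + act 0 v" if "\<omega> \<in> \<Omega>" for \<omega>
    using commute[OF that] act_zero by simp
  interpret skew_operator "\<Omega> \<union> act ` S" "act y" M N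
  proof
    show "noetherian (\<Omega> \<union> act ` S) N" "N \<subseteq> M" by fact+
    show "submod (insert (act y) (\<Omega> \<union> act ` S)) M" by (rule submod_antimono[OF M]) auto
    show "additive_on M \<omega>" if "\<omega> \<in> insert (act y) (\<Omega> \<union> act ` S)" for \<omega>
      by (rule additive) (use that in auto)
  next
    fix \<omega> assume "\<omega> \<in> \<Omega> \<union> act ` S"
    then consider "\<omega> \<in> \<Omega>" | s where "s \<in> S" "\<omega> = act s" by blast
    then show "\<exists>\<omega>'\<in>\<Omega> \<union> act ` S. \<exists>\<omega>''\<in>\<Omega> \<union> act ` S. \<forall>v\<in>M. \<omega> (act y v) = act y (\<omega>' v) + \<omega>'' v"
    proof cases
      case 1
      then show ?thesis using comm[OF 1] zero by blast
    next
      case 2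
      from act_mult show ?thesis
      proof
        assume l: "\<forall>a b. \<forall>v\<in>M. act (a * b) v = act a (act b v)"
        obtain s' where s': "s' \<in> S" "T s' = s" using Tinv[OF 2(1)] by blast
        have "\<forall>v\<in>M. \<omega> (act y v) = act y (act s' v) + act (- \<Delta> s') v"
          using swap[OF l s'(1)] s' 2 by simp
        then show ?thesis using s'(1) subring_minus[OF S \<Delta>] by blast
      next
        assume r: "\<forall>a b. \<forall>v\<in>M. act (a * b) v = act b (act a v)"
        have "\<forall>v\<in>M. \<omega> (act y v) = act y (act (T s) v) + act (\<Delta> s) v"
          using swap'[OF r 2(1)] 2 by simp
        then show ?thesis using TS \<Delta> 2(1) by blast
      qed
    qed
  next
    fix \<omega> assume "\<omega> \<in> \<Omega> \<union> act ` S"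
    then consider "\<omega> \<in> \<Omega>" | s where "s \<in> S" "\<omega> = act s" by blast
    then show "\<exists>\<omega>'\<in>\<Omega> \<union> act ` S. \<exists>\<omega>''\<in>\<Omega> \<union> act ` S. \<forall>v\<in>M. \<omega>' (act y v) = act y (\<omega> v) + \<omega>'' v"
    proof cases
      case 1
      then show ?thesis using comm[OF 1] zero by blast
    next
      case 2
      from act_mult show ?thesis
      proof
        assume l: "\<forall>a b. \<forall>v\<in>M. act (a * b) v = act a (act b v)"
        have "\<forall>v\<in>M. act (T s) (act y v) = act y (\<omega> v) + act (- \<Delta> s) v"
          using swap[OF l 2(1)] 2 by simp
        then show ?thesis using TS subring_minus[OF S \<Delta>] 2(1) by blast
      next
        assume r: "\<forall>a b. \<forall>v\<in>M. act (a * b) v = act b (act a v)"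
        obtain s' where s': "s' \<in> S" "T s' = s" using Tinv[OF 2(1)] by blast
        have "\<forall>v\<in>M. act s' (act y v) = act y (\<omega> v) + act (\<Delta> s') v"
          using swap'[OF r s'(1)] s' 2 by simp
        then show ?thesis using s'(1) \<Delta> by blast
      qed
    qed
  qed
  let ?Z = "{r. \<forall>v\<in>polys. act r v \<in> polys}"
  have sm: "submod (\<Omega> \<union> act ` S) polys" by (rule submod_antimono[OF polys_submod]) auto
  have sub: "subring ?Z" by (rule stabilizer_subring[OF sm polys_sub subring_one[OF S]])
  have "insert y S \<subseteq> ?Z" using submod_op[OF polys_submod] by blast
  then have "subring hull (insert y S) \<subseteq> ?Z" using sub by (rule hull_minimal)
  then have st: "act r v \<in> polys" if "r \<in> insert y S'" "v \<in> polys" for r v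
    using that S' \<open>insert y S \<subseteq> ?Z\<close> by blast
  have "noetherian (\<Omega> \<union> act ` S') polys"
  proof (rule noetherian_more_operators[OF noetherian_polys])
    show "insert (act y) (\<Omega> \<union> act ` S) \<subseteq> \<Omega> \<union> act ` S'" using S'(1) by blast
    show "submod (\<Omega> \<union> act ` S') polys"
      using polys_submod st unfolding submod_def by blast
  qed
  then show ?thesis using N_polys polys_sub by blast
qed

end

section \<open>Left noetherian subrings of a division ring\<close>

definition left_noetherian :: "'a::ring_1 set \<Rightarrow> bool" where
  "left_noetherian S \<longleftrightarrow> subring S \<and> noetherian ((*) ` S) S"

definition division_subring :: "'a::division_ring set \<Rightarrow> bool" where
  "division_subring D \<longleftrightarrow> subring D \<and> (\<forall>d\<in>D. inverse d \<in> D)"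

lemma noetherian_subset:
  assumes "noetherian \<Omega> N" "submod \<Omega> N'" "N' \<subseteq> N"
  shows "noetherian \<Omega> N'"
  unfolding noetherian_def
proof (intro conjI allI impI)
  fix P assume P: "\<forall>i. submod \<Omega> (P i) \<and> P i \<subseteq> N' \<and> P i \<subseteq> P (Suc i)"
  then have 1: "submod \<Omega> (P i)" "P i \<subseteq> P (Suc i)" for i by simp_all
  have 2: "P i \<subseteq> N" for i using P assms(3) by (meson order_trans)
  show "\<exists>m. \<forall>i\<ge>m. P i = P m"
    by (rule noetherian_chain[where P = P, OF assms(1) 1(1) 2 1(2)]) blast
qed (rule assms(2))

lemma subring_submod: "subring S \<Longrightarrow> submod ((*) ` S) S"
  unfolding submod_def by (auto intro: subring_zero subring_diff subring_mult)

lemma left_noetherianI: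
  assumes "subring S" "noetherian ((*) ` S) N" "1 \<in> N"
  shows "left_noetherian S"
proof -
  have "S \<subseteq> N"
  proof
    fix s assume "s \<in> S"
    then have "s * 1 \<in> N"
      using assms submod_op[of "(*) ` S" N "(*) s" 1] unfolding noetherian_def by blast
    then show "s \<in> N" by simp
  qed
  then show ?thesis
    unfolding left_noetherian_def
    using assms noetherian_subset subring_submod by blast
qed

lemma left_mult_action: "ring_action (*) (UNIV :: 'a::ring_1 set) {}"
  by unfold_locales (auto simp: submod_def additive_on_def algebra_simps)

lemma left_noetherian_extension:
  fixes S :: "'a::ring_1 set"
  assumes "left_noetherian S" "bij_betw T S S" "\<And>s. s \<in> S \<Longrightarrow> \<Delta> s \<in> S"
    and "\<And>s. s \<in> S \<Longrightarrow> y * s = T s * y + \<Delta> s"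
    and "subring S'" "insert y S \<subseteq> S'" "S' \<subseteq> subring hull (insert y S)"
  shows "left_noetherian S'"
proof -
  have S: "subring S" "noetherian ({} \<union> (*) ` S) S"
    using assms(1) unfolding left_noetherian_def by auto
  obtain N' where "S \<subseteq> N'" "noetherian ({} \<union> (*) ` S') N'"
    using ring_action.noetherian_extension[OF left_mult_action S(1) assms(2-4) S(2) subset_UNIV assms(6,7)]
    by blast
  then show ?thesis
    using left_noetherianI[OF assms(5)] subring_one[OF S(1)] by auto
qed

text \<open>
  For left ideals and for left subspaces: the sum of \<open>H\<close> and \<open>S z\<close>.
\<close>

lemma submod_adjoin:
  assumes S: "subring S" and H: "submod ((*) ` S) H"
  shows "submod ((*) ` S) {h + c * z | h c. h \<in> H \<and> c \<in> S}" (is "submod _ ?X")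
    and "H \<subseteq> {h + c * z | h c. h \<in> H \<and> c \<in> S}" and "z \<in> {h + c * z | h c. h \<in> H \<and> c \<in> S}"
proof -
  have I: "a \<in> ?X" if "a = h + c * z" "h \<in> H" "c \<in> S" for a h c using that by blast
  show HX: "H \<subseteq> ?X"
  proof
    fix h assume "h \<in> H"
    then show "h \<in> ?X" using I[of h h 0] subring_zero[OF S] by simp
  qed
  show "z \<in> ?X" by (rule I[OF _ submod_zero[OF H] subring_one[OF S]]) simp
  have "a - b \<in> ?X" if ab: "a \<in> ?X" "b \<in> ?X" for a b
  proof -
    obtain h c h' c' where *: "a = h + c * z" "h \<in> H" "c \<in> S" "b = h' + c' * z" "h' \<in> H" "c' \<in> S"
      using ab by blast
    show ?thesis
      by (rule I[OF _ submod_diff[OF H *(2,5)] subring_diff[OF S *(3,6)]]) (simp add: * algebra_simps)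
  qed
  moreover have "s * a \<in> ?X" if a: "a \<in> ?X" and s: "s \<in> S" for a s
  proof -
    obtain h c where *: "a = h + c * z" "h \<in> H" "c \<in> S" using a by blast
    show ?thesis
      by (rule I[OF _ submod_op[OF H imageI[OF s] *(2)] subring_mult[OF S s *(3)]])
        (simp add: * algebra_simps)
  qed
  ultimately show "submod ((*) ` S) ?X"
    using subsetD[OF HX submod_zero[OF H]] unfolding submod_def by blast
qed

text \<open>
  A line over a division ring has no submodules other than zero and itself.
\<close>

lemma noetherian_line:
  fixes act :: "'a::division_ring \<Rightarrow> 'm::ab_group_add \<Rightarrow> 'm"
  assumes D: "division_subring D" and diff: "\<And>a b. act (a - b) v = act a v - act b v"
    and mult: "\<And>a b. act (a * b) v = act a (act b v)"
  shows "noetherian (act ` D) ((\<lambda>c. act c v) ` D)"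
proof (rule noetherian_simple)
  have S: "subring D" and inv: "\<And>d. d \<in> D \<Longrightarrow> inverse d \<in> D"
    using D unfolding division_subring_def by auto
  let ?N = "(\<lambda>c. act c v) ` D"
  have I: "act c v \<in> ?N" if "c \<in> D" for c using that by (rule imageI)
  have zero: "act 0 v = 0" using diff[of 0 0] by simp
  have "act a v - act b v \<in> ?N" "act a (act b v) \<in> ?N" if "a \<in> D" "b \<in> D" for a b
    using I[OF subring_diff[OF S that]] I[OF subring_mult[OF S that]] by (simp_all add: diff mult)
  then show "submod (act ` D) ?N"
    unfolding submod_def using I[OF subring_zero[OF S]] by (simp add: zero)
  fix P assume P: "submod (act ` D) P" "P \<subseteq> ?N"
  have "P = ?N" if p: "p \<in> P" "p \<noteq> 0" for p
  proof -
    obtain b where b: "b \<in> D" "p = act b v" using subsetD[OF P(2) p(1)] by (elim imageE)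
    have "b \<noteq> 0" using b(2) p(2) zero by auto
    have "act c v \<in> P" if c: "c \<in> D" for c
    proof -
      have "act (c * inverse b) p \<in> P"
        by (rule submod_op[OF P(1) imageI[OF subring_mult[OF S c inv[OF b(1)]]] p(1)])
      then show ?thesis using \<open>b \<noteq> 0\<close> unfolding b(2) mult[symmetric] by (simp add: mult.assoc)
    qed
    then show ?thesis using P(2) by (intro subset_antisym) (simp_all add: image_subset_iff)
  qed
  then show "P = {0} \<or> P = ?N" using submod_zero[OF P(1)] by blast
qed

lemma division_subring_left_noetherian:
  assumes "division_subring D"
  shows "left_noetherian D"
  using noetherian_line[OF assms, of "(*)" 1] assms
  unfolding left_noetherian_def division_subring_def by (simp add: left_diff_distrib mult.assoc)

text \<open>
  The partial sums of \<open>C q + C q p + C q p\<^sup>2 + \<dots>\<close>. If \<open>C q\<close> and \<open>C p\<close> met only in zero, this sum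
  would be direct, so the Ore condition follows from the ascending chain condition.
\<close>

primrec geometric_left_ideal :: "'a::ring_1 set \<Rightarrow> 'a \<Rightarrow> 'a \<Rightarrow> nat \<Rightarrow> 'a set" where
  "geometric_left_ideal C q p 0 = {0}"
| "geometric_left_ideal C q p (Suc i) =
     {w + c * (q * p ^ i) | w c. w \<in> geometric_left_ideal C q p i \<and> c \<in> C}"

lemma geometric_submod:
  assumes "subring C" "p \<in> C" "q \<in> C"
  shows "submod ((*) ` C) (geometric_left_ideal C q p i) \<and> geometric_left_ideal C q p i \<subseteq> C"
proof (induction i)
  case 0
  then show ?case using subring_zero[OF assms(1)] by (auto simp: submod_def)
next
  case (Suc i)
  have "geometric_left_ideal C q p (Suc i) \<subseteq> C"
    using Suc assms by (auto intro!: subring_add subring_mult subring_power)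
  then show ?case using submod_adjoin(1)[OF assms(1) conjunct1[OF Suc]] by simp
qed

lemma geometric_factor:
  assumes "x \<in> geometric_left_ideal C q p (Suc i)"
  shows "\<exists>c\<in>C. \<exists>w\<in>geometric_left_ideal C q p i. x = c * q + w * p"
  using assms
proof (induction i arbitrary: x)
  case 0
  then show ?case by auto
next
  case (Suc i)
  then obtain c w where *: "x = w + c * (q * p ^ Suc i)" "c \<in> C" "w \<in> geometric_left_ideal C q p (Suc i)"
    by auto
  obtain c' w' where **: "c' \<in> C" "w' \<in> geometric_left_ideal C q p i" "w = c' * q + w' * p"
    using Suc.IH[OF *(3)] by blast
  have "x = c' * q + (w' + c * (q * p ^ i)) * p"
    unfolding * ** by (simp add: algebra_simps power_commutes)
  moreover have "w' + c * (q * p ^ i) \<in> geometric_left_ideal C q p (Suc i)" using * ** by auto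
  ultimately show ?case using **(1) by blast
qed

text \<open>
  Once the chain is stationary, \<open>q p\<^sup>m = c q + w p\<close> with \<open>w\<close> a combination of lower powers. If
  \<open>c \<noteq> 0\<close>, this exhibits a common left multiple of \<open>q\<close> and \<open>p\<close>; if \<open>c = 0\<close>, then \<open>p\<close> cancels on the right
  and \<open>m\<close> drops.
\<close>

lemma left_Ore:
  fixes C :: "'a::division_ring set"
  assumes C: "left_noetherian C" and p: "p \<in> C" "p \<noteq> 0" and q: "q \<in> C"
  shows "\<exists>p'\<in>C. \<exists>q'\<in>C. p' \<noteq> 0 \<and> p' * q = q' * p"
proof -
  let ?P = "geometric_left_ideal C q p"
  have sr: "subring C" and nC: "noetherian ((*) ` C) C"
    using C unfolding left_noetherian_def by auto
  have P: "submod ((*) ` C) (?P i)" "?P i \<subseteq> C" for i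
    using geometric_submod[OF sr p(1) q] by auto
  have up: "?P i \<subseteq> ?P (Suc i)" and mem: "q * p ^ i \<in> ?P (Suc i)" for i
    using submod_adjoin(2,3)[OF sr P(1)[of i], of "q * p ^ i"] by simp_all
  obtain m where m: "\<And>i. i \<ge> m \<Longrightarrow> ?P i = ?P m"
    by (rule noetherian_chain[where P = ?P, OF nC P up]) (rule that)
  have "q * p ^ m \<in> ?P m" using mem[of m] m[of "Suc m"] by (metis le_SucI le_refl)
  then show ?thesis
  proof (induction m)
    case 0
    then have "1 * q = 0 * p" by simp
    then show ?case using subring_one[OF sr] subring_zero[OF sr] by (metis zero_neq_one)
  next
    case (Suc m)
    obtain c w where *: "c \<in> C" "w \<in> ?P m" "q * p ^ Suc m = c * q + w * p"
      using geometric_factor[OF Suc.prems] by blast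
    have e: "(q * p ^ m - w) * p = c * q"
      using *(3) by (simp add: algebra_simps power_commutes)
    show ?case
    proof (cases "c = 0")
      case True
      then have "q * p ^ m = w" using e p by simp
      then show ?thesis using Suc.IH *(2) by blast
    next
      case False
      have "q * p ^ m - w \<in> C"
        using * P(2) q p(1) sr by (auto intro!: subring_diff subring_mult subring_power)
      then show ?thesis using False e *(1) by metis
    qed
  qed
qed

definition left_fractions :: "'a::division_ring set \<Rightarrow> 'a set" where
  "left_fractions C = {d. \<exists>p\<in>C. p \<noteq> 0 \<and> p * d \<in> C}"

lemma left_fractions_sub: "subring C \<Longrightarrow> C \<subseteq> left_fractions C"
  unfolding left_fractions_def using subring_one by force

lemma left_fractions_division_subring:
  assumes C: "left_noetherian C"
  shows "division_subring (left_fractions C)"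
  unfolding division_subring_def subring_def
proof (intro conjI ballI)
  have sr: "subring C" using C unfolding left_noetherian_def by auto
  show "1 \<in> left_fractions C" using left_fractions_sub[OF sr] subring_one[OF sr] by blast
  fix a assume "a \<in> left_fractions C"
  then obtain p where p: "p \<in> C" "p \<noteq> 0" "p * a \<in> C" unfolding left_fractions_def by blast
  show "inverse a \<in> left_fractions C"
  proof (cases "a = 0")
    case True
    then show ?thesis using left_fractions_sub[OF sr] subring_zero[OF sr] by auto
  next
    case False
    then have "(p * a) * inverse a \<in> C" "p * a \<noteq> 0" using p by (auto simp: mult.assoc)
    then show ?thesis using p unfolding left_fractions_def by blast
  qed
  fix b assume "b \<in> left_fractions C"
  then obtain q where q: "q \<in> C" "q \<noteq> 0" "q * b \<in> C" unfolding left_fractions_def by blast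
  obtain p' q' where 1: "p' \<in> C" "q' \<in> C" "p' \<noteq> 0" "p' * p = q' * q"
    using left_Ore[OF C q(1,2) p(1)] by blast
  have "p' * p * (a - b) = p' * (p * a) - q' * (q * b)"
    unfolding right_diff_distrib by (simp add: mult.assoc[symmetric] 1(4))
  then have "p' * p * (a - b) \<in> C" "p' * p \<in> C" "p' * p \<noteq> 0"
    using 1 p q sr by (auto intro!: subring_diff subring_mult)
  then show "a - b \<in> left_fractions C" unfolding left_fractions_def by blast
  obtain p' q' where 2: "p' \<in> C" "q' \<in> C" "p' \<noteq> 0" "p' * (p * a) = q' * q"
    using left_Ore[OF C q(1,2) p(3)] by blast
  have "p' * p * (a * b) = (p' * (p * a)) * b" by (simp add: mult.assoc)
  also have "\<dots> = q' * (q * b)" unfolding 2(4) by (simp add: mult.assoc)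
  finally have "p' * p * (a * b) \<in> C" "p' * p \<in> C" "p' * p \<noteq> 0"
    using 2(1-3) p q sr by (auto intro!: subring_mult)
  then show "a * b \<in> left_fractions C" unfolding left_fractions_def by blast
qed

section \<open>Iterated skew polynomial algebras\<close>

lemma subring_sum: "subring S \<Longrightarrow> (\<And>i. i \<in> I \<Longrightarrow> f i \<in> S) \<Longrightarrow> (\<Sum>i\<in>I. f i) \<in> S"
  by (induction I rule: infinite_finite_induct) (auto intro: subring_zero subring_add)

lemma skew_polynomial_ring_generated:
  assumes "skew_polynomial_ring S y \<tau> \<delta> T"
  shows "T \<subseteq> subring hull (insert y S)"
proof
  fix t assume "t \<in> T"
  then obtain c where c: "range c \<subseteq> S" "t = (\<Sum>i | c i \<noteq> 0. c i * y ^ i)"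
    using assms unfolding skew_polynomial_ring_def by blast
  have "c i * y ^ i \<in> subring hull (insert y S)" for i
    using c(1) by (intro subring_mult[OF subring_hull] subring_power[OF subring_hull]) (auto intro!: hull_inc)
  then show "t \<in> subring hull (insert y S)"
    unfolding c(2) by (intro subring_sum[OF subring_hull])
qed

lemma skew_polynomial_ringD:
  assumes "skew_polynomial_ring S y \<tau> \<delta> T"
  shows "subring S" "subring T" "insert y S \<subseteq> T" "bij_betw \<tau> S S" "\<And>s. s \<in> S \<Longrightarrow> \<delta> s \<in> S"
    "\<And>s. s \<in> S \<Longrightarrow> y * s = \<tau> s * y + \<delta> s"
  using assms unfolding skew_polynomial_ring_def ring_automorphism_on_def skew_derivation_on_def
  by auto

locale iterated_algebra =
  fixes K :: "'a::division_ring set" and n x \<tau> \<delta> R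
  assumes iterated: "iterated_skew_polynomial_algebra K n x \<tau> \<delta> R"
begin

lemma K_division_subring: "division_subring K"
  and R_zero: "R 0 = K"
  using iterated unfolding iterated_skew_polynomial_algebra_def subfield_def division_subring_def
  by auto

lemma K_subring: "subring K"
  using K_division_subring unfolding division_subring_def by blast

lemma K_inverse: "c \<in> K \<Longrightarrow> inverse c \<in> K"
  using K_division_subring unfolding division_subring_def by blast

lemma K_commute: "a \<in> K \<Longrightarrow> b \<in> K \<Longrightarrow> a * b = b * a"
  using iterated unfolding iterated_skew_polynomial_algebra_def subfield_def by auto

lemma step:
  assumes "i < n"
  shows "skew_polynomial_ring (R i) (x (Suc i)) (\<tau> (Suc i)) (\<delta> (Suc i)) (R (Suc i))"
    and "linear_over_on K (R i) (\<tau> (Suc i))" "linear_over_on K (R i) (\<delta> (Suc i))"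
proof -
  have "Suc i \<in> {1..n}" "Suc i - 1 = i" using assms by auto
  then show "skew_polynomial_ring (R i) (x (Suc i)) (\<tau> (Suc i)) (\<delta> (Suc i)) (R (Suc i))"
    "linear_over_on K (R i) (\<tau> (Suc i))" "linear_over_on K (R i) (\<delta> (Suc i))"
    using iterated unfolding iterated_skew_polynomial_algebra_def by metis+
qed

lemma R_subring: "i \<le> n \<Longrightarrow> subring (R i)"
  by (cases i) (use R_zero K_subring skew_polynomial_ringD(2)[OF step(1)] in auto)

lemma K_sub_R: "i \<le> n \<Longrightarrow> K \<subseteq> R i"
proof (induction i)
  case (Suc i)
  then show ?case using skew_polynomial_ringD(3)[OF step(1), of i] by auto
qed (simp add: R_zero)

text \<open>
  Linearity gives \<open>\<tau> c = c \<tau> 1 = c\<close> and \<open>\<delta> c = c \<delta> 1 = 0\<close>, so every variable commutes with \<open>K\<close>.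
\<close>

lemma K_central_R: "i \<le> n \<Longrightarrow> c \<in> K \<Longrightarrow> r \<in> R i \<Longrightarrow> c * r = r * c"
proof (induction i arbitrary: r)
  case 0
  then show ?case using K_commute R_zero by auto
next
  case (Suc i)
  then have i: "i < n" by simp
  note R = skew_polynomial_ringD[OF step(1)[OF i]]
  have K: "K \<subseteq> R i" using K_sub_R i by simp
  have one: "1 \<in> R i" using subring_one[OF R(1)] .
  have "\<tau> (Suc i) (c * 1) = c * \<tau> (Suc i) 1" "\<delta> (Suc i) (c * 1) = c * \<delta> (Suc i) 1"
    using step(2,3)[OF i] Suc.prems(2) one unfolding linear_over_on_def by blast+
  moreover have "\<tau> (Suc i) 1 = 1"
    using step(1)[OF i] unfolding skew_polynomial_ring_def ring_automorphism_on_def by blast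
  moreover have "\<delta> (Suc i) (1 * 1) = \<tau> (Suc i) 1 * \<delta> (Suc i) 1 + \<delta> (Suc i) 1 * 1"
    using step(1)[OF i] one unfolding skew_polynomial_ring_def skew_derivation_on_def by blast
  ultimately have "\<tau> (Suc i) c = c" "\<delta> (Suc i) c = 0" by auto
  then have xc: "x (Suc i) * c = c * x (Suc i)"
    using R(6)[of c] K Suc.prems(2) by auto
  have "subring {r. c * r = r * c}"
    unfolding subring_def by (auto simp: algebra_simps) (metis mult.assoc)
  moreover have "insert (x (Suc i)) (R i) \<subseteq> {r. c * r = r * c}"
    using Suc xc by auto
  ultimately have "subring hull (insert (x (Suc i)) (R i)) \<subseteq> {r. c * r = r * c}"
    by (intro hull_minimal)
  then show ?case
    using Suc.prems skew_polynomial_ring_generated[OF step(1)[OF i]] by blast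
qed

lemma noetherian_R:
  assumes "ring_action act M \<Omega>" "noetherian (\<Omega> \<union> act ` K) N" "N \<subseteq> M" "i \<le> n"
  shows "\<exists>N'. N \<subseteq> N' \<and> N' \<subseteq> M \<and> noetherian (\<Omega> \<union> act ` R i) N'"
  using assms(4)
proof (induction i)
  case 0
  then show ?case using assms R_zero by auto
next
  case (Suc i)
  then obtain N1 where N1: "N \<subseteq> N1" "N1 \<subseteq> M" "noetherian (\<Omega> \<union> act ` R i) N1" by auto
  have i: "i < n" using Suc by simp
  note R = skew_polynomial_ringD[OF step(1)[OF i]]
  obtain N2 where "N1 \<subseteq> N2" "N2 \<subseteq> M" "noetherian (\<Omega> \<union> act ` R (Suc i)) N2"
    using ring_action.noetherian_extension[OF assms(1) R(1,4,5,6) N1(3,2) R(3)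
        skew_polynomial_ring_generated[OF step(1)[OF i]]] by blast
  then show ?case using N1(1) by blast
qed

lemma left_noetherian_R: "i \<le> n \<Longrightarrow> left_noetherian (R i)"
proof -
  assume i: "i \<le> n"
  have "noetherian ({} \<union> (*) ` K) K"
    using division_subring_left_noetherian[OF K_division_subring] unfolding left_noetherian_def by simp
  then obtain N where "K \<subseteq> N" "noetherian ({} \<union> (*) ` R i) N"
    using noetherian_R[OF left_mult_action _ subset_UNIV i] by blast
  then show ?thesis
    using left_noetherianI[OF R_subring[OF i]] subring_one[OF K_subring] by auto
qed

end

section \<open>Division subalgebras satisfy the ascending chain condition\<close>

text \<open>
  A left \<open>D\<close>-linear map with values in \<open>D\<close> that separates \<open>1\<close> from \<open>d\<close>. By Zorn's lemma there is a
  maximal subspace \<open>H\<close> that contains \<open>1\<close> but not \<open>d\<close>; maximality makes \<open>D d\<close> a complement of \<open>H\<close>,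
  and the map is the coordinate of \<open>d\<close>.
\<close>

lemma separating_functional:
  fixes D :: "'a::division_ring set"
  assumes D: "division_subring D" and d: "d \<notin> D"
  shows "\<exists>\<phi>. (\<forall>u v. \<phi> (u + v) = \<phi> u + \<phi> v) \<and> (\<forall>c\<in>D. \<forall>z. \<phi> (c * z) = c * \<phi> z) \<and> \<phi> 1 = 0 \<and> \<phi> d = 1"
proof -
  have sr: "subring D" and inv: "\<And>c. c \<in> D \<Longrightarrow> inverse c \<in> D"
    using D unfolding division_subring_def by auto
  define \<A> where "\<A> = {H. submod ((*) ` D) H \<and> 1 \<in> H \<and> d \<notin> H}"
  have "D \<in> \<A>" unfolding \<A>_def using subring_submod[OF sr] subring_one[OF sr] d by blast
  moreover have "\<Union>C \<in> \<A>" if C: "C \<noteq> {}" "subset.chain \<A> C" for C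
  proof -
    have C1: "H \<in> \<A>" if "H \<in> C" for H using C(2) that unfolding subset.chain_def by blast
    have C2: "H \<subseteq> H' \<or> H' \<subseteq> H" if "H \<in> C" "H' \<in> C" for H H'
      using C(2) that unfolding subset.chain_def by blast
    have "p - q \<in> \<Union>C" if pq: "p \<in> \<Union>C" "q \<in> \<Union>C" for p q
    proof -
      obtain H H' where H: "H \<in> C" "H' \<in> C" "p \<in> H" "q \<in> H'" using pq by blast
      then obtain H'' where "H'' \<in> C" "p \<in> H''" "q \<in> H''" using C2[OF H(1,2)] by blast
      then show ?thesis using C1 submod_diff unfolding \<A>_def by blast
    qed
    moreover have "\<omega> p \<in> \<Union>C" if "p \<in> \<Union>C" "\<omega> \<in> (*) ` D" for p \<omega>
      using that C1 submod_op unfolding \<A>_def by blast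
    moreover have "0 \<in> \<Union>C" "1 \<in> \<Union>C" "d \<notin> \<Union>C"
      using C(1) C1 submod_zero unfolding \<A>_def by blast+
    ultimately show ?thesis unfolding \<A>_def submod_def by blast
  qed
  ultimately obtain H where H: "H \<in> \<A>" and max: "\<And>X. X \<in> \<A> \<Longrightarrow> H \<subseteq> X \<Longrightarrow> X = H"
    using subset_Zorn_nonempty[of \<A>] by blast
  have Hs: "submod ((*) ` D) H" "1 \<in> H" "d \<notin> H" using H unfolding \<A>_def by auto
  have Hm: "c * h \<in> H" if "c \<in> D" "h \<in> H" for c h using that submod_op[OF Hs(1)] by blast
  have ex: "\<exists>c\<in>D. z - c * d \<in> H" for z
  proof (cases "z \<in> H")
    case True
    then show ?thesis using subring_zero[OF sr] by force
  next
    case False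
    define X where "X = {h + c * z | h c. h \<in> H \<and> c \<in> D}"
    have X: "submod ((*) ` D) X" and HX: "H \<subseteq> X" and zX: "z \<in> X"
      unfolding X_def by (rule submod_adjoin[OF sr Hs(1)])+
    have "d \<in> X" using max[of X] X HX zX False Hs(2) unfolding \<A>_def by blast
    then obtain h c where hc: "d = h + c * z" "h \<in> H" "c \<in> D" unfolding X_def by blast
    then have "c \<noteq> 0" using Hs(3) by auto
    then have "z - inverse c * d = 0 - inverse c * h"
      unfolding hc(1) by (simp add: algebra_simps mult.assoc[symmetric])
    then have "z - inverse c * d \<in> H"
      using submod_diff[OF Hs(1) submod_zero[OF Hs(1)] Hm[OF inv[OF hc(3)] hc(2)]] by simp
    then show ?thesis using inv[OF hc(3)] by blast
  qed
  have uniq: "c = c'" if "c \<in> D" "c' \<in> D" "z - c * d \<in> H" "z - c' * d \<in> H" for c c' z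
  proof (rule ccontr)
    assume "c \<noteq> c'"
    have "(c' - c) * d \<in> H"
      using submod_diff[OF Hs(1) that(3,4)] by (simp add: algebra_simps)
    then have "inverse (c' - c) * ((c' - c) * d) \<in> H"
      using Hm inv subring_diff[OF sr] that(1,2) by blast
    then show False using Hs(3) \<open>c \<noteq> c'\<close> by (simp add: mult.assoc[symmetric])
  qed
  obtain \<phi> where \<phi>: "\<And>z. \<phi> z \<in> D" "\<And>z. z - \<phi> z * d \<in> H" using ex by metis
  have "\<phi> (u + v) = \<phi> u + \<phi> v" for u v
  proof (rule uniq[OF \<phi>(1) _ \<phi>(2)])
    show "\<phi> u + \<phi> v \<in> D" using \<phi>(1) subring_add[OF sr] by blast
    have "u + v - (\<phi> u + \<phi> v) * d = (u - \<phi> u * d) + (v - \<phi> v * d)" by (simp add: algebra_simps)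
    then show "u + v - (\<phi> u + \<phi> v) * d \<in> H" using submod_add[OF Hs(1)] \<phi>(2) by metis
  qed
  moreover have "\<phi> (c * z) = c * \<phi> z" if c: "c \<in> D" for c z
  proof (rule uniq[OF \<phi>(1) _ \<phi>(2)])
    show "c * \<phi> z \<in> D" using \<phi>(1) subring_mult[OF sr] c by blast
    have "c * z - c * \<phi> z * d = c * (z - \<phi> z * d)" by (simp add: algebra_simps)
    then show "c * z - c * \<phi> z * d \<in> H" using Hm[OF c] \<phi>(2) by metis
  qed
  moreover have "\<phi> 1 = 0"
    by (rule uniq[OF \<phi>(1) _ \<phi>(2)]) (use Hs(2) subring_zero[OF sr] in auto)
  moreover have "\<phi> d = 1"
    by (rule uniq[OF \<phi>(1) _ \<phi>(2)]) (use subring_one[OF sr] submod_zero[OF Hs(1)] in auto)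
  ultimately show ?thesis by blast
qed

locale iterated_fractions = iterated_algebra +
  assumes fractions: "division_ring_of_fractions (R n)"
begin

lemma left_fraction: "\<exists>a\<in>R n. \<exists>b\<in>R n. b \<noteq> 0 \<and> q = inverse b * a"
  and right_fraction: "\<exists>a\<in>R n. \<exists>b\<in>R n. b \<noteq> 0 \<and> q = a * inverse b"
  using fractions unfolding division_ring_of_fractions_def by metis+

lemma K_central: 
  assumes "c \<in> K"
  shows "c * q = q * c"
proof -
  obtain a b where ab: "a \<in> R n" "b \<in> R n" "b \<noteq> 0" "q = a * inverse b"
    using right_fraction by blast
  have "c * a = a * c" "c * b = b * c" using K_central_R[OF order_refl assms] ab(1,2) by simp_all
  have "inverse b * c = inverse b * (c * b) * inverse b" using ab(3) by (simp add: mult.assoc)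
  also have "\<dots> = c * inverse b"
    unfolding \<open>c * b = b * c\<close> using ab(3) by (simp add: mult.assoc[symmetric])
  finally have "a * (inverse b * c) = c * (a * inverse b)"
    using \<open>c * a = a * c\<close> by (simp add: mult.assoc[symmetric])
  then show ?thesis unfolding ab(4) by (simp add: mult.assoc)
qed

text \<open>
  In a counterexample there are division subrings \<open>D m\<close> containing \<open>d 0, \<dots>, d m\<close> but not
  \<open>d (m + 1)\<close>, with separating functionals \<open>\<phi> m\<close>. The bimodule \<open>R n \<otimes>\<^sub>K R n\<close> is represented by its
  action on these functionals: \<open>a \<otimes> b\<close> becomes the function \<open>j z \<mapsto> a \<phi>\<^sub>j (b z)\<close>. The elements that
  vanish at all \<open>j \<ge> m\<close> form an ascending chain of sub-bimodules. It is strict: if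
  \<open>d = s\<inverse> r = r' s'\<inverse>\<close> is \<open>d (m + 1)\<close>, then \<open>r \<otimes> s' - s \<otimes> r' = s (d \<otimes> 1 - 1 \<otimes> d) s'\<close> vanishes at
  all \<open>j > m\<close>, since \<open>\<phi>\<^sub>j\<close> is linear over \<open>d\<close>, but it does not vanish at \<open>j = m\<close>.
\<close>

theorem division_subring_acc:
  fixes d :: "nat \<Rightarrow> 'a"
  shows "\<exists>m. \<forall>D. division_subring D \<and> K \<subseteq> D \<and> (\<forall>i\<le>m. d i \<in> D) \<longrightarrow> d (Suc m) \<in> D"
proof (rule ccontr)
  assume "\<not> ?thesis"
  then have "\<forall>m. \<exists>D. division_subring D \<and> K \<subseteq> D \<and> (\<forall>i\<le>m. d i \<in> D) \<and> d (Suc m) \<notin> D" by blast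
  from choice[OF this] obtain D where D: "\<And>m. division_subring (D m)" "\<And>m. K \<subseteq> D m"
      "\<And>m i. i \<le> m \<Longrightarrow> d i \<in> D m" "\<And>m. d (Suc m) \<notin> D m" by auto
  obtain \<phi> where \<phi>: "\<And>m u v. \<phi> m (u + v) = \<phi> m u + \<phi> m v"
      "\<And>m c z. c \<in> D m \<Longrightarrow> \<phi> m (c * z) = c * \<phi> m z" "\<And>m. \<phi> m 1 = 0" "\<And>m. \<phi> m (d (Suc m)) = 1"
    using separating_functional[OF D(1,4)] by metis
  \<comment> \<open>\<open>L a\<close> and \<open>B b\<close> are the multiplications \<open>t \<mapsto> a t\<close> and \<open>t \<mapsto> t b\<close> of the bimodule; the element
    \<open>1 \<otimes> 1\<close> is \<open>\<phi>\<close> itself.\<close>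
  define L :: "'a \<Rightarrow> (nat \<Rightarrow> 'a \<Rightarrow> 'a) \<Rightarrow> (nat \<Rightarrow> 'a \<Rightarrow> 'a)" where "L a v = (\<lambda>j z. a * v j z)" for a v
  define B :: "'a \<Rightarrow> (nat \<Rightarrow> 'a \<Rightarrow> 'a) \<Rightarrow> (nat \<Rightarrow> 'a \<Rightarrow> 'a)" where "B b v = (\<lambda>j z. v j (b * z))" for b v
  define M :: "(nat \<Rightarrow> 'a \<Rightarrow> 'a) set" where
    "M = {v. \<forall>j. (\<forall>z z'. v j (z + z') = v j z + v j z') \<and> (\<forall>c\<in>K. \<forall>z. v j (c * z) = c * v j z)}"
  have M0: "0 \<in> M" and Mdiff: "\<And>u v. u \<in> M \<Longrightarrow> v \<in> M \<Longrightarrow> u - v \<in> M"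
    unfolding M_def by (auto simp: algebra_simps)
  have ac: "a * (c * z) = c * (a * z)" if "c \<in> K" for a c z
    using K_central[OF that, of a] by (simp add: mult.assoc[symmetric])
  have M_L: "L a v \<in> M" if "v \<in> M" for a v
    using that unfolding M_def L_def by (simp add: distrib_left ac)
  have M_B: "B b v \<in> M" if "v \<in> M" for b v
    using that unfolding M_def B_def by (simp add: distrib_left ac)
  have Mz: "v j (z + z') = v j z + v j z'" if "v \<in> M" for v j z z'
    using that unfolding M_def by blast
  have actL: "ring_action L M {}"
    by unfold_locales
      (use M0 Mdiff M_L in \<open>auto simp: submod_def additive_on_def L_def fun_eq_iff algebra_simps\<close>)
  have actB: "ring_action B M (L ` R n)"
  proof unfold_locales
    show "submod (L ` R n \<union> range B) M"
      using M0 Mdiff M_L M_B unfolding submod_def by blast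
    show "additive_on M \<omega>" if "\<omega> \<in> L ` R n \<union> range B" for \<omega>
      using that by (auto simp: additive_on_def L_def B_def fun_eq_iff algebra_simps)
    show "B (a + b) v = B a v + B b v" if "v \<in> M" for a b v
      using Mz[OF that] by (simp add: B_def fun_eq_iff distrib_right)
    show "(\<forall>a b. \<forall>v\<in>M. B (a * b) v = B a (B b v)) \<or> (\<forall>a b. \<forall>v\<in>M. B (a * b) v = B b (B a v))"
      by (simp add: B_def fun_eq_iff mult.assoc)
    show "\<omega> (B a v) = B a (\<omega> v)" if "\<omega> \<in> L ` R n" for \<omega> a v
      using that by (auto simp: L_def B_def)
  qed
  have \<phi>M: "\<phi> \<in> M" unfolding M_def using \<phi>(1,2) D(2) by blast
  \<comment> \<open>The extension process starts from the line \<open>K (1 \<otimes> 1)\<close>, first on the left, then on the right.\<close>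
  define N0 where "N0 = (\<lambda>c. L c \<phi>) ` K"
  have "noetherian ({} \<union> L ` K) N0"
    unfolding N0_def Un_empty_left
    by (rule noetherian_line[OF K_division_subring])
      (simp_all add: L_def fun_eq_iff left_diff_distrib mult.assoc)
  moreover have "N0 \<subseteq> M" unfolding N0_def using M_L[OF \<phi>M] by (simp add: image_subset_iff)
  ultimately have "\<exists>N'. N0 \<subseteq> N' \<and> N' \<subseteq> M \<and> noetherian ({} \<union> L ` R n) N'"
    by (rule noetherian_R[OF actL _ _ order_refl])
  then obtain N1 where N1: "N0 \<subseteq> N1" "N1 \<subseteq> M" "noetherian (L ` R n) N1"
    by auto
  \<comment> \<open>The right extensions start with the scalars from \<open>K\<close>, which act as on the left.\<close>
  have "B c v = L c v" if "c \<in> K" "v \<in> N1" for c v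
    using subsetD[OF N1(2) that(2)] that(1) unfolding M_def L_def B_def by simp
  moreover have "submod (L ` R n) N1" using N1(3) unfolding noetherian_def by simp
  ultimately have "submod (L ` R n \<union> B ` K) N1"
    using K_sub_R[OF order_refl] unfolding submod_def by (simp add: ball_Un subset_iff)
  with N1(3) Un_upper1 have "noetherian (L ` R n \<union> B ` K) N1"
    by (rule noetherian_more_operators)
  note nN1 = this
  have "\<exists>N'. N1 \<subseteq> N' \<and> N' \<subseteq> M \<and> noetherian (L ` R n \<union> B ` R n) N'"
    by (rule noetherian_R[OF actB nN1 N1(2) order_refl])
  then obtain N2 where N2: "N1 \<subseteq> N2" "noetherian (L ` R n \<union> B ` R n) N2"
    by blast
  have N2s: "submod (L ` R n \<union> B ` R n) N2" using N2(2) unfolding noetherian_def by simp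
  have "L 1 \<phi> \<in> N0" unfolding N0_def by (rule imageI[OF subring_one[OF K_subring]])
  moreover have "L 1 \<phi> = \<phi>" by (simp add: L_def)
  ultimately have \<phi>N2: "\<phi> \<in> N2" using subsetD[OF N2(1)] subsetD[OF N1(1)] by metis
  have T: "L a (B b \<phi>) \<in> N2" if "a \<in> R n" "b \<in> R n" for a b
  proof -
    have "B b \<phi> \<in> N2" using submod_op[OF N2s, of "B b" \<phi>] \<phi>N2 that(2) by simp
    then show ?thesis using submod_op[OF N2s, of "L a" "B b \<phi>"] that(1) by simp
  qed
  define P where "P m = {v \<in> N2. \<forall>j\<ge>m. \<forall>z. v j z = 0}" for m
  have "submod (L ` R n \<union> B ` R n) (P m)" for m
    using N2s unfolding submod_def P_def by (auto simp: L_def B_def)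
  moreover have "P m \<subseteq> N2" "P m \<subseteq> P (Suc m)" for m unfolding P_def by auto
  ultimately obtain m where m: "\<And>i. i \<ge> m \<Longrightarrow> P i = P m"
    using noetherian_chain[where P = P, OF N2(2)] by blast
  obtain r s where rs: "r \<in> R n" "s \<in> R n" "s \<noteq> 0" "d (Suc m) = inverse s * r"
    using left_fraction by blast
  obtain r' s' where rs': "r' \<in> R n" "s' \<in> R n" "s' \<noteq> 0" "d (Suc m) = r' * inverse s'"
    using right_fraction by blast
  define v where "v = L r (B s' \<phi>) - L s (B r' \<phi>)"
  have v: "v j z = r * \<phi> j (s' * z) - s * \<phi> j (r' * z)" for j z
    unfolding v_def L_def B_def by simp
  have sd: "s * d (Suc m) = r"
    using rs(3) unfolding rs(4) by (simp add: mult.assoc[symmetric])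
  have ds: "d (Suc m) * s' = r'"
    using rs'(3) unfolding rs'(4) by (simp add: mult.assoc)
  have "v j z = 0" if "j \<ge> Suc m" for j z
  proof -
    have "r' * z = d (Suc m) * (s' * z)" using ds by (simp add: mult.assoc[symmetric])
    then have "\<phi> j (r' * z) = d (Suc m) * \<phi> j (s' * z)" using \<phi>(2)[OF D(3)[OF that]] by simp
    then show ?thesis unfolding v using sd by (simp add: mult.assoc[symmetric])
  qed
  moreover have "v \<in> N2"
    unfolding v_def by (rule submod_diff[OF N2s T[OF rs(1) rs'(2)] T[OF rs(2) rs'(1)]])
  ultimately have "v \<in> P (Suc m)" unfolding P_def by blast
  then have "v \<in> P m" using m[of "Suc m"] by auto
  then have "v m (inverse s') = 0" unfolding P_def by blast
  then have "r * \<phi> m 1 - s * \<phi> m (d (Suc m)) = 0"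
    unfolding v using rs'(3,4) by simp
  then show False using \<phi>(3,4) rs(3) by simp
qed

end

section \<open>Fractions of skew polynomials over a division ring\<close>

primrec left_polys :: "'a::ring_1 set \<Rightarrow> 'a \<Rightarrow> nat \<Rightarrow> 'a set" where
  "left_polys D y 0 = {0}"
| "left_polys D y (Suc n) = {c * y ^ n + w | c w. c \<in> D \<and> w \<in> left_polys D y n}"

inductive_set products :: "'a::ring_1 set \<Rightarrow> 'a set" for G where
  one: "1 \<in> products G"
| snoc: "b \<in> products G \<Longrightarrow> g \<in> G \<Longrightarrow> b * g \<in> products G"

lemma products_mono:
  assumes "G \<subseteq> H"
  shows "products G \<subseteq> products H"
proof
  fix b assume "b \<in> products G"
  then show "b \<in> products H" by induction (use assms in \<open>auto intro: products.intros\<close>)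
qed

lemma products_mult:
  assumes "a \<in> products G" "b \<in> products G"
  shows "a * b \<in> products G"
  using assms(2)
proof induction
  case (snoc b g)
  then show ?case using products.snoc[of "a * b" G g] by (simp add: mult.assoc)
qed (use assms in simp)

text \<open>
  All elements of the type are left fractions of the skew polynomial ring \<open>D[y; T, \<Delta>]\<close> over the
  division ring \<open>D\<close>; condition \<open>indep\<close> says that the powers of \<open>y\<close> are left independent over \<open>D\<close>.
\<close>

locale skew_fraction_ring =
  fixes D :: "'a::division_ring set" and y :: 'a and T \<Delta> :: "'a \<Rightarrow> 'a"
  assumes D: "division_subring D"
    and T_D: "\<And>d. d \<in> D \<Longrightarrow> T d \<in> D"
    and T_nonzero: "\<And>d. d \<in> D \<Longrightarrow> d \<noteq> 0 \<Longrightarrow> T d \<noteq> 0"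
    and \<Delta>_D: "\<And>d. d \<in> D \<Longrightarrow> \<Delta> d \<in> D"
    and rel: "\<And>d. d \<in> D \<Longrightarrow> y * d = T d * y + \<Delta> d"
    and indep: "\<And>n. y ^ n \<notin> left_polys D y n"
    and left_fraction: "\<And>q. \<exists>n. \<exists>b\<in>left_polys D y n. b \<noteq> 0 \<and> (\<exists>m. b * q \<in> left_polys D y m)"
begin

abbreviation "A \<equiv> left_polys D y"

text \<open>
  The skew polynomial ring \<open>D[y; T, \<Delta>]\<close> itself.
\<close>

definition S :: "'a set" where "S = (\<Union>n. A n)"

lemma D_subring: "subring D" and D_inverse: "d \<in> D \<Longrightarrow> inverse d \<in> D"
  using D unfolding division_subring_def by auto

lemmas D_closed = subring_zero[OF D_subring] subring_one[OF D_subring] subring_add[OF D_subring]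
  subring_diff[OF D_subring] subring_mult[OF D_subring] subring_minus[OF D_subring] D_inverse

lemma A_SucI: "c \<in> D \<Longrightarrow> w \<in> A n \<Longrightarrow> c * y ^ n + w \<in> A (Suc n)"
  by auto

lemma A_SucE:
  assumes "a \<in> A (Suc n)"
  obtains c w where "c \<in> D" "w \<in> A n" "a = c * y ^ n + w"
  using assms by auto

lemma A_zero: "0 \<in> A n"
  by (induction n) (use A_SucI[OF subring_zero[OF D_subring]] in force)+

lemma A_diff: "a \<in> A n \<Longrightarrow> b \<in> A n \<Longrightarrow> a - b \<in> A n"
proof (induction n arbitrary: a b)
  case (Suc n)
  obtain c w where a: "c \<in> D" "w \<in> A n" "a = c * y ^ n + w" using Suc.prems(1) by (rule A_SucE)
  obtain c' w' where b: "c' \<in> D" "w' \<in> A n" "b = c' * y ^ n + w'" using Suc.prems(2) by (rule A_SucE)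
  have "a - b = (c - c') * y ^ n + (w - w')" unfolding a b by (simp add: algebra_simps)
  then show ?case using A_SucI[OF D_closed(4)[OF a(1) b(1)] Suc.IH[OF a(2) b(2)]] by metis
qed simp

lemma A_add: "a \<in> A n \<Longrightarrow> b \<in> A n \<Longrightarrow> a + b \<in> A n"
  using A_diff[of a n "0 - b"] A_diff[OF A_zero, of b n] by simp

lemma A_scale: "d \<in> D \<Longrightarrow> a \<in> A n \<Longrightarrow> d * a \<in> A n"
proof (induction n arbitrary: a)
  case (Suc n)
  obtain c w where a: "c \<in> D" "w \<in> A n" "a = c * y ^ n + w" using Suc.prems(2) by (rule A_SucE)
  have "d * a = (d * c) * y ^ n + d * w" unfolding a by (simp add: algebra_simps)
  then show ?case using A_SucI[OF D_closed(5)[OF Suc.prems(1) a(1)] Suc.IH[OF Suc.prems(1) a(2)]] by metis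
qed simp

lemma A_Suc: "A n \<subseteq> A (Suc n)"
proof
  fix a assume "a \<in> A n"
  then show "a \<in> A (Suc n)" using A_SucI[OF subring_zero[OF D_subring], of a n] by simp
qed

lemma A_mono: "m \<le> n \<Longrightarrow> a \<in> A m \<Longrightarrow> a \<in> A n"
  using lift_Suc_mono_le[of A m n, OF A_Suc] by blast

lemma y_leading_term:
  assumes "c \<in> D" "y * w \<in> A (Suc n)"
  shows "\<exists>v\<in>A (Suc n). y * (c * y ^ n + w) = T c * y ^ Suc n + v"
proof
  show "y * (c * y ^ n + w) = T c * y ^ Suc n + (\<Delta> c * y ^ n + y * w)"
    by (simp add: distrib_left mult.assoc[symmetric] rel[OF assms(1)]) (simp add: distrib_right mult.assoc)
  show "\<Delta> c * y ^ n + y * w \<in> A (Suc n)"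
    using A_add[OF A_SucI[OF \<Delta>_D[OF assms(1)] A_zero] assms(2)] by simp
qed

lemma A_y: "a \<in> A n \<Longrightarrow> y * a \<in> A (Suc n)"
proof (induction n arbitrary: a)
  case 0
  then show ?case using A_zero[of "Suc 0"] by simp
next
  case (Suc n)
  obtain c w where a: "c \<in> D" "w \<in> A n" "a = c * y ^ n + w" using Suc.prems(1) by (rule A_SucE)
  then show ?case using y_leading_term[OF a(1) Suc.IH[OF a(2)]] A_SucI[OF T_D[OF a(1)]] by metis
qed

lemma A_pow: "a \<in> A n \<Longrightarrow> y ^ j * a \<in> A (j + n)"
proof (induction j)
  case (Suc j)
  then show ?case using A_y[of "y ^ j * a"] by (simp add: mult.assoc del: left_polys.simps)
qed simp

lemma A_mult: "a \<in> A m \<Longrightarrow> b \<in> A (Suc n) \<Longrightarrow> a * b \<in> A (m + n)"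
proof (induction m arbitrary: a)
  case 0
  then show ?case using A_zero by simp
next
  case (Suc m)
  obtain c w where a: "c \<in> D" "w \<in> A m" "a = c * y ^ m + w" using Suc.prems(1) by (rule A_SucE)
  have "c * (y ^ m * b) \<in> A (Suc m + n)"
    using A_scale[OF a(1) A_pow[OF Suc.prems(2), of m]] by (simp del: left_polys.simps)
  moreover have "w * b \<in> A (Suc m + n)"
    using A_mono[of "m + n" "Suc m + n"] Suc.IH[OF a(2) Suc.prems(2)] by simp
  ultimately show ?case
    using A_add unfolding a(3) by (simp add: distrib_right mult.assoc del: left_polys.simps)
qed

lemma A_one: "A (Suc 0) = D"
  by auto

lemma S_I: "a \<in> A n \<Longrightarrow> a \<in> S"
  unfolding S_def by blast

lemma S_E: 
  assumes "a \<in> S"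
  obtains n where "a \<in> A n"
  using assms unfolding S_def by blast

lemma D_S: "D \<subseteq> S"
  using S_I[of _ "Suc 0"] A_one by blast

lemma S_subring: "subring S"
  unfolding subring_def
proof (intro conjI ballI)
  show "1 \<in> S" using D_S D_closed(2) by blast
  fix a b assume "a \<in> S" "b \<in> S"
  then obtain m n where "a \<in> A m" "b \<in> A n" by (elim S_E)
  then have ab: "a \<in> A (max m n)" "b \<in> A (max m n)" "b \<in> A (Suc n)" "a \<in> A m"
    using A_mono[of m "max m n"] A_mono[of n "max m n"] A_mono[of n "Suc n"]
    by (simp_all del: left_polys.simps)
  show "a - b \<in> S" by (rule S_I[OF A_diff[OF ab(1,2)]])
  show "a * b \<in> S" by (rule S_I[OF A_mult[OF ab(4,3)]])
qed

lemmas S_closed = subring_zero[OF S_subring] subring_one[OF S_subring] subring_add[OF S_subring]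
  subring_diff[OF S_subring] subring_mult[OF S_subring]

definition has_degree :: "nat \<Rightarrow> 'a \<Rightarrow> bool" where
  "has_degree n a \<longleftrightarrow> a \<in> A (Suc n) \<and> a \<notin> A n"

lemma has_degree_iff: "has_degree n a \<longleftrightarrow> (\<exists>c\<in>D. \<exists>w\<in>A n. c \<noteq> 0 \<and> a = c * y ^ n + w)"
proof
  assume a: "has_degree n a"
  then have "a \<in> A (Suc n)" unfolding has_degree_def by blast
  then obtain c w where *: "c \<in> D" "w \<in> A n" "a = c * y ^ n + w" by (rule A_SucE)
  then have "c \<noteq> 0" using a unfolding has_degree_def by auto
  then show "\<exists>c\<in>D. \<exists>w\<in>A n. c \<noteq> 0 \<and> a = c * y ^ n + w" using * by blast
next
  assume "\<exists>c\<in>D. \<exists>w\<in>A n. c \<noteq> 0 \<and> a = c * y ^ n + w"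
  then obtain c w where *: "c \<in> D" "w \<in> A n" "c \<noteq> 0" "a = c * y ^ n + w" by blast
  have "a \<notin> A n"
  proof
    assume "a \<in> A n"
    then have "inverse c * (a - w) \<in> A n" using A_scale A_diff D_inverse * by blast
    moreover have "inverse c * (a - w) = y ^ n" using * by (simp add: mult.assoc[symmetric])
    ultimately show False using indep by simp
  qed
  then show "has_degree n a" unfolding has_degree_def using A_SucI * by simp
qed

lemma degree_exists:
  assumes "a \<in> A n" "a \<noteq> 0"
  shows "\<exists>m<n. has_degree m a"
  using assms
proof (induction n)
  case (Suc n)
  show ?case
  proof (cases "a \<in> A n")
    case True
    then show ?thesis using Suc by (meson less_SucI)
  next
    case False
    then show ?thesis using Suc.prems(1) unfolding has_degree_def by blast
  qed
qed simp

lemma degree_unique: "has_degree m a \<Longrightarrow> has_degree n a \<Longrightarrow> m = n"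
  using A_mono[of "Suc m" n a] A_mono[of "Suc n" m a] unfolding has_degree_def
  by (metis Suc_leI linorder_neqE_nat)

lemma degree_nonzero: "has_degree n a \<Longrightarrow> a \<noteq> 0"
  using A_zero unfolding has_degree_def by blast

lemma degree_S: "has_degree n a \<Longrightarrow> a \<in> S"
  using S_I unfolding has_degree_def by blast

lemma degree_0_iff: "has_degree 0 a \<longleftrightarrow> a \<in> D \<and> a \<noteq> 0"
  unfolding has_degree_def A_one by simp

lemma degree_y: 
  assumes "has_degree n a"
  shows "has_degree (Suc n) (y * a)"
proof -
  obtain c w where *: "c \<in> D" "w \<in> A n" "c \<noteq> 0" "a = c * y ^ n + w"
    using assms unfolding has_degree_iff by blast
  then show ?thesis
    unfolding has_degree_iff using y_leading_term[OF *(1) A_y[OF *(2)]] T_D[OF *(1)] T_nonzero[OF *(1,3)]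
    by metis
qed

lemma degree_pow: "has_degree n a \<Longrightarrow> has_degree (j + n) (y ^ j * a)"
proof (induction j)
  case (Suc j)
  then show ?case using degree_y[of "j + n" "y ^ j * a"] by (simp add: mult.assoc)
qed simp

text \<open>
  The leading coefficient of the product is \<open>c T\<^sup>m(e)\<close> for leading coefficients \<open>c\<close> and \<open>e\<close> of the
  factors, and \<open>T\<close> does not annihilate nonzero elements of \<open>D\<close>.
\<close>

lemma degree_mult:
  assumes "has_degree m a" "has_degree n b"
  shows "has_degree (m + n) (a * b)"
proof -
  obtain c w where a: "c \<in> D" "w \<in> A m" "c \<noteq> 0" "a = c * y ^ m + w"
    using assms(1) unfolding has_degree_iff by blast
  obtain e v where b: "e \<in> D" "v \<in> A (m + n)" "e \<noteq> 0" "y ^ m * b = e * y ^ (m + n) + v"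
    using degree_pow[OF assms(2), of m] unfolding has_degree_iff by blast
  have "w * b \<in> A (m + n)" using A_mult[OF a(2)] assms(2) unfolding has_degree_def by blast
  then have "c * v + w * b \<in> A (m + n)" using A_add A_scale a b by blast
  moreover have "a * b = (c * e) * y ^ (m + n) + (c * v + w * b)"
    unfolding a(4) by (simp only: distrib_right mult.assoc b(4) distrib_left add.assoc)
  moreover have "c * e \<in> D" "c * e \<noteq> 0" using a b D_closed by auto
  ultimately show ?thesis unfolding has_degree_iff by blast
qed

lemma division:
  assumes b: "has_degree m b" and a: "a \<in> A n"
  shows "\<exists>q\<in>S. a - q * b \<in> A m"
  using a
proof (induction n arbitrary: a)
  case 0
  then show ?case using S_closed(1) A_zero by force
next
  case (Suc n)
  show ?case
  proof (cases "Suc n \<le> m")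
    case True
    then have "a - 0 * b \<in> A m" using A_mono[OF True Suc.prems] by simp
    then show ?thesis using S_closed(1) by blast
  next
    case False
    then obtain j where j: "n = j + m" by (metis add.commute le_add_diff_inverse not_less_eq_eq)
    obtain c w where a: "c \<in> D" "w \<in> A n" "a = c * y ^ n + w" using Suc.prems(1) by (rule A_SucE)
    obtain e v where e: "e \<in> D" "v \<in> A n" "e \<noteq> 0" "y ^ j * b = e * y ^ n + v"
      using degree_pow[OF b, of j] unfolding has_degree_iff j by blast
    define r where "r = c * inverse e"
    have r: "r \<in> D" unfolding r_def by (rule D_closed(5)[OF a(1) D_inverse[OF e(1)]])
    have "r * (y ^ j * b) = c * y ^ n + r * v"
      unfolding e(4) r_def using e(3) by (simp add: distrib_left mult.assoc[symmetric])
        (simp add: mult.assoc)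
    then have "a - r * (y ^ j * b) = w - r * v" unfolding a by simp
    also have "\<dots> \<in> A n" by (rule A_diff[OF a(2) A_scale[OF r e(2)]])
    finally obtain q where q: "q \<in> S" "a - r * (y ^ j * b) - q * b \<in> A m" using Suc.IH by blast
    have "y ^ j \<in> S" using S_I[OF A_pow[of 1 "Suc 0" j]] A_one D_closed(2) by simp
    then have "r * y ^ j + q \<in> S" by (rule S_closed(3)[OF S_closed(5)[OF subsetD[OF D_S r]] q(1)])
    moreover have "a - (r * y ^ j + q) * b = a - r * (y ^ j * b) - q * b"
      by (simp add: algebra_simps)
    ultimately show ?thesis using q(2) by metis
  qed
qed

definition left_ideal :: "'a \<Rightarrow> 'a set" where "left_ideal p = (\<lambda>q. q * p) ` S"

lemma left_idealI: "q \<in> S \<Longrightarrow> q * p \<in> left_ideal p"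
  unfolding left_ideal_def by blast

lemma left_ideal_diff: "a \<in> left_ideal p \<Longrightarrow> b \<in> left_ideal p \<Longrightarrow> a - b \<in> left_ideal p"
  unfolding left_ideal_def using S_closed(4) by (force simp: left_diff_distrib[symmetric])

lemma left_ideal_mult: "a \<in> left_ideal p \<Longrightarrow> s \<in> S \<Longrightarrow> s * a \<in> left_ideal p"
  unfolding left_ideal_def using S_closed(5) by (force simp: mult.assoc[symmetric])

lemma left_ideal_zero: "0 \<in> left_ideal p"
  using left_idealI[OF S_closed(1), of p] by simp

lemma left_ideal_submod: "submod ((*) ` S) (left_ideal p)"
  unfolding submod_def using left_ideal_zero left_ideal_diff left_ideal_mult by blast

lemma left_ideal_S: "p \<in> S \<Longrightarrow> left_ideal p \<subseteq> S"
  unfolding left_ideal_def using S_closed(5) by blast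

lemma principal:
  assumes I: "submod ((*) ` S) I" "I \<subseteq> S" "a \<in> I" "a \<noteq> 0"
  shows "\<exists>x\<in>I. x \<noteq> 0 \<and> I = left_ideal x"
proof -
  have deg: "\<exists>m. has_degree m b" if "b \<in> I" "b \<noteq> 0" for b
    using that I(2) degree_exists by (meson S_E subsetD)
  define n where "n = (LEAST n. \<exists>x\<in>I. has_degree n x)"
  have "\<exists>x\<in>I. has_degree n x"
    unfolding n_def by (rule LeastI_ex) (use deg I in blast)
  then obtain x where x: "x \<in> I" "has_degree n x" by blast
  have "I \<subseteq> left_ideal x"
  proof
    fix b assume b: "b \<in> I"
    then obtain m where "b \<in> A m" using I(2) by (meson S_E subsetD)
    then obtain q where q: "q \<in> S" "b - q * x \<in> A n" using division[OF x(2)] by blast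
    have "b - q * x \<in> I"
      using submod_diff[OF I(1) b] submod_op[OF I(1) _ x(1)] q(1) by blast
    moreover have "\<not> has_degree m (b - q * x)" if "m < n" "b - q * x \<in> I" for m
      using not_less_Least[of m "\<lambda>n. \<exists>x\<in>I. has_degree n x"] that unfolding n_def by blast
    ultimately have "b - q * x = 0" using degree_exists[OF q(2)] by blast
    then show "b \<in> left_ideal x" using left_idealI[OF q(1), of x] by simp
  qed
  moreover have "left_ideal x \<subseteq> I"
    using submod_op[OF I(1) _ x(1)] unfolding left_ideal_def by blast
  ultimately show ?thesis using x degree_nonzero by blast
qed

text \<open>
  A generator of a maximal left ideal.
\<close>

definition atom :: "'a \<Rightarrow> bool" where
  "atom p \<longleftrightarrow> p \<in> S \<and> p \<noteq> 0 \<and> 1 \<notin> left_ideal p \<and>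
     (\<forall>a\<in>S. a \<notin> left_ideal p \<longrightarrow> (\<exists>s\<in>S. s * a - 1 \<in> left_ideal p))"

lemma constant_in_left_ideal:
  assumes "has_degree n p" "n > 0" "d \<in> D" "d \<in> left_ideal p"
  shows "d = 0"
proof (rule ccontr)
  assume "d \<noteq> 0"
  obtain q where q: "q \<in> S" "d = q * p" using assms(4) unfolding left_ideal_def by blast
  then have "q \<noteq> 0" using \<open>d \<noteq> 0\<close> by auto
  then obtain m where "has_degree m q" using q(1) degree_exists by (meson S_E)
  then have "has_degree (m + n) d" using degree_mult assms(1) q(2) by simp
  moreover have "has_degree 0 d" using degree_0_iff assms(3) \<open>d \<noteq> 0\<close> by blast
  ultimately show False using degree_unique assms(2) by (metis add_is_0 less_irrefl)
qed

text \<open>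
  A right factor of least positive degree is an atom: a proper left ideal above it is generated by
  another right factor, whose degree cannot be smaller.
\<close>

lemma atomic_right_factor:
  assumes b: "has_degree n b" "n > 0"
  shows "\<exists>p b'. atom p \<and> b' \<in> S \<and> b = b' * p \<and> (\<exists>m<n. has_degree m b')"
proof -
  define Q where "Q m p \<longleftrightarrow> m > 0 \<and> has_degree m p \<and> b \<in> left_ideal p" for m p
  have "Q n b" unfolding Q_def using b left_idealI[OF S_closed(2), of b] by simp
  define m where "m = (LEAST m. \<exists>p. Q m p)"
  have "\<exists>p. Q m p" unfolding m_def by (rule LeastI_ex) (use \<open>Q n b\<close> in blast)
  then obtain p where p: "Q m p" by blast
  have least: "m \<le> k" if "Q k z" for k z
    unfolding m_def by (rule Least_le) (use that in blast)
  have pd: "has_degree m p" "m > 0" "b \<in> left_ideal p" using p unfolding Q_def by auto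
  have "\<exists>s\<in>S. s * a - 1 \<in> left_ideal p" if a: "a \<in> S" "a \<notin> left_ideal p" for a
  proof -
    define J where "J = {v + u * a | v u. v \<in> left_ideal p \<and> u \<in> S}"
    have J: "submod ((*) ` S) J" "left_ideal p \<subseteq> J" "a \<in> J"
      unfolding J_def by (rule submod_adjoin[OF S_subring left_ideal_submod])+
    have "J \<subseteq> S"
      using left_ideal_S[OF degree_S[OF pd(1)]] a(1) unfolding J_def
      by (auto intro!: S_closed(3,5))
    have pJ: "p \<in> J" using subsetD[OF J(2) left_idealI[OF S_closed(2), of p]] by simp
    obtain z where z: "z \<in> J" "z \<noteq> 0" "J = left_ideal z"
      using principal[OF J(1) \<open>J \<subseteq> S\<close> pJ degree_nonzero[OF pd(1)]] by metis
    have zS: "z \<in> S" using \<open>J \<subseteq> S\<close> z by blast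
    then obtain k where k: "has_degree k z" using degree_exists z(2) by (meson S_E)
    obtain u where u: "u \<in> S" "p = u * z" using pJ unfolding z(3) left_ideal_def by blast
    have "u \<noteq> 0" using u degree_nonzero[OF pd(1)] by auto
    then obtain l where l: "has_degree l u" using degree_exists u(1) by (meson S_E)
    have lk: "m = l + k" using degree_unique[OF pd(1)] degree_mult[OF l k] u(2) by simp
    obtain t where t: "t \<in> S" "b = t * p" using pd(3) unfolding left_ideal_def by blast
    have "b \<in> left_ideal z"
      using left_idealI[OF S_closed(5)[OF t(1) u(1)], of z] unfolding t(2) u(2) by (simp add: mult.assoc)
    then have "k = 0 \<or> m \<le> k" using least[of k z] k unfolding Q_def by auto
    moreover have "l \<noteq> 0"
    proof
      assume "l = 0"
      then have "u \<in> D" "u \<noteq> 0" using l degree_0_iff by auto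
      then have "z = inverse u * p" unfolding u(2) by (simp add: mult.assoc[symmetric])
      then have "z \<in> left_ideal p" using left_idealI[OF subsetD[OF D_S D_inverse[OF \<open>u \<in> D\<close>]], of p] by simp
      moreover obtain s where "s \<in> S" "a = s * z" using J(3) unfolding z(3) left_ideal_def by blast
      ultimately show False using a(2) left_ideal_mult by blast
    qed
    ultimately have "k = 0" using lk by simp
    then have "z \<in> D" "z \<noteq> 0" using k degree_0_iff by auto
    then have "inverse z * z \<in> J" unfolding z(3) by (intro left_idealI subsetD[OF D_S] D_inverse)
    then have "1 \<in> J" using z(2) by simp
    then obtain s v where sv: "1 = v + s * a" "s \<in> S" "v \<in> left_ideal p" unfolding J_def by blast
    then have "s * a - 1 = 0 - v" by (simp add: algebra_simps)
    then have "s * a - 1 \<in> left_ideal p" using left_ideal_diff[OF left_ideal_zero sv(3)] by simp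
    then show ?thesis using sv(2) by blast
  qed
  moreover have "1 \<notin> left_ideal p"
    using constant_in_left_ideal[OF pd(1,2) D_closed(2)] by auto
  ultimately have "atom p"
    unfolding atom_def using degree_S[OF pd(1)] degree_nonzero[OF pd(1)] by blast
  moreover obtain b' where b': "b' \<in> S" "b = b' * p" using pd(3) unfolding left_ideal_def by blast
  moreover have "\<exists>m<n. has_degree m b'"
  proof -
    have "b' \<noteq> 0" using b' degree_nonzero[OF b(1)] by auto
    then obtain l where l: "has_degree l b'" using degree_exists b'(1) by (meson S_E)
    then have "n = l + m" using degree_unique[OF b(1)] degree_mult[OF l pd(1)] b'(2) by simp
    then show ?thesis using l pd(2) by (intro exI[of _ l]) simp
  qed
  ultimately show ?thesis by blast
qed

lemma factorization:
  assumes "has_degree n b"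
  shows "\<exists>P. finite P \<and> (\<forall>p\<in>P. atom p) \<and> b \<in> products (P \<union> (D - {0}))"
  using assms
proof (induction n arbitrary: b rule: less_induct)
  case (less n)
  show ?case
  proof (cases "n = 0")
    case True
    then have "b \<in> D - {0}" using less.prems degree_0_iff by simp
    then have "1 * b \<in> products ({} \<union> (D - {0}))" by (intro products.intros) auto
    then show ?thesis by (intro exI[of _ "{}"]) simp
  next
    case False
    then obtain p b' m where *: "atom p" "b' \<in> S" "b = b' * p" "m < n" "has_degree m b'"
      using atomic_right_factor[OF less.prems] by blast
    then obtain P where P: "finite P" "\<forall>p\<in>P. atom p" "b' \<in> products (P \<union> (D - {0}))"
      using less.IH by blast
    have "b' \<in> products (insert p P \<union> (D - {0}))"
      using P(3) products_mono[of "P \<union> (D - {0})" "insert p P \<union> (D - {0})"] by blast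
    then have "b \<in> products (insert p P \<union> (D - {0}))" unfolding *(3) by (rule products.snoc) simp
    then show ?thesis using P *(1) by (intro exI[of _ "insert p P"]) simp
  qed
qed

text \<open>
  The element \<open>b\<close> acts injectively on the simple module \<open>S/S(y - c)\<close>. An atom \<open>p\<close> that does not is
  one with \<open>S/Sp \<cong> S/S(y - c)\<close>.
\<close>

definition injective_at :: "'a \<Rightarrow> 'a \<Rightarrow> bool" where
  "injective_at c b \<longleftrightarrow> (\<forall>v\<in>S. b * v \<in> left_ideal (y - c) \<longrightarrow> v \<in> left_ideal (y - c))"

text \<open>
  Only atoms and units are admitted as denominators, not all elements that act injectively: an
  element acting injectively may still have a factor that does not, while the proof of the Ore
  condition passes from one factor to the next.
\<close>

definition regular_factors :: "'a \<Rightarrow> 'a set" where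
  "regular_factors c = {g \<in> S. g \<noteq> 0 \<and> injective_at c g \<and> (atom g \<or> g \<in> D)}"

abbreviation "denominators c \<equiv> products (regular_factors c)"

definition local_ring :: "'a \<Rightarrow> 'a set" where
  "local_ring c = {q. \<exists>b\<in>denominators c. b * q \<in> S}"

lemma degree_linear:
  assumes "c \<in> D"
  shows "has_degree 1 (y - c)"
proof -
  have "- c \<in> A 1" using A_one D_closed(6)[OF assms] by simp
  moreover have "y - c = 1 * y ^ 1 + (- c)" by simp
  ultimately show ?thesis unfolding has_degree_iff using D_closed(2) zero_neq_one by metis
qed

lemma linear_constant: "c \<in> D \<Longrightarrow> d \<in> D \<Longrightarrow> d \<in> left_ideal (y - c) \<Longrightarrow> d = 0"
  using constant_in_left_ideal[OF degree_linear] by simp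

lemma linear_remainder:
  assumes "c \<in> D" "v \<in> S"
  shows "\<exists>d\<in>D. v - d \<in> left_ideal (y - c)"
proof -
  obtain n where "v \<in> A n" using assms(2) by (rule S_E)
  then obtain q where q: "q \<in> S" "v - q * (y - c) \<in> A 1"
    using division[OF degree_linear[OF assms(1)]] by blast
  then have "v - q * (y - c) \<in> D" using A_one by simp
  moreover have "v - (v - q * (y - c)) \<in> left_ideal (y - c)" using left_idealI[OF q(1)] by simp
  ultimately show ?thesis by blast
qed

text \<open>
  Unless \<open>a\<close> already lies in \<open>S g\<close>, the class of \<open>a\<close> generates the simple module \<open>S/Sg\<close>, and the
  annihilator of this class is \<open>S x\<close> for some \<open>x\<close>. Then \<open>S/Sx \<cong> S/Sg\<close>, so \<open>x\<close> inherits from \<open>g\<close>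
  that it is an atom and that it acts injectively on \<open>S/S(y - c)\<close>. In the proof, \<open>s\<close> inverts \<open>a\<close>
  modulo \<open>S g\<close>, and right multiplication by \<open>s\<close> is the isomorphism from \<open>S/Sg\<close> to \<open>S/Sx\<close>.
\<close>

lemma regular_factor_Ore:
  assumes g: "g \<in> regular_factors c" and a: "a \<in> S"
  shows "\<exists>b\<in>denominators c. b * a \<in> left_ideal g"
proof (cases "a \<in> left_ideal g")
  case True
  then show ?thesis using products.one by force
next
  case False
  have gS: "g \<in> S" and inj: "injective_at c g" and g0: "g \<noteq> 0"
    using g unfolding regular_factors_def by auto
  have "g \<notin> D"
  proof
    assume "g \<in> D"
    then have "(a * inverse g) * g \<in> left_ideal g"
      by (intro left_idealI S_closed(5)[OF a] subsetD[OF D_S] D_inverse)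
    then show False using False g0 by (simp add: mult.assoc)
  qed
  then have "atom g" using g unfolding regular_factors_def by blast
  then have max: "\<exists>s\<in>S. s * b - 1 \<in> left_ideal g" if "b \<in> S" "b \<notin> left_ideal g" for b
    using that unfolding atom_def by blast
  have "1 \<notin> left_ideal g" using \<open>atom g\<close> unfolding atom_def by blast
  obtain s t where st: "s \<in> S" "t \<in> S" "s * a - 1 = t * g"
    using max[OF a False] unfolding left_ideal_def by blast
  define I where "I = {z \<in> S. z * a \<in> left_ideal g}"
  have I: "submod ((*) ` S) I"
    unfolding submod_def I_def
    using S_closed(1,4,5) left_ideal_zero left_ideal_diff left_ideal_mult
    by (auto simp: left_diff_distrib mult.assoc)
  have sa: "s * a = 1 + t * g" using st(3) by (simp add: algebra_simps)
  have "(g * s) * a = (1 + g * t) * g" by (simp add: mult.assoc sa algebra_simps)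
  then have gs: "g * s \<in> I"
    unfolding I_def using left_idealI[OF S_closed(3)[OF S_closed(2) S_closed(5)[OF gS st(2)]], of g]
      S_closed(5)[OF gS st(1)] by simp
  have "s \<noteq> 0"
  proof
    assume "s = 0"
    then have "1 = (- t) * g" using sa by (simp add: eq_neg_iff_add_eq_0)
    then show False using \<open>1 \<notin> left_ideal g\<close> left_idealI[OF subring_minus[OF S_subring st(2)]] by metis
  qed
  then obtain x where x: "x \<in> I" "x \<noteq> 0" "I = left_ideal x"
    using principal[OF I _ gs] g0 unfolding I_def by auto
  have as: "a * s - 1 \<in> I"
  proof -
    have "(a * s - 1) * a = (a * t) * g" using sa by (simp add: algebra_simps)
    then show ?thesis
      unfolding I_def using left_idealI[OF S_closed(5)[OF a st(2)], of g]
        S_closed(4)[OF S_closed(5)[OF a st(1)] S_closed(2)] by simp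
  qed
  have "atom x"
    unfolding atom_def
  proof (intro conjI ballI impI)
    show "x \<in> S" "x \<noteq> 0" using x unfolding I_def by auto
    show "1 \<notin> left_ideal x" using False unfolding x(3)[symmetric] I_def by simp
    fix z assume z: "z \<in> S" "z \<notin> left_ideal x"
    then have "z * a \<notin> left_ideal g" unfolding x(3)[symmetric] I_def by blast
    then obtain w u where w: "w \<in> S" "u \<in> S" "w * (z * a) - 1 = u * g"
      using max[of "z * a"] S_closed(5) z a unfolding left_ideal_def by blast
    have e: "w * (z * a) = 1 + u * g" using w(3) by (simp add: algebra_simps)
    have "((a * w) * z - 1) * a = (a * u) * g"
      unfolding left_diff_distrib mult.assoc e by (simp add: algebra_simps)
    then have "(a * w) * z - 1 \<in> I"
      unfolding I_def using left_idealI[OF S_closed(5)[OF a w(2)], of g]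
        S_closed(4)[OF S_closed(5)[OF S_closed(5)[OF a w(1)] z(1)] S_closed(2)] by simp
    then show "\<exists>s\<in>S. s * z - 1 \<in> left_ideal x" using S_closed(5)[OF a w(1)] x(3) by blast
  qed
  moreover have "injective_at c x"
    unfolding injective_at_def
  proof (intro ballI impI)
    fix v assume v: "v \<in> S" "x * v \<in> left_ideal (y - c)"
    have Iv: "z * v \<in> left_ideal (y - c)" if z: "z \<in> I" for z
    proof -
      obtain q where "q \<in> S" "z = q * x" using z unfolding x(3) left_ideal_def by blast
      then show ?thesis using left_ideal_mult[OF v(2)] by (simp add: mult.assoc)
    qed
    have "g * (s * v) \<in> left_ideal (y - c)" using Iv[OF gs] by (simp add: mult.assoc)
    then have "s * v \<in> left_ideal (y - c)"
      using inj S_closed(5)[OF st(1) v(1)] unfolding injective_at_def by blast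
    then have "a * (s * v) - (a * s - 1) * v \<in> left_ideal (y - c)"
      by (rule left_ideal_diff[OF left_ideal_mult[OF _ a] Iv[OF as]])
    then show "v \<in> left_ideal (y - c)" by (simp add: algebra_simps)
  qed
  ultimately have "x \<in> regular_factors c" unfolding regular_factors_def atom_def by blast
  then have "1 * x \<in> denominators c" by (intro products.intros)
  moreover have "x * a \<in> left_ideal g" using x(1) unfolding I_def by blast
  ultimately show ?thesis by (metis mult_1_left)
qed

lemma regular_products:
  assumes "b \<in> denominators c"
  shows "b \<in> S \<and> b \<noteq> 0 \<and> injective_at c b"
  using assms
proof induction
  case one
  then show ?case using S_closed unfolding injective_at_def by simp
next
  case (snoc b g)
  then have g: "g \<in> S" "g \<noteq> 0" "injective_at c g" unfolding regular_factors_def by auto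
  have "injective_at c (b * g)"
    using snoc g S_closed(5) unfolding injective_at_def by (metis mult.assoc)
  then show ?case using snoc g S_closed(5) by auto
qed

lemma regular_Ore:
  assumes "b \<in> denominators c" "a \<in> S"
  shows "\<exists>b'\<in>denominators c. \<exists>a'\<in>S. b' * a = a' * b"
  using assms
proof (induction arbitrary: a)
  case one
  then show ?case using products.one by force
next
  case (snoc b g)
  obtain x a1 where x: "x \<in> denominators c" "a1 \<in> S" "x * a = a1 * g"
    using regular_factor_Ore[OF snoc.hyps(2) snoc.prems] unfolding left_ideal_def by blast
  obtain x' a2 where x': "x' \<in> denominators c" "a2 \<in> S" "x' * a1 = a2 * b"
    using snoc.IH[OF x(2)] by blast
  have "(x' * x) * a = x' * a1 * g" by (simp add: mult.assoc x(3))
  also have "\<dots> = a2 * (b * g)" unfolding x'(3) by (simp add: mult.assoc)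
  finally show ?case using products_mult[OF x'(1) x(1)] x'(2) by blast
qed

lemma S_local_ring: "S \<subseteq> local_ring c"
  unfolding local_ring_def using products.one by force

lemma local_ring_subring: "subring (local_ring c)"
  unfolding subring_def
proof (intro conjI ballI)
  show "1 \<in> local_ring c" using S_local_ring S_closed(2) by blast
  fix q1 q2 assume "q1 \<in> local_ring c" "q2 \<in> local_ring c"
  then obtain b1 b2 where b: "b1 \<in> denominators c" "b1 * q1 \<in> S"
    "b2 \<in> denominators c" "b2 * q2 \<in> S" unfolding local_ring_def by blast
  obtain b' a' where 1: "b' \<in> denominators c" "a' \<in> S" "b' * b1 = a' * b2"
    using regular_Ore[OF b(3)] regular_products[OF b(1)] by blast
  have "b' * b1 * (q1 - q2) = b' * (b1 * q1) - a' * (b2 * q2)"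
    unfolding right_diff_distrib by (simp add: mult.assoc[symmetric] 1(3))
  also have "\<dots> \<in> S"
    using regular_products[OF 1(1)] b 1(2) by (auto intro!: S_closed(4,5))
  finally show "q1 - q2 \<in> local_ring c"
    unfolding local_ring_def using products_mult[OF 1(1) b(1)] by blast
  obtain b' a' where 2: "b' \<in> denominators c" "a' \<in> S" "b' * (b1 * q1) = a' * b2"
    using regular_Ore[OF b(3,2)] by blast
  have "b' * b1 * (q1 * q2) = (b' * (b1 * q1)) * q2" by (simp add: mult.assoc)
  also have "\<dots> = a' * (b2 * q2)" unfolding 2(3) by (simp add: mult.assoc)
  also have "\<dots> \<in> S" by (rule S_closed(5)[OF 2(2) b(4)])
  finally show "q1 * q2 \<in> local_ring c"
    unfolding local_ring_def using products_mult[OF 2(1) b(1)] by blast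
qed

text \<open>
  A denominator \<open>b\<close> of the inverse of \<open>y - c\<close> would be a left multiple of \<open>y - c\<close>, so it would
  annihilate the class of \<open>1\<close> in \<open>S/S(y - c)\<close>.
\<close>

lemma local_ring_proper:
  assumes c: "c \<in> D"
  shows "inverse (y - c) \<notin> local_ring c"
proof
  assume "inverse (y - c) \<in> local_ring c"
  then obtain b where b: "b \<in> denominators c" "b * inverse (y - c) \<in> S"
    unfolding local_ring_def by blast
  have "y - c \<noteq> 0" using degree_nonzero[OF degree_linear[OF c]] .
  then have "b * 1 \<in> left_ideal (y - c)" using left_idealI[OF b(2), of "y - c"] by (simp add: mult.assoc)
  then have "1 \<in> left_ideal (y - c)"
    using regular_products[OF b(1)] S_closed(2) unfolding injective_at_def by blast
  then show False using linear_constant[OF c D_closed(2)] by simp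
qed

text \<open>
  Take the atomic factors of denominators of the generators. If all of them acted injectively for
  some \<open>c\<close>, then \<open>local_ring c\<close> would contain all generators.
\<close>

theorem finitely_many_singular_atoms:
  assumes X: "finite X" "subring hull (D \<union> X) = UNIV"
  shows "\<exists>P. finite P \<and> (\<forall>p\<in>P. atom p) \<and> (\<forall>c\<in>D. \<exists>p\<in>P. \<not> injective_at c p)"
proof -
  have "\<exists>P. finite P \<and> (\<forall>p\<in>P. atom p) \<and> (\<exists>b\<in>products (P \<union> (D - {0})). b * q \<in> S)" for q
  proof -
    obtain n b m where b: "b \<in> A n" "b \<noteq> 0" "b * q \<in> A m" using left_fraction by blast
    obtain k where k: "has_degree k b" using degree_exists[OF b(1,2)] by blast
    then show ?thesis using factorization[OF k] S_I[OF b(3)] by blast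
  qed
  then obtain P where P: "\<And>q. finite (P q)" "\<And>q p. p \<in> P q \<Longrightarrow> atom p"
    "\<And>q. \<exists>b\<in>products (P q \<union> (D - {0})). b * q \<in> S" by metis
  define P' where "P' = (\<Union>q\<in>X. P q)"
  have "\<exists>p\<in>P'. \<not> injective_at c p" if c: "c \<in> D" for c
  proof (rule ccontr)
    assume "\<not> ?thesis"
    then have inj: "injective_at c p" if "p \<in> P'" for p using that by blast
    have "P' \<subseteq> regular_factors c"
      using inj P(2) unfolding regular_factors_def P'_def atom_def by blast
    moreover have "d \<in> regular_factors c" if d: "d \<in> D - {0}" for d
    proof -
      have "v \<in> left_ideal (y - c)" if "d * v \<in> left_ideal (y - c)" for v
      proof -
        have "inverse d \<in> S" using d subsetD[OF D_S D_inverse[of d]] by blast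
        then have "inverse d * (d * v) \<in> left_ideal (y - c)" by (rule left_ideal_mult[OF that])
        then show ?thesis using d by (simp add: mult.assoc[symmetric])
      qed
      then show ?thesis using d D_S unfolding regular_factors_def injective_at_def by auto
    qed
    ultimately have "products (P q \<union> (D - {0})) \<subseteq> denominators c" if "q \<in> X" for q
      using that by (intro products_mono) (auto simp: P'_def)
    then have "X \<subseteq> local_ring c" unfolding local_ring_def using P(3) by blast
    moreover have "D \<subseteq> local_ring c" using D_S S_local_ring by blast
    ultimately have "subring hull (D \<union> X) \<subseteq> local_ring c"
      by (intro hull_minimal local_ring_subring) simp
    then show False using X(2) local_ring_proper[OF c] by blast
  qed
  then show ?thesis
    using P(1,2) X(1) by (intro exI[of _ P']) (auto simp: P'_def)
qed

text \<open>
  Representing the annihilated elements by constants gives \<open>p d \<in> S(y - c)\<close> and \<open>p d' \<in> S(y - c')\<close>.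
  Maximality of \<open>S p\<close> forces \<open>(y - c) d\<inverse> \<in> S p\<close>, hence \<open>(y - c) e \<in> S(y - c')\<close> for
  \<open>e = d\<inverse> d'\<close>, and comparison of coefficients gives the equation.
\<close>

theorem singular_atom_eigenvector:
  assumes p: "atom p" and c: "c \<in> D" "\<not> injective_at c p" and c': "c' \<in> D" "\<not> injective_at c' p"
  shows "\<exists>e\<in>D. e \<noteq> 0 \<and> T e * c' + \<Delta> e = c * e"
proof -
  have pS: "p \<in> S" using p unfolding atom_def by blast
  have kernel: "\<exists>d\<in>D. d \<noteq> 0 \<and> p * d \<in> left_ideal (y - c)" if c: "c \<in> D" "\<not> injective_at c p" for c
  proof -
    obtain v where v: "v \<in> S" "p * v \<in> left_ideal (y - c)" "v \<notin> left_ideal (y - c)"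
      using c(2) unfolding injective_at_def by blast
    obtain d where d: "d \<in> D" "v - d \<in> left_ideal (y - c)" using linear_remainder[OF c(1) v(1)] by blast
    have "p * v - p * (v - d) \<in> left_ideal (y - c)"
      using left_ideal_diff[OF v(2) left_ideal_mult[OF d(2) pS]] .
    then have "p * d \<in> left_ideal (y - c)" by (simp add: algebra_simps)
    moreover have "d \<noteq> 0" using v(3) d(2) by auto
    ultimately show ?thesis using d(1) by blast
  qed
  obtain d where d: "d \<in> D" "d \<noteq> 0" "p * d \<in> left_ideal (y - c)" using kernel[OF c] by blast
  obtain d' where d': "d' \<in> D" "d' \<noteq> 0" "p * d' \<in> left_ideal (y - c')" using kernel[OF c'] by blast
  have yS: "y - c \<in> S" by (rule degree_S[OF degree_linear[OF c(1)]])
  have id: "inverse d \<in> S" "d \<in> S" using D_S D_inverse d by auto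
  have "(y - c) * inverse d \<in> left_ideal p"
  proof (rule ccontr)
    assume "(y - c) * inverse d \<notin> left_ideal p"
    then obtain s t where st: "s \<in> S" "t \<in> S" "s * ((y - c) * inverse d) - 1 = t * p"
      using p S_closed(5)[OF yS id(1)] unfolding atom_def left_ideal_def by blast
    have "s * (y - c) - d = (s * ((y - c) * inverse d) - 1) * d"
      using d(2) by (simp add: left_diff_distrib mult.assoc)
    also have "\<dots> = t * (p * d)" unfolding st(3) by (simp add: mult.assoc)
    also have "\<dots> \<in> left_ideal (y - c)" using left_ideal_mult[OF d(3) st(2)] .
    finally have "s * (y - c) - (s * (y - c) - d) \<in> left_ideal (y - c)"
      by (rule left_ideal_diff[OF left_idealI[OF st(1)]])
    then show False using linear_constant[OF c(1) d(1)] d(2) by simp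
  qed
  then obtain t where t: "t \<in> S" "(y - c) * inverse d = t * p" unfolding left_ideal_def by blast
  define e where "e = inverse d * d'"
  have e: "e \<in> D" "e \<noteq> 0" unfolding e_def using D_closed(5)[OF D_inverse[OF d(1)] d'(1)] d(2) d'(2) by auto
  have "(y - c) * e = t * (p * d')"
    unfolding e_def by (simp add: mult.assoc[symmetric] t(2))
  then have 1: "(y - c) * e \<in> left_ideal (y - c')" using left_ideal_mult[OF d'(3) t(1)] by simp
  have "(y - c) * e - T e * (y - c') \<in> left_ideal (y - c')"
    by (rule left_ideal_diff[OF 1 left_idealI[OF subsetD[OF D_S T_D[OF e(1)]]]])
  moreover have "(y - c) * e - T e * (y - c') = T e * c' + \<Delta> e - c * e"
    using rel[OF e(1)] by (simp add: left_diff_distrib right_diff_distrib)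
  moreover have "T e * c' + \<Delta> e - c * e \<in> D"
    using e(1) c(1) c'(1) by (intro D_closed T_D \<Delta>_D)
  ultimately have "T e * c' + \<Delta> e - c * e = 0" using linear_constant[OF c'(1)] by metis
  then show ?thesis using e by auto
qed

end

section \<open>The additive and multiplicative groups of an infinite field\<close>

text \<open>
  A commutative group on a subset of a type, to treat \<open>(K, +)\<close> and \<open>K\<^sup>*\<close> alike.
\<close>

locale comm_group_on =
  fixes U :: "'a set" and comp :: "'a \<Rightarrow> 'a \<Rightarrow> 'a" (infixl "\<odot>" 70) and e :: 'a and inv :: "'a \<Rightarrow> 'a"
  assumes comp_closed: "a \<in> U \<Longrightarrow> b \<in> U \<Longrightarrow> a \<odot> b \<in> U"
    and unit_closed: "e \<in> U"
    and inv_closed: "a \<in> U \<Longrightarrow> inv a \<in> U"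
    and assoc: "a \<in> U \<Longrightarrow> b \<in> U \<Longrightarrow> c \<in> U \<Longrightarrow> a \<odot> b \<odot> c = a \<odot> (b \<odot> c)"
    and comm: "a \<in> U \<Longrightarrow> b \<in> U \<Longrightarrow> a \<odot> b = b \<odot> a"
    and unit: "a \<in> U \<Longrightarrow> a \<odot> e = a"
    and inverse: "a \<in> U \<Longrightarrow> a \<odot> inv a = e"
begin

definition subgrp :: "'a set \<Rightarrow> bool" where
  "subgrp H \<longleftrightarrow> H \<subseteq> U \<and> e \<in> H \<and> (\<forall>a\<in>H. \<forall>b\<in>H. a \<odot> b \<in> H) \<and> (\<forall>a\<in>H. inv a \<in> H)"

text \<open>
  Infinite generation in the form in which it is used: a sequence that escapes from subgroups
  containing its earlier members.
\<close>

definition infinitely_generated :: bool where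
  "infinitely_generated \<longleftrightarrow>
     (\<exists>f H. \<forall>j::nat. subgrp (H j) \<and> f j \<in> U \<and> f j \<notin> H j \<and> (\<forall>i<j. f i \<in> H j))"

definition npow :: "'a \<Rightarrow> nat \<Rightarrow> 'a" where "npow a k = ((\<odot>) a ^^ k) e"

lemma subgrpD:
  assumes "subgrp H"
  shows "H \<subseteq> U" "e \<in> H" "\<And>a b. a \<in> H \<Longrightarrow> b \<in> H \<Longrightarrow> a \<odot> b \<in> H" "\<And>a. a \<in> H \<Longrightarrow> inv a \<in> H"
  using assms unfolding subgrp_def by auto

lemma left_comm: "a \<in> U \<Longrightarrow> b \<in> U \<Longrightarrow> c \<in> U \<Longrightarrow> a \<odot> (b \<odot> c) = b \<odot> (a \<odot> c)"
  using assoc[of a b c] assoc[of b a c] comm[of a b] by simp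

lemmas ac = assoc comm left_comm comp_closed

lemma inv_unit: "inv e = e"
  using inverse[OF unit_closed] unit[OF inv_closed[OF unit_closed]]
    comm[OF unit_closed inv_closed[OF unit_closed]] by simp

lemma cancel:
  assumes "a \<in> U" "b \<in> U" "c \<in> U" "a \<odot> b = a \<odot> c"
  shows "b = c"
proof -
  have "b = inv a \<odot> (a \<odot> b)" if "b \<in> U" for b
    using that assms(1) inv_closed[OF assms(1)] assoc[of "inv a" a b] comm[of "inv a" a] inverse[of a]
      comm[of e b] unit[of b] unit_closed by simp
  then show ?thesis using assms by metis
qed

lemma inv_comp:
  assumes "a \<in> U" "b \<in> U"
  shows "inv (a \<odot> b) = inv a \<odot> inv b"
proof (rule cancel[of "a \<odot> b"])
  have "a \<odot> b \<odot> (inv a \<odot> inv b) = (a \<odot> inv a) \<odot> (b \<odot> inv b)"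
    using assms inv_closed by (simp add: ac)
  then show "a \<odot> b \<odot> inv (a \<odot> b) = a \<odot> b \<odot> (inv a \<odot> inv b)"
    using assms comp_closed inverse unit unit_closed by simp
qed (use assms inv_closed comp_closed in auto)

lemma npow_closed: "a \<in> U \<Longrightarrow> npow a k \<in> U"
  unfolding npow_def by (induction k) (auto intro: unit_closed comp_closed)

lemma npow_add: "a \<in> U \<Longrightarrow> npow a (k + l) = npow a k \<odot> npow a l"
proof (induction k)
  case 0
  then show ?case using npow_closed[of a l] comm[of e "npow a l"] unit unit_closed
    by (simp add: npow_def)
next
  case (Suc k)
  then show ?case
    using npow_closed[of a k] npow_closed[of a l] by (simp add: npow_def ac)
qed

lemma npow_subgrp:
  assumes "subgrp H" "a \<in> U" "npow a N \<in> H"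
  shows "npow a (k * N) \<in> H"
proof (induction k)
  case 0
  then show ?case using subgrpD(2)[OF assms(1)] by (simp add: npow_def)
next
  case (Suc k)
  then show ?case using npow_add[OF assms(2)] subgrpD(3)[OF assms(1) assms(3)] by simp
qed

text \<open>
  Adjoining an element some power of which already lies in the subgroup enlarges the index only by
  a finite factor.
\<close>

lemma subgrp_adjoin:
  assumes H: "subgrp H" and x: "x \<in> U" and N: "N > 0" "npow x N \<in> H"
  shows "\<exists>H'. subgrp H' \<and> H \<subseteq> H' \<and> x \<in> H' \<and> H' \<subseteq> {h \<odot> npow x k | h k. h \<in> H \<and> k < N}"
proof -
  define H' where "H' = {h \<odot> npow x k | h k. h \<in> H}"
  have I: "h \<odot> npow x k \<in> H'" if "h \<in> H" for h k unfolding H'_def using that by blast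
  have HU: "h \<in> U" if "h \<in> H" for h using that subgrpD(1)[OF H] by blast
  note px = npow_closed[OF x]
  have "subgrp H'"
    unfolding subgrp_def
  proof (intro conjI ballI)
    show "H' \<subseteq> U" unfolding H'_def using HU px comp_closed by blast
    have "npow x 0 = e" by (simp add: npow_def)
    then show "e \<in> H'" using I[OF subgrpD(2)[OF H], of 0] unit[OF unit_closed] by simp
    fix a assume "a \<in> H'"
    then obtain h k where a: "a = h \<odot> npow x k" "h \<in> H" unfolding H'_def by blast
    show "a \<odot> b \<in> H'" if b: "b \<in> H'" for b
    proof -
      obtain g l where b: "b = g \<odot> npow x l" "g \<in> H" using b unfolding H'_def by blast
      have "a \<odot> b = (h \<odot> g) \<odot> npow x (k + l)"
        unfolding a b npow_add[OF x] using HU a(2) b(2) px by (simp add: ac)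
      then show ?thesis using I[OF subgrpD(3)[OF H a(2) b(2)]] by simp
    qed
    show "inv a \<in> H'"
    proof -
      let ?n = "npow x (k * N)"
      have n: "?n \<in> H" using npow_subgrp[OF H x N(2)] .
      have "k + (N - 1) * k = k * N" using N(1) by (cases N) auto
      then have "?n = npow x k \<odot> npow x ((N - 1) * k)" using npow_add[OF x] by metis
      then have "inv ?n \<odot> npow x ((N - 1) * k)
          = inv (npow x k) \<odot> (npow x ((N - 1) * k) \<odot> inv (npow x ((N - 1) * k)))"
        using inv_comp[OF px px] px inv_closed[OF px] by (simp add: ac)
      then have "inv ?n \<odot> npow x ((N - 1) * k) = inv (npow x k)"
        using inverse[OF px] unit[OF inv_closed[OF px]] by simp
      then have "inv a = (inv h \<odot> inv ?n) \<odot> npow x ((N - 1) * k)"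
        unfolding a(1) using inv_comp[OF HU[OF a(2)] px] HU[OF a(2)] px inv_closed by (simp add: assoc)
      then show ?thesis using I[OF subgrpD(3)[OF H subgrpD(4)[OF H a(2)] subgrpD(4)[OF H n]]] by simp
    qed
  qed
  moreover have "H \<subseteq> H'"
  proof
    fix h assume "h \<in> H"
    then show "h \<in> H'" using I[of h 0] unit HU by (simp add: npow_def)
  qed
  moreover have "x \<in> H'"
    using I[OF subgrpD(2)[OF H], of 1] unit[OF x] comm[OF unit_closed x] by (simp add: npow_def)
  moreover have "H' \<subseteq> {h \<odot> npow x k | h k. h \<in> H \<and> k < N}"
  proof
    fix a assume "a \<in> H'"
    then obtain h k where a: "a = h \<odot> npow x k" "h \<in> H" unfolding H'_def by blast
    have "npow x k = npow x (k div N * N) \<odot> npow x (k mod N)"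
      using npow_add[OF x, of "k div N * N" "k mod N"] by simp
    then have "a = (h \<odot> npow x (k div N * N)) \<odot> npow x (k mod N)"
      unfolding a using HU[OF a(2)] px by (simp add: assoc)
    moreover have "h \<odot> npow x (k div N * N) \<in> H"
      using subgrpD(3)[OF H a(2)] npow_subgrp[OF H x N(2)] by blast
    moreover have "k mod N < N" using N(1) by simp
    ultimately show "a \<in> {h \<odot> npow x k | h k. h \<in> H \<and> k < N}" by blast
  qed
  ultimately show ?thesis by blast
qed

text \<open>
  Applied to \<open>H = {e}\<close>, this says that finitely many elements of finite order lie in a finite subgroup;
  applied to the subgroup of \<open>p\<close>-th powers, that every finitely generated subgroup meets only
  finitely many classes modulo \<open>p\<close>-th powers.
\<close>

lemma finite_index_extension:
  assumes "finite X" "X \<subseteq> U" "subgrp H" "\<And>x. x \<in> X \<Longrightarrow> \<exists>N>0. npow x N \<in> H"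
  shows "\<exists>H' Q. subgrp H' \<and> H \<subseteq> H' \<and> X \<subseteq> H' \<and> finite Q \<and> Q \<subseteq> U \<and> H' \<subseteq> {h \<odot> q | h q. h \<in> H \<and> q \<in> Q}"
  using assms(1,2,4)
proof (induction X rule: finite_induct)
  case empty
  have "h = h \<odot> e" if "h \<in> H" for h using that unit subgrpD(1)[OF assms(3)] by (metis subsetD)
  then have "H \<subseteq> {h \<odot> q | h q. h \<in> H \<and> q \<in> {e}}" by blast
  then show ?case using assms(3) unit_closed by blast
next
  case (insert x X)
  then obtain H' Q where H': "subgrp H'" "H \<subseteq> H'" "X \<subseteq> H'" "finite Q" "Q \<subseteq> U"
      "H' \<subseteq> {h \<odot> q | h q. h \<in> H \<and> q \<in> Q}" by auto
  have x: "x \<in> U" using insert.prems(1) by simp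
  obtain N where N: "N > 0" "npow x N \<in> H" using insert.prems(2)[of x] by blast
  obtain H2 where H2: "subgrp H2" "H' \<subseteq> H2" "x \<in> H2" "H2 \<subseteq> {h \<odot> npow x k | h k. h \<in> H' \<and> k < N}"
    using subgrp_adjoin[OF H'(1) x N(1)] N(2) H'(2) by blast
  define Q2 where "Q2 = (\<lambda>(q, k). q \<odot> npow x k) ` (Q \<times> {..<N})"
  have "H2 \<subseteq> {h \<odot> q | h q. h \<in> H \<and> q \<in> Q2}"
  proof
    fix a assume "a \<in> H2"
    then obtain h' k where a: "a = h' \<odot> npow x k" "h' \<in> H'" "k < N" using H2(4) by blast
    then obtain h q where h: "h' = h \<odot> q" "h \<in> H" "q \<in> Q" using H'(6) by blast
    have "h \<in> U" "q \<in> U" using h(2,3) subgrpD(1)[OF assms(3)] H'(5) by auto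
    then have "a = h \<odot> (q \<odot> npow x k)" unfolding a h using npow_closed[OF x] by (simp add: assoc)
    moreover have "q \<odot> npow x k \<in> Q2" unfolding Q2_def using h(3) a(3) by force
    ultimately show "a \<in> {h \<odot> q | h q. h \<in> H \<and> q \<in> Q2}" using h(2) by blast
  qed
  moreover have "finite Q2" "Q2 \<subseteq> U"
    unfolding Q2_def using H'(4,5) npow_closed[OF x] comp_closed by auto
  moreover have "H \<subseteq> H2" "insert x X \<subseteq> H2" using H' H2 by auto
  ultimately show ?case using H2(1) by blast
qed

lemma infinitely_generatedI:
  assumes "\<And>X. finite X \<Longrightarrow> X \<subseteq> U \<Longrightarrow> \<exists>H. subgrp H \<and> X \<subseteq> H \<and> H \<noteq> U"
  shows "infinitely_generated"
proof -
  have "\<exists>Hu. subgrp (fst Hu) \<and> X \<subseteq> fst Hu \<and> snd Hu \<in> U - fst Hu" if X: "finite X" "X \<subseteq> U" for X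
  proof -
    obtain H where H: "subgrp H" "X \<subseteq> H" "H \<noteq> U" using assms[OF X] by (elim exE conjE)
    then obtain u where u: "u \<in> U - H" using subgrpD(1)[OF H(1)] by auto
    show ?thesis by (rule exI[of _ "(H, u)"]) (use H u in simp)
  qed
  then have "\<forall>X. \<exists>Hu. finite X \<and> X \<subseteq> U \<longrightarrow> subgrp (fst Hu) \<and> X \<subseteq> fst Hu \<and> snd Hu \<in> U - fst Hu"
    by (intro allI) (simp del: split_paired_Ex)
  then obtain g where "\<forall>X. finite X \<and> X \<subseteq> U \<longrightarrow>
      subgrp (fst (g X)) \<and> X \<subseteq> fst (g X) \<and> snd (g X) \<in> U - fst (g X)"
    by (rule choice[THEN exE])
  then have g: "\<And>X. finite X \<Longrightarrow> X \<subseteq> U \<Longrightarrow>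
      subgrp (fst (g X)) \<and> X \<subseteq> fst (g X) \<and> snd (g X) \<in> U - fst (g X)" by simp
  define F where "F = rec_nat {} (\<lambda>_ X. insert (snd (g X)) X)"
  have F: "F 0 = {}" "\<And>n. F (Suc n) = insert (snd (g (F n))) (F n)" unfolding F_def by simp_all
  have fin: "finite (F n) \<and> F n \<subseteq> U" for n
    by (induction n) (use F g in auto)
  have "snd (g (F i)) \<in> F j" if "i < j" for i j
    using that by (induction j) (auto simp: F less_Suc_eq)
  then have "\<forall>j. subgrp (fst (g (F j))) \<and> snd (g (F j)) \<in> U \<and> snd (g (F j)) \<notin> fst (g (F j)) \<and>
      (\<forall>i<j. snd (g (F i)) \<in> fst (g (F j)))"
    using g[OF conjunct1[OF fin] conjunct2[OF fin]] by blast
  then show ?thesis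
    unfolding infinitely_generated_def
    by (intro exI[of _ "\<lambda>j. snd (g (F j))"] exI[of _ "\<lambda>j. fst (g (F j))"])
qed

lemma torsion_infinitely_generated:
  assumes "infinite U" "\<And>x. x \<in> U \<Longrightarrow> \<exists>N>0. npow x N = e"
  shows "infinitely_generated"
proof (rule infinitely_generatedI)
  fix X :: "'a set" assume X: "finite X" "X \<subseteq> U"
  have "e \<odot> e = e" by (rule unit[OF unit_closed])
  then have "subgrp {e}" unfolding subgrp_def using unit_closed inv_unit by simp
  moreover have "\<exists>N>0. npow x N \<in> {e}" if "x \<in> X" for x using assms(2) that X(2) by auto
  ultimately obtain H Q where H: "subgrp H" "X \<subseteq> H" "finite Q" "H \<subseteq> {h \<odot> q | h q. h \<in> {e} \<and> q \<in> Q}"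
    using finite_index_extension[OF X, of "{e}"] by blast
  then have "H \<subseteq> (\<odot>) e ` Q" by auto
  then have "finite H" using H(3) finite_subset by blast
  then show "\<exists>H. subgrp H \<and> X \<subseteq> H \<and> H \<noteq> U" using H(1,2) assms(1) by blast
qed

end

lemma commuting_binomial:
  fixes a b :: "'a::ring_1"
  assumes "a * b = b * a"
  shows "(a + b) ^ n = (\<Sum>k\<le>n. of_nat (n choose k) * (a ^ k * b ^ (n - k)))"
proof (induction n)
  case (Suc n)
  have ba: "b * (a ^ k * w) = a ^ k * (b * w)" for k w
    using power_commuting_commutes[OF assms, of k] by (simp add: mult.assoc[symmetric])
  have swap: "c * (of_nat m * w) = of_nat m * (c * w)" for c w :: 'a and m
    using mult_of_nat_commute[of m c] by (simp add: mult.assoc[symmetric])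
  let ?t = "\<lambda>k. a ^ k * b ^ (Suc n - k)"
  have 1: "a * (\<Sum>k\<le>n. of_nat (n choose k) * (a ^ k * b ^ (n - k)))
      = (\<Sum>k\<le>n. of_nat (n choose k) * ?t (Suc k))"
    unfolding sum_distrib_left by (intro sum.cong) (simp_all add: swap mult.assoc)
  have "b * (\<Sum>k\<le>n. of_nat (n choose k) * (a ^ k * b ^ (n - k))) = (\<Sum>k\<le>n. of_nat (n choose k) * ?t k)"
    unfolding sum_distrib_left by (intro sum.cong) (simp_all add: swap ba Suc_diff_le)
  also have "\<dots> = (\<Sum>k\<le>Suc n. of_nat (n choose k) * ?t k)" by (simp add: binomial_eq_0)
  also have "\<dots> = ?t 0 + (\<Sum>k\<le>n. of_nat (n choose Suc k) * ?t (Suc k))"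
    unfolding sum.atMost_Suc_shift by simp
  finally have 2: "b * (\<Sum>k\<le>n. of_nat (n choose k) * (a ^ k * b ^ (n - k)))
      = ?t 0 + (\<Sum>k\<le>n. of_nat (n choose Suc k) * ?t (Suc k))" .
  have "(a + b) ^ Suc n = ?t 0 + ((\<Sum>k\<le>n. of_nat (n choose k) * ?t (Suc k)) +
      (\<Sum>k\<le>n. of_nat (n choose Suc k) * ?t (Suc k)))"
    by (simp only: power_Suc Suc distrib_right 1 2 add.left_commute)
  also have "\<dots> = ?t 0 + (\<Sum>k\<le>n. of_nat (Suc n choose Suc k) * ?t (Suc k))"
    by (simp add: sum.distrib[symmetric] distrib_right)
  also have "\<dots> = (\<Sum>k\<le>Suc n. of_nat (Suc n choose k) * ?t k)"
    unfolding sum.atMost_Suc_shift by simp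
  finally show ?case .
qed simp

lemma commuting_frobenius:
  fixes a b :: "'a::ring_1"
  assumes "a * b = b * a" "prime p" "of_nat p = (0 :: 'a)"
  shows "(a + b) ^ p = a ^ p + b ^ p"
proof -
  have p: "p > 0" using assms(2) by (simp add: prime_gt_0_nat)
  have "of_nat (p choose k) * (a ^ k * b ^ (p - k)) = 0" if "k \<in> {..p} - {0, p}" for k
  proof -
    have "p dvd (p choose k)" using that assms(2) by (intro dvd_choose_prime) auto
    then have "of_nat (p choose k) = (0 :: 'a)" using assms(3) by (auto elim!: dvdE)
    then show ?thesis by simp
  qed
  then have "(a + b) ^ p = (\<Sum>k\<in>{0, p}. of_nat (p choose k) * (a ^ k * b ^ (p - k)))"
    unfolding commuting_binomial[OF assms(1)] by (intro sum.mono_neutral_right) auto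
  then show ?thesis using p by (simp add: add.commute)
qed

lemma commuting_power_mult:
  fixes a b :: "'a::monoid_mult"
  assumes "a * b = b * a"
  shows "(a * b) ^ n = a ^ n * b ^ n"
proof (induction n)
  case (Suc n)
  have "b * a ^ n = a ^ n * b" using power_commuting_commutes[OF assms, of n] by simp
  then show ?case using Suc by (simp add: mult.assoc) (simp add: mult.assoc[symmetric])
qed simp

lemma positive_characteristic_prime:
  assumes "n > 0" "of_nat n = (0 :: 'a::division_ring)"
  shows "\<exists>p. prime p \<and> of_nat p = (0 :: 'a)"
  using assms
proof (induction n rule: less_induct)
  case (less n)
  then have "n \<noteq> 1" by auto
  then obtain p where p: "prime p" "p dvd n" using prime_factor_nat by blast
  then obtain m where m: "n = p * m" by blast
  then have "of_nat p = (0 :: 'a) \<or> of_nat m = (0 :: 'a)" using less.prems by simp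
  moreover have "m < n" "m > 0" using m less.prems prime_gt_1_nat[OF p(1)] by auto
  ultimately show ?case using p(1) less.IH by blast
qed

lemma of_int_eq_0_char_0:
  assumes "\<not> (\<exists>n>0. of_nat n = (0 :: 'a::ring_1))" "of_int a = (0 :: 'a)"
  shows "a = 0"
proof (rule ccontr)
  assume "a \<noteq> 0"
  moreover have "of_nat (nat \<bar>a\<bar>) = (0 :: 'a)" using assms(2) by (simp add: abs_if)
  ultimately show False using assms(1) by (metis zero_less_abs_iff zero_less_nat_eq)
qed

locale infinite_subfield =
  fixes K :: "'a::division_ring set"
  assumes K: "division_subring K"
    and K_commute: "\<And>a b. a \<in> K \<Longrightarrow> b \<in> K \<Longrightarrow> a * b = b * a"
    and K_infinite: "infinite K"
begin

lemma K_subring: "subring K" and K_inverse: "c \<in> K \<Longrightarrow> inverse c \<in> K"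
  using K unfolding division_subring_def by auto

lemmas K_closed = subring_zero[OF K_subring] subring_one[OF K_subring] subring_add[OF K_subring]
  subring_diff[OF K_subring] subring_mult[OF K_subring] subring_minus[OF K_subring] K_inverse
  subring_power[OF K_subring]

sublocale additive: comm_group_on K "(+)" 0 uminus
  by unfold_locales (use K_closed in \<open>auto simp: algebra_simps\<close>)

sublocale units: comm_group_on "K - {0}" "(*)" 1 inverse
proof unfold_locales
  fix a b assume "a \<in> K - {0}" "b \<in> K - {0}"
  then show "a * b = b * a" using K_commute by blast
qed (use K_closed in \<open>auto simp: mult.assoc\<close>)

lemma additive_npow: "additive.npow a k = of_nat k * a"
  by (induction k) (simp_all add: additive.npow_def distrib_right)

lemma multiplicative_npow: "units.npow a k = a ^ k"
  by (induction k) (simp_all add: units.npow_def)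

lemma of_nat_K: "of_nat n \<in> K"
  by (induction n) (use K_closed in auto)

text \<open>
  In positive characteristic finitely many elements lie in a finite subgroup. In characteristic
  zero the powers of \<open>1/2\<close> escape: \<open>2\<^sup>-\<^sup>j\<^sup>-\<^sup>1\<close> is not an integral multiple of \<open>2\<^sup>-\<^sup>j\<close>.
\<close>

theorem additive_infinitely_generated: "additive.infinitely_generated"
proof (cases "\<exists>n>0. of_nat n = (0 :: 'a)")
  case True
  then obtain n where n: "n > 0" "of_nat n = (0 :: 'a)" by blast
  then show ?thesis
    by (intro additive.torsion_infinitely_generated[OF K_infinite] exI[of _ n]) (simp add: additive_npow)
next
  case False
  then have int0: "a = 0" if "of_int a = (0 :: 'a)" for a using of_int_eq_0_char_0 that by blast
  have two: "(2 :: 'a) \<noteq> 0" using int0[of 2] by auto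
  have p2: "(2 :: 'a) ^ j \<noteq> 0" for j using two by simp
  define f :: "nat \<Rightarrow> 'a" where "f i = inverse (2 ^ Suc i)" for i
  define H :: "nat \<Rightarrow> 'a set" where "H j = {c \<in> K. \<exists>a. 2 ^ j * c = of_int a}" for j
  have HI: "c \<in> H j" if "c \<in> K" "2 ^ j * c = of_int a" for c j a unfolding H_def using that by blast
  have two_K: "(2 :: 'a) \<in> K" using of_nat_K[of 2] by simp
  have fK: "f i \<in> K" for i unfolding f_def by (rule K_closed(7)[OF K_closed(8)[OF two_K]])
  have "additive.subgrp (H j)" for j
    unfolding additive.subgrp_def
  proof (intro conjI ballI)
    show "H j \<subseteq> K" unfolding H_def by blast
    show "0 \<in> H j" by (rule HI[OF K_closed(1), of j 0]) simp
    fix a assume "a \<in> H j"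
    then obtain k where a: "a \<in> K" "2 ^ j * a = of_int k" unfolding H_def by blast
    then show "- a \<in> H j" by (intro HI[OF K_closed(6), of a j "- k"]) auto
    fix b assume "b \<in> H j"
    then obtain l where "b \<in> K" "2 ^ j * b = of_int l" unfolding H_def by blast
    then show "a + b \<in> H j" using a by (intro HI[OF K_closed(3), of a b j "k + l"]) (auto simp: distrib_left)
  qed
  moreover have "f i \<in> H j" if "i < j" for i j
  proof -
    have "(2 :: 'a) ^ j = 2 ^ (j - Suc i) * 2 ^ Suc i"
      using that by (simp only: power_add[symmetric]) simp
    then have "2 ^ j * f i = 2 ^ (j - Suc i)"
      unfolding f_def using p2[of "Suc i"] by (simp only: mult.assoc right_inverse mult_1_right) simp
    then show ?thesis by (intro HI[OF fK, of _ _ "2 ^ (j - Suc i)"]) simp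
  qed
  moreover have "f j \<notin> H j" for j
  proof
    assume "f j \<in> H j"
    then obtain a where a: "2 ^ j * f j = of_int a" unfolding H_def by blast
    have "(2 :: 'a) ^ Suc j * f j = 1" unfolding f_def using p2[of "Suc j"] by (rule right_inverse)
    then have "2 * of_int a = (1 :: 'a)" by (simp add: mult.assoc a)
    then have "of_int (2 * a - 1) = (0 :: 'a)" by simp
    then have "2 * a - 1 = 0" by (rule int0)
    then show False by presburger
  qed
  ultimately show ?thesis unfolding additive.infinitely_generated_def using fK by blast
qed

text \<open>
  The prime numbers escape: the quotients \<open>a/b\<close> of natural numbers not divisible by the \<open>j\<close>-th prime
  form a subgroup that contains all other primes.
\<close>

lemma multiplicative_infinitely_generated_char_0:
  assumes char: "\<And>n. n > 0 \<Longrightarrow> of_nat n \<noteq> (0 :: 'a)"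
  shows "units.infinitely_generated"
proof -
  have inj: "m = n" if "of_nat m = (of_nat n :: 'a)" for m n
    using of_int_eq_0_char_0[where 'a = 'a, of "int m - int n"] char that by auto
  obtain q :: "nat \<Rightarrow> nat" where q: "Fun.inj q" "range q \<subseteq> {p. prime p}"
    using infinite_countable_subset[OF primes_infinite] by blast
  have prime: "prime (q i)" for i using q(2) by blast
  define H :: "nat \<Rightarrow> 'a set" where
    "H j = {c \<in> K - {0}. \<exists>a b. \<not> q j dvd a \<and> \<not> q j dvd b \<and> of_nat b * c = of_nat a}" for j
  have HI: "c \<in> H j" if "c \<in> K - {0}" "\<not> q j dvd a" "\<not> q j dvd b" "of_nat b * c = of_nat a" for c j a b
    unfolding H_def using that by blast
  have "units.subgrp (H j)" for j
    unfolding units.subgrp_def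
  proof (intro conjI ballI)
    show "H j \<subseteq> K - {0}" unfolding H_def by blast
    have "\<not> q j dvd 1" using prime[of j] by (metis not_prime_unit)
    then show "1 \<in> H j" using K_closed by (intro HI[of 1 j 1 1]) auto
    fix c assume "c \<in> H j"
    then obtain a b where c: "c \<in> K - {0}" "\<not> q j dvd a" "\<not> q j dvd b" "of_nat b * c = of_nat a"
      unfolding H_def by blast
    have "of_nat a * inverse c = of_nat b" using c(1) by (simp add: c(4)[symmetric] mult.assoc)
    then show "inverse c \<in> H j" using c K_closed by (intro HI[of "inverse c" j b a]) auto
    fix d assume "d \<in> H j"
    then obtain a' b' where d: "d \<in> K - {0}" "\<not> q j dvd a'" "\<not> q j dvd b'" "of_nat b' * d = of_nat a'"
      unfolding H_def by blast
    have "of_nat (b' * b) * (c * d) = of_nat b' * (of_nat b * c) * d" by (simp add: mult.assoc)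
    also have "\<dots> = of_nat a * (of_nat b' * d)"
      unfolding c(4) by (metis mult.assoc mult_of_nat_commute)
    also have "\<dots> = of_nat (a * a')" by (simp add: d(4))
    finally show "c * d \<in> H j"
      using c d K_closed prime_dvd_mult_iff[OF prime[of j]]
      by (intro HI[of "c * d" j "a * a'" "b' * b"]) auto
  qed
  moreover have fK: "of_nat (q j) \<in> K - {0}" for j
    using of_nat_K char[of "q j"] prime_gt_0_nat[OF prime[of j]] by simp
  moreover have "of_nat (q i) \<in> H j" if "i < j" for i j
  proof (rule HI[of _ _ "q i" 1])
    have "q i \<noteq> q j" using q(1) that by (metis inj_eq less_irrefl)
    then show "\<not> q j dvd q i" using prime[of i] prime[of j] by (metis primes_dvd_imp_eq)
    show "\<not> q j dvd 1" using prime[of j] by (metis not_prime_unit)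
  qed (use fK in auto)
  moreover have "of_nat (q j) \<notin> H j" for j
  proof
    assume "of_nat (q j) \<in> H j"
    then obtain a b where "\<not> q j dvd a" "of_nat b * of_nat (q j) = (of_nat a :: 'a)"
      unfolding H_def by blast
    then show False using inj[of "b * q j" a] by auto
  qed
  ultimately show ?thesis
    unfolding units.infinitely_generated_def
    by (intro exI[of _ "\<lambda>j. of_nat (q j)"] exI[of _ H]) blast
qed

text \<open>
  There are three cases. If \<open>K\<^sup>*\<close> is a torsion group, then finitely generated subgroups are finite. If
  \<open>t\<close> has infinite order and \<open>K\<close> is perfect, then the iterated \<open>p\<close>-th roots of \<open>t\<close> escape. If \<open>t\<close> is
  not a \<open>p\<close>-th power, then the elements \<open>t + c\<^sup>p\<close> lie in infinitely many classes modulo \<open>p\<close>-th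
  powers: if \<open>t + c\<^sup>p = w\<^sup>p (t + d\<^sup>p)\<close> with \<open>w \<noteq> 1\<close>, then \<open>(1 - w)\<^sup>p t = (w d - c)\<^sup>p\<close> makes \<open>t\<close> a
  \<open>p\<close>-th power, and \<open>w = 1\<close> gives \<open>c = d\<close>.
\<close>

lemma multiplicative_infinitely_generated_char_p:
  assumes p: "prime p" "of_nat p = (0 :: 'a)"
  shows "units.infinitely_generated"
proof -
  have p0: "p > 0" using prime_gt_0_nat[OF p(1)] .
  have frob: "(a + b) ^ p = a ^ p + b ^ p" if "a \<in> K" "b \<in> K" for a b
    using commuting_frobenius[OF K_commute[OF that] p] .
  have frob_minus: "(- a) ^ p = - (a ^ p)" if "a \<in> K" for a
  proof -
    have "(- a) ^ p + a ^ p = 0" using frob[of "- a" a] that K_closed(6) p0 by (simp add: power_0_left)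
    then show ?thesis by (simp add: eq_neg_iff_add_eq_0)
  qed
  have frob_diff: "(a - b) ^ p = a ^ p - b ^ p" if "a \<in> K" "b \<in> K" for a b
    using frob[of a "- b"] frob_minus[of b] that K_closed(6) by simp
  have mult: "(a * b) ^ k = a ^ k * b ^ k" if "a \<in> K" "b \<in> K" for a b k
    by (rule commuting_power_mult[OF K_commute[OF that]])
  consider (torsion) "\<And>t. t \<in> K - {0} \<Longrightarrow> \<exists>N>0. t ^ N = 1"
    | (perfect) t where "t \<in> K - {0}" "\<And>N. N > 0 \<Longrightarrow> t ^ N \<noteq> 1" "\<And>s. s \<in> K \<Longrightarrow> \<exists>u\<in>K. s = u ^ p"
    | (imperfect) t where "t \<in> K" "\<And>u. u \<in> K \<Longrightarrow> t \<noteq> u ^ p"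
    by metis
  then show ?thesis
  proof cases
    case torsion
    have "infinite (K - {0})" using K_infinite by simp
    then show ?thesis
      by (rule units.torsion_infinitely_generated) (unfold multiplicative_npow, rule torsion)
  next
    case perfect
    obtain r where r: "\<And>s. s \<in> K \<Longrightarrow> r s \<in> K \<and> s = r s ^ p" using perfect(3) by metis
    define f where "f i = (r ^^ i) t" for i
    have fp: "f (Suc i) ^ p = f i" and fK: "f i \<in> K - {0}" for i
    proof -
      have fK: "f i \<in> K" for i by (induction i) (use perfect(1) r in \<open>auto simp: f_def\<close>)
      show fp: "f (Suc i) ^ p = f i" for i using r[OF fK[of i]] by (simp add: f_def)
      have "f i \<noteq> 0"
      proof (induction i)
        case (Suc i)
        then show ?case using fp[of i] p0 by (auto simp: power_0_left)
      qed (use perfect(1) in \<open>simp add: f_def\<close>)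
      then show "f i \<in> K - {0}" using fK by simp
    qed
    have fpow: "f (i + k) ^ (p ^ k) = f i" for i k
    proof (induction k)
      case (Suc k)
      have "f (i + Suc k) ^ (p ^ Suc k) = (f (Suc (i + k)) ^ p) ^ (p ^ k)" by (simp add: power_mult)
      then show ?case using Suc fp by simp
    qed simp
    have nontorsion: "f i ^ N \<noteq> 1" if "N > 0" for i N
    proof
      assume "f i ^ N = 1"
      then have "(f i ^ N) ^ (p ^ i) = 1" by simp
      then have "(f (0 + i) ^ (p ^ i)) ^ N = 1" by (simp add: power_mult[symmetric] mult.commute)
      then have "t ^ N = 1" unfolding fpow by (simp add: f_def)
      then show False using perfect(2)[OF that] by simp
    qed
    define H where "H j = {c \<in> K - {0}. \<exists>m n. c * f j ^ m = f j ^ n}" for j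
    have HI: "c \<in> H j" if "c \<in> K - {0}" "c * f j ^ m = f j ^ n" for c j m n
      unfolding H_def using that by blast
    have "units.subgrp (H j)" for j
      unfolding units.subgrp_def
    proof (intro conjI ballI)
      show "H j \<subseteq> K - {0}" unfolding H_def by blast
      have "1 * f j ^ 0 = f j ^ 0" by simp
      then show "1 \<in> H j" using K_closed(2) by (intro HI) auto
      fix c assume "c \<in> H j"
      then obtain m n where c: "c \<in> K - {0}" "c * f j ^ m = f j ^ n" unfolding H_def by blast
      have "inverse c * f j ^ n = f j ^ m" using c(1) by (simp add: c(2)[symmetric] mult.assoc[symmetric])
      then show "inverse c \<in> H j" using c(1) K_closed(7)[of c] by (intro HI) auto
      fix d assume "d \<in> H j"
      then obtain m' n' where d: "d \<in> K - {0}" "d * f j ^ m' = f j ^ n'" unfolding H_def by blast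
      have "c * d * f j ^ (m' + m) = c * (d * f j ^ m') * f j ^ m" by (simp add: power_add mult.assoc)
      also have "\<dots> = c * f j ^ m * f j ^ n'"
        unfolding d(2) by (simp add: mult.assoc flip: power_add) (simp add: add.commute)
      also have "\<dots> = f j ^ (n + n')" unfolding c(2) by (simp add: power_add)
      finally show "c * d \<in> H j" using c(1) d(1) K_closed(5)[of c d] by (intro HI) auto
    qed
    moreover have "f (Suc i) \<in> H j" if "i < j" for i j
    proof -
      have "f j ^ (p ^ (j - Suc i)) = f (Suc i)" using fpow[of "Suc i" "j - Suc i"] that by simp
      then have "f (Suc i) * f j ^ 0 = f j ^ (p ^ (j - Suc i))" by simp
      then show ?thesis by (rule HI[OF fK])
    qed
    moreover have "f (Suc j) \<notin> H j" for j
    proof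
      let ?s = "f (Suc j)"
      assume "?s \<in> H j"
      then obtain m n where "?s * f j ^ m = f j ^ n" unfolding H_def by blast
      then have "?s * (?s ^ p) ^ m = (?s ^ p) ^ n" unfolding fp .
      then have e: "?s ^ Suc (p * m) = ?s ^ (p * n)" by (simp add: power_mult)
      have ne: "Suc (p * m) \<noteq> p * n"
      proof
        assume "Suc (p * m) = p * n"
        then have "p dvd 1" by (metis dvd_add_right_iff dvd_triv_left plus_1_eq_Suc add.commute)
        then show False using p(1) by (metis not_prime_unit)
      qed
      have s0: "?s ^ k \<noteq> 0" for k using fK[of "Suc j"] by simp
      have red: False if "k < l" "?s ^ k = ?s ^ l" for k l
      proof -
        have "?s ^ k * ?s ^ (l - k) = ?s ^ l" using that(1) by (simp only: power_add[symmetric]) simp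
        then have "?s ^ k * ?s ^ (l - k) = ?s ^ k * 1" using that(2) by simp
        then have "?s ^ (l - k) = 1" using s0[of k] by (simp only: mult_cancel_left) simp
        then show False using nontorsion[of "l - k"] that(1) by simp
      qed
      show False using red[OF _ e] red[OF _ e[symmetric]] ne by linarith
    qed
    ultimately show ?thesis
      unfolding units.infinitely_generated_def using fK
      by (intro exI[of _ "\<lambda>i. f (Suc i)"] exI[of _ H]) blast
  next
    case imperfect
    define P where "P = {u ^ p | u. u \<in> K - {0}}"
    have PI: "u ^ p \<in> P" if "u \<in> K - {0}" for u unfolding P_def using that by blast
    have P: "units.subgrp P"
      unfolding units.subgrp_def
    proof (intro conjI ballI)
      show "P \<subseteq> K - {0}" unfolding P_def using K_closed by auto
      show "1 \<in> P" using PI[of 1] K_closed by simp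
      fix a assume "a \<in> P"
      then obtain u where u: "u \<in> K - {0}" "a = u ^ p" unfolding P_def by blast
      show "inverse a \<in> P" using PI[of "inverse u"] u K_closed by (simp add: power_inverse)
      fix b assume "b \<in> P"
      then obtain v where v: "v \<in> K - {0}" "b = v ^ p" unfolding P_def by blast
      show "a * b \<in> P" using PI[of "u * v"] u v K_closed mult by auto
    qed
    show ?thesis
    proof (rule units.infinitely_generatedI)
      fix X :: "'a set" assume X: "finite X" "X \<subseteq> K - {0}"
      have "\<exists>N>0. units.npow x N \<in> P" if "x \<in> X" for x
        using that X(2) p0 PI by (intro exI[of _ p]) (auto simp: multiplicative_npow)
      then obtain H Q where H: "units.subgrp H" "X \<subseteq> H" "finite Q" "Q \<subseteq> K - {0}"
          "H \<subseteq> {h * q | h q. h \<in> P \<and> q \<in> Q}"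
        using units.finite_index_extension[OF X P] by blast
      have "H \<noteq> K - {0}"
      proof
        assume HK: "H = K - {0}"
        have "\<exists>q\<in>Q. \<exists>u\<in>K - {0}. t + c ^ p = u ^ p * q" if c: "c \<in> K" for c
        proof -
          have "t + c ^ p \<noteq> 0"
            using imperfect(2)[OF K_closed(6)[OF c]] unfolding frob_minus[OF c] eq_neg_iff_add_eq_0 .
          moreover have "t + c ^ p \<in> K" by (rule K_closed(3)[OF imperfect(1) K_closed(8)[OF c]])
          ultimately have "t + c ^ p \<in> H" unfolding HK by blast
          have "t + c ^ p \<in> {h * q | h q. h \<in> P \<and> q \<in> Q}" using H(5) \<open>t + c ^ p \<in> H\<close> by (rule subsetD)
          then obtain h q where hq: "h \<in> P" "q \<in> Q" "t + c ^ p = h * q" by (elim CollectE exE conjE)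
          have "\<exists>u. h = u ^ p \<and> u \<in> K - {0}" using hq(1) unfolding P_def by (rule CollectD)
          then obtain u where "u \<in> K - {0}" "h = u ^ p" by (elim exE conjE)
          have "t + c ^ p = u ^ p * q" unfolding hq(3) \<open>h = u ^ p\<close> by (rule refl)
          show ?thesis by (intro bexI[of _ q] bexI[of _ u]) fact+
        qed
        then have "\<forall>c\<in>K. \<exists>q\<in>Q. \<exists>u\<in>K - {0}. t + c ^ p = u ^ p * q" by (rule ballI)
        from pigeonhole_infinite_rel[OF K_infinite H(3) this]
        obtain q where q: "infinite {c \<in> K. \<exists>u\<in>K - {0}. t + c ^ p = u ^ p * q}" (is "infinite ?C")
          by (rule bexE)
        then have "?C \<noteq> {}" by (metis finite.emptyI)
        then obtain c where c: "c \<in> ?C" by (elim exE[OF ex_in_conv[THEN iffD2]])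
        have "infinite (?C - {c})" using q by simp
        then have "?C - {c} \<noteq> {}" by (metis finite.emptyI)
        then obtain d where "d \<in> ?C - {c}" by (elim exE[OF ex_in_conv[THEN iffD2]])
        then have d: "d \<in> ?C" "d \<noteq> c" by simp_all
        obtain u where u: "u \<in> K - {0}" "t + c ^ p = u ^ p * q" and cK: "c \<in> K" using c by blast
        obtain v where v: "v \<in> K - {0}" "t + d ^ p = v ^ p * q" and dK: "d \<in> K" using d(1) by blast
        \<comment> \<open>Two elements \<open>t + c\<^sup>p\<close> and \<open>t + d\<^sup>p\<close> of the same class differ by the factor \<open>w\<^sup>p\<close>.\<close>
        define w where "w = u * inverse v"
        have wK: "w \<in> K" unfolding w_def using u v K_closed by auto
        have "w * v = u" unfolding w_def using v by (simp add: mult.assoc)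
        then have "w ^ p * v ^ p = u ^ p" using mult[OF wK, of v p] v by simp
        then have "t + c ^ p = w ^ p * (t + d ^ p)"
          unfolding u(2) v(2) by (simp add: mult.assoc[symmetric])
        then have e: "(1 - w ^ p) * t = (w * d) ^ p - c ^ p"
          using mult[OF wK dK] by (simp add: algebra_simps)
        have e: "(1 - w) ^ p * t = (w * d - c) ^ p"
          using e frob_diff[of 1 w] frob_diff[of "w * d" c] wK dK cK K_closed by simp
        have iK: "inverse (1 - w) \<in> K" "w * d - c \<in> K" using K_closed wK dK cK by auto
        show False
        proof (cases "w = 1")
          case True
          then have "(d - c) ^ p = 0" using e p0 by (simp add: power_0_left)
          then show False using d(2) by simp
        next
          case False
          have "inverse (1 - w) ^ p * (1 - w) ^ p = 1"
            using mult[OF iK(1), of "1 - w" p] False K_closed wK by simp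
          then have "t = inverse (1 - w) ^ p * ((1 - w) ^ p * t)" by (simp add: mult.assoc[symmetric])
          also have "\<dots> = (inverse (1 - w) * (w * d - c)) ^ p" unfolding e using mult iK by simp
          finally show False using imperfect(2)[OF K_closed(5)[OF iK]] by simp
        qed
      qed
      then show "\<exists>H. units.subgrp H \<and> X \<subseteq> H \<and> H \<noteq> K - {0}" using H(1,2) by blast
    qed
  qed
qed

theorem multiplicative_infinitely_generated: "units.infinitely_generated"
proof (cases "\<exists>n>0. of_nat n = (0 :: 'a)")
  case True
  then show ?thesis
    using positive_characteristic_prime multiplicative_infinitely_generated_char_p by blast
next
  case False
  then show ?thesis using multiplicative_infinitely_generated_char_0 by blast
qed

end

section \<open>Separating homogeneous elements by division subrings\<close>

text \<open>
  Eigenspaces of an operator on a division ring, indexed by a group of eigenvalues. They are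
  independent but need not span.
\<close>

locale division_grading = comm_group_on U comp e inv
  for U :: "'a::division_ring set" and comp (infixl "\<odot>" 70) and e inv +
  fixes B :: "'a \<Rightarrow> 'a set"
  assumes B_zero: "\<And>l. l \<in> U \<Longrightarrow> 0 \<in> B l"
    and B_diff: "\<And>l a b. l \<in> U \<Longrightarrow> a \<in> B l \<Longrightarrow> b \<in> B l \<Longrightarrow> a - b \<in> B l"
    and B_mult: "\<And>l m a b. l \<in> U \<Longrightarrow> m \<in> U \<Longrightarrow> a \<in> B l \<Longrightarrow> b \<in> B m \<Longrightarrow> a * b \<in> B (l \<odot> m)"
    and B_inverse: "\<And>l a. l \<in> U \<Longrightarrow> a \<in> B l \<Longrightarrow> inverse a \<in> B (inv l)"
    and B_one: "1 \<in> B e"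
    and B_independent: "\<And>M b. finite M \<Longrightarrow> M \<subseteq> U \<Longrightarrow> (\<And>l. l \<in> M \<Longrightarrow> b l \<in> B l) \<Longrightarrow> (\<Sum>l\<in>M. b l) = 0
        \<Longrightarrow> \<forall>l\<in>M. b l = 0"
begin

inductive_set span :: "'a set \<Rightarrow> 'a set" for G where
  zero: "0 \<in> span G"
| add: "a \<in> span G \<Longrightarrow> l \<in> G \<Longrightarrow> b \<in> B l \<Longrightarrow> a + b \<in> span G"

lemma B_add:
  assumes "l \<in> U" "a \<in> B l" "b \<in> B l"
  shows "a + b \<in> B l"
  using B_diff[OF assms(1,2) B_diff[OF assms(1) B_zero[OF assms(1)] assms(3)]] by simp

lemma span_B: "l \<in> G \<Longrightarrow> b \<in> B l \<Longrightarrow> b \<in> span G"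
  using span.add[OF span.zero, of l G b] by simp

lemma span_add: "b \<in> span G \<Longrightarrow> a \<in> span G \<Longrightarrow> a + b \<in> span G"
proof (induction rule: span.induct)
  case (add c l b)
  then show ?case using span.add[of "a + c" G l b] by (simp add: add.assoc)
qed simp

lemma span_minus:
  assumes "G \<subseteq> U" "a \<in> span G"
  shows "- a \<in> span G"
  using assms(2)
proof induction
  case (add a l b)
  then have "0 - b \<in> B l" using assms(1) B_diff B_zero by (meson subsetD)
  then have "- a + (0 - b) \<in> span G" using add by (intro span.add)
  then show ?case by (simp add: add.commute)
qed (simp add: span.zero)

lemma span_mult_B:
  assumes "G \<subseteq> U" "m \<in> U" "w \<in> B m" "a \<in> span G"
  shows "a * w \<in> span ((\<lambda>l. l \<odot> m) ` G)"
  using assms(4)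
proof induction
  case (add a l b)
  have "b * w \<in> B (l \<odot> m)" using B_mult assms(1-3) add.hyps by blast
  then have "a * w + b * w \<in> span ((\<lambda>l. l \<odot> m) ` G)"
    using add.IH add.hyps(2) by (intro span.add) auto
  then show ?case by (simp add: distrib_right)
qed (simp add: span.zero)

lemma span_mono: "G \<subseteq> G' \<Longrightarrow> span G \<subseteq> span G'"
proof
  fix a assume G: "G \<subseteq> G'" and "a \<in> span G"
  from this(2) show "a \<in> span G'" by induction (use G in \<open>auto intro: span.intros\<close>)
qed

lemma span_subring:
  assumes "subgrp H"
  shows "subring (span H)"
  unfolding subring_def
proof (intro conjI ballI)
  note H = subgrpD[OF assms]
  show "1 \<in> span H" by (rule span_B[OF H(2) B_one])
  fix a b assume ab: "a \<in> span H" "b \<in> span H"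
  show "a - b \<in> span H" using span_add[OF span_minus[OF H(1) ab(2)] ab(1)] by simp
  from ab(2) show "a * b \<in> span H"
  proof induction
    case (add c l w)
    have "(\<lambda>k. k \<odot> l) ` H \<subseteq> H" using H(3) add.hyps(2) by blast
    then have "a * w \<in> span H"
      using span_mult_B[OF H(1) _ add.hyps(3) ab(1)] H(1) add.hyps(2) span_mono by blast
    then show ?case using span_add[OF _ add.IH] by (simp add: distrib_left)
  qed (simp add: span.zero)
qed

lemma span_sum:
  assumes "G \<subseteq> U" "a \<in> span G"
  shows "\<exists>M b. finite M \<and> M \<subseteq> G \<and> (\<forall>l\<in>U. b l \<in> B l) \<and> (\<forall>l. l \<notin> M \<longrightarrow> b l = 0) \<and> a = (\<Sum>l\<in>M. b l)"
  using assms(2)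
proof induction
  case zero
  then show ?case using B_zero by (intro exI[of _ "{}"] exI[of _ "\<lambda>_. 0"]) simp
next
  case (add a k c)
  then obtain M b where M: "finite M" "M \<subseteq> G" "\<And>l. l \<in> U \<Longrightarrow> b l \<in> B l" "\<And>l. l \<notin> M \<Longrightarrow> b l = 0"
      "a = (\<Sum>l\<in>M. b l)" by blast
  define b' where "b' l = b l + (if l = k then c else 0)" for l
  have "(\<Sum>l\<in>insert k M. b' l) = (\<Sum>l\<in>insert k M. b l) + c"
    unfolding b'_def sum.distrib using M(1) by (simp add: sum.delta)
  also have "(\<Sum>l\<in>insert k M. b l) = (\<Sum>l\<in>M. b l)"
    using M(1,4) by (intro sum.mono_neutral_right) auto
  finally have "a + c = (\<Sum>l\<in>insert k M. b' l)" using M(5) by simp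
  moreover have "b' l \<in> B l" if "l \<in> U" for l
    unfolding b'_def using M(3)[OF that] B_add[OF that] add.hyps(3) by auto
  moreover have "b' l = 0" if "l \<notin> insert k M" for l unfolding b'_def using that M(4) by simp
  ultimately show ?case
    using M(1,2) add.hyps(2) by (intro exI[of _ "insert k M"] exI[of _ b']) simp
qed

lemma span_disjoint:
  assumes "G \<subseteq> U" "G' \<subseteq> U" "G \<inter> G' = {}" "a \<in> span G" "a \<in> span G'"
  shows "a = 0"
proof -
  obtain M b where M: "finite M" "M \<subseteq> G" "\<And>l. l \<in> U \<Longrightarrow> b l \<in> B l" "\<And>l. l \<notin> M \<Longrightarrow> b l = 0"
      "a = (\<Sum>l\<in>M. b l)" using span_sum[OF assms(1,4)] by blast
  obtain M' b' where M': "finite M'" "M' \<subseteq> G'" "\<And>l. l \<in> U \<Longrightarrow> b' l \<in> B l" "\<And>l. l \<notin> M' \<Longrightarrow> b' l = 0"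
      "a = (\<Sum>l\<in>M'. b' l)" using span_sum[OF assms(2,5)] by blast
  have "(\<Sum>l\<in>M \<union> M'. b l) = a" unfolding M(5)
    using M M'(1) by (intro sum.mono_neutral_right) auto
  moreover have "(\<Sum>l\<in>M \<union> M'. b' l) = a" unfolding M'(5)
    using M' M(1) by (intro sum.mono_neutral_right) auto
  ultimately have "(\<Sum>l\<in>M \<union> M'. b l - b' l) = 0" by (simp add: sum_subtractf)
  then have "\<forall>l\<in>M \<union> M'. b l - b' l = 0"
    using M M' assms(1,2) by (intro B_independent) (auto intro!: B_diff)
  moreover have "b' l = 0" if "l \<in> M" for l using that M(2) M'(2,4) assms(3) by blast
  ultimately have "b l = 0" if "l \<in> M" for l using that by force
  then show ?thesis unfolding M(5) by simp
qed

lemma B_unit_division_subring: "division_subring (B e)"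
  unfolding division_subring_def subring_def
  using B_one B_diff[OF unit_closed] B_mult[OF unit_closed unit_closed] B_inverse[OF unit_closed]
    unit[OF unit_closed] inv_unit by simp

text \<open>
  Conjugation by a homogeneous \<open>u\<close> preserves \<open>B e\<close>, and it multiplies the homogeneous \<open>d i\<close> by the
  commutator of \<open>u\<close> and \<open>d i\<close>, which has degree \<open>e\<close> because the group is commutative.
\<close>

lemma conjugation_stable:
  fixes k :: nat and l d :: "nat \<Rightarrow> 'a"
  assumes d: "\<And>i. i < k \<Longrightarrow> l i \<in> U \<and> d i \<in> B (l i) \<and> d i \<noteq> 0"
    and u: "m \<in> U" "u \<in> B m" "u \<noteq> 0"
    and s: "s \<in> subring hull (B e \<union> d ` {..<k})"
  shows "u * s * inverse u \<in> subring hull (B e \<union> d ` {..<k})"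
proof -
  let ?C = "subring hull (B e \<union> d ` {..<k})"
  let ?Z = "{s. u * s * inverse u \<in> ?C}"
  have C: "subring ?C" by (rule subring_hull)
  have iu: "inverse u * u = 1" "u * inverse u = 1" using u(3) by simp_all
  have "subring ?Z"
  proof (rule subringI)
    show "1 \<in> ?Z" using subring_one[OF C] iu by simp
    fix a b assume "a \<in> ?Z" "b \<in> ?Z"
    then have ab: "u * a * inverse u \<in> ?C" "u * b * inverse u \<in> ?C" by auto
    show "a - b \<in> ?Z" using subring_diff[OF C ab] by (simp add: algebra_simps)
    have "(u * a * inverse u) * (u * b * inverse u) = u * a * (inverse u * u) * b * inverse u"
      by (simp only: mult.assoc)
    also have "\<dots> = u * (a * b) * inverse u" by (simp only: iu mult.assoc mult_1_left)
    finally show "a * b \<in> ?Z" using subring_mult[OF C ab] by simp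
  qed
  moreover have "B e \<union> d ` {..<k} \<subseteq> ?Z"
  proof
    fix s assume "s \<in> B e \<union> d ` {..<k}"
    then consider "s \<in> B e" | i where "i < k" "s = d i" by blast
    then show "s \<in> ?Z"
    proof cases
      case 1
      have "u * s * inverse u \<in> B (m \<odot> e \<odot> inv m)"
        using B_mult B_inverse u(1,2) 1 unit_closed inv_closed comp_closed by simp
      also have "m \<odot> e \<odot> inv m = e" using unit inverse u(1) by simp
      finally show ?thesis by (auto intro: hull_inc)
    next
      case 2
      note di = d[OF 2(1)]
      have "u * d i * inverse u * inverse (d i) \<in> B (m \<odot> l i \<odot> inv m \<odot> inv (l i))"
        using B_mult B_inverse u(1,2) di inv_closed comp_closed by simp
      also have "m \<odot> l i \<odot> inv m \<odot> inv (l i) = (m \<odot> inv m) \<odot> (l i \<odot> inv (l i))"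
        using u(1) di inv_closed by (simp add: ac)
      also have "\<dots> = e" using inverse u(1) di unit unit_closed by simp
      finally have "u * d i * inverse u * inverse (d i) \<in> ?C" by (auto intro: hull_inc)
      moreover have "d i \<in> ?C" using 2(1) by (auto intro: hull_inc)
      ultimately have "u * d i * inverse u * inverse (d i) * d i \<in> ?C" by (rule subring_mult[OF C])
      then show ?thesis using di 2(2) by (simp add: mult.assoc)
    qed
  qed
  ultimately have "?C \<subseteq> ?Z" by (intro hull_minimal)
  then show ?thesis using s by blast
qed

text \<open>
  By \<open>conjugation_stable\<close>, adjoining \<open>d k\<close> is a skew polynomial extension (modulo relations) with
  conjugation by \<open>d k\<close> as its automorphism and zero derivation.
\<close>

lemma homogeneous_subring_left_noetherian:
  fixes k :: nat and l d :: "nat \<Rightarrow> 'a"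
  assumes d: "\<And>i. i < k \<Longrightarrow> l i \<in> U \<and> d i \<in> B (l i) \<and> d i \<noteq> 0"
  shows "left_noetherian (subring hull (B e \<union> d ` {..<k}))"
  using d
proof (induction k)
  case 0
  have "subring hull (B e) = B e"
    using B_unit_division_subring unfolding division_subring_def by (intro hull_same) blast
  then show ?case using division_subring_left_noetherian[OF B_unit_division_subring] by simp
next
  case (Suc k)
  let ?C = "\<lambda>k. subring hull (B e \<union> d ` {..<k})"
  have dk: "l k \<in> U" "d k \<in> B (l k)" "d k \<noteq> 0" using Suc.prems[of k] by auto
  have d': "\<And>i. i < k \<Longrightarrow> l i \<in> U \<and> d i \<in> B (l i) \<and> d i \<noteq> 0" using Suc.prems by simp
  define T where "T s = d k * s * inverse (d k)" for s
  define T' where "T' s = inverse (d k) * s * d k" for s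
  have T: "T s \<in> ?C k" if "s \<in> ?C k" for s
    unfolding T_def by (rule conjugation_stable[OF d' dk that])
  have T': "T' s \<in> ?C k" if "s \<in> ?C k" for s
    using conjugation_stable[OF d' inv_closed[OF dk(1)] B_inverse[OF dk(1,2)] _ that] dk(3)
    unfolding T'_def by simp
  have TT': "T (T' s) = s" "T' (T s) = s" for s
    unfolding T_def T'_def using dk(3) by (simp_all add: mult.assoc) (simp_all add: mult.assoc[symmetric])
  have bij: "bij_betw T (?C k) (?C k)"
    by (rule bij_betw_byWitness[where f' = T']) (use T T' TT' in auto)
  have ins: "B e \<union> d ` {..<Suc k} = insert (d k) (B e \<union> d ` {..<k})"
    by (simp add: lessThan_Suc)
  show ?case
  proof (rule left_noetherian_extension[OF Suc.IH[OF d'] bij, of "\<lambda>_. 0" "d k"])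
    show "0 \<in> ?C k" by (rule subring_zero[OF subring_hull])
    show "d k * s = T s * d k + 0" for s unfolding T_def using dk(3) by (simp add: mult.assoc)
    show "subring (?C (Suc k))" by (rule subring_hull)
    show "insert (d k) (?C k) \<subseteq> ?C (Suc k)"
      unfolding ins using hull_mono[of "B e \<union> d ` {..<k}" "insert (d k) (B e \<union> d ` {..<k})" subring]
      by (auto intro: hull_inc)
    show "?C (Suc k) \<subseteq> subring hull (insert (d k) (?C k))"
      unfolding ins by (intro hull_mono insert_mono hull_subset)
  qed
qed

text \<open>
  The subring generated by \<open>B e\<close> and the \<open>d i\<close> is left noetherian, so its left fractions form a
  division subring. If \<open>w\<close> were such a fraction, then \<open>p w = q\<close> with \<open>p\<close> and \<open>q\<close> supported in \<open>H\<close>,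
  while \<open>p w\<close> is supported in the coset of \<open>m\<close>.
\<close>

theorem separating_division_subring:
  fixes k :: nat and l d :: "nat \<Rightarrow> 'a"
  assumes H: "subgrp H"
    and d: "\<And>i. i < k \<Longrightarrow> l i \<in> H \<and> d i \<in> B (l i) \<and> d i \<noteq> 0"
    and w: "m \<in> U" "m \<notin> H" "w \<in> B m" "w \<noteq> 0"
  shows "\<exists>D. division_subring D \<and> B e \<subseteq> D \<and> (\<forall>i<k. d i \<in> D) \<and> w \<notin> D"
proof -
  let ?C = "subring hull (B e \<union> d ` {..<k})"
  note HD = subgrpD[OF H]
  have noeth: "left_noetherian ?C"
    using d HD(1) by (intro homogeneous_subring_left_noetherian[of k l]) blast
  have C: "B e \<union> d ` {..<k} \<subseteq> ?C" by (rule hull_subset)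
  have CD: "?C \<subseteq> left_fractions ?C" by (rule left_fractions_sub[OF subring_hull])
  have "B e \<union> d ` {..<k} \<subseteq> span H" using span_B HD(2) d by blast
  then have Csp: "?C \<subseteq> span H" using span_subring[OF H] by (rule hull_minimal)
  have "w \<notin> left_fractions ?C"
  proof
    assume "w \<in> left_fractions ?C"
    then obtain p where p: "p \<in> ?C" "p \<noteq> 0" "p * w \<in> ?C" unfolding left_fractions_def by blast
    have "p * w \<in> span ((\<lambda>l. l \<odot> m) ` H)"
      by (rule span_mult_B[OF HD(1) w(1,3)]) (use p(1) Csp in blast)
    moreover have "p * w \<in> span H" using p(3) Csp by blast
    moreover have "h \<odot> m \<notin> H" if h: "h \<in> H" for h
    proof
      assume "h \<odot> m \<in> H"
      then have "inv h \<odot> (h \<odot> m) \<in> H" using HD(3,4) h by blast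
      moreover have "h \<in> U" using h HD(1) by blast
      then have "inv h \<odot> (h \<odot> m) = m \<odot> (h \<odot> inv h)" using w(1) inv_closed by (simp add: ac)
      then have "inv h \<odot> (h \<odot> m) = m" using inverse[OF \<open>h \<in> U\<close>] unit[OF w(1)] by simp
      ultimately show False using w(2) by simp
    qed
    then have "(\<lambda>l. l \<odot> m) ` H \<inter> H = {}" by blast
    moreover have "(\<lambda>l. l \<odot> m) ` H \<subseteq> U" using HD(1) w(1) comp_closed by blast
    ultimately have "p * w = 0" using span_disjoint[OF _ HD(1)] by blast
    then show False using p(2) w(4) by simp
  qed
  then show ?thesis
    using left_fractions_division_subring[OF noeth] C CD
    by (intro exI[of _ "left_fractions ?C"]) blast
qed

end

lemma eigenvectors_independent:
  fixes \<theta> :: "'a::division_ring \<Rightarrow> 'a"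
  assumes K: "subring K" "\<And>a b. a \<in> K \<Longrightarrow> b \<in> K \<Longrightarrow> a * b = b * a"
    and add: "\<And>a b. \<theta> (a + b) = \<theta> a + \<theta> b" and lin: "\<And>c a. c \<in> K \<Longrightarrow> \<theta> (c * a) = c * \<theta> a"
    and M: "finite M" "M \<subseteq> K" "\<And>l. l \<in> M \<Longrightarrow> \<theta> (b l) = l * b l" "(\<Sum>l\<in>M. b l) = 0"
  shows "\<forall>l\<in>M. b l = 0"
  using M
proof (induction M arbitrary: b rule: finite_induct)
  case (insert m M)
  have \<theta>0: "\<theta> 0 = 0" using add[of 0 0] by simp
  have sum: "\<theta> (\<Sum>l\<in>N. b l) = (\<Sum>l\<in>N. \<theta> (b l))" if "finite N" for N
    using that by (induction N rule: finite_induct) (simp_all add: add \<theta>0)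
  have mK: "m \<in> K" and MK: "\<And>l. l \<in> M \<Longrightarrow> l \<in> K" using insert.prems(1) by auto
  have "(\<Sum>l\<in>insert m M. (l - m) * b l) = (\<Sum>l\<in>insert m M. \<theta> (b l)) - m * (\<Sum>l\<in>insert m M. b l)"
    unfolding sum_distrib_left sum_subtractf[symmetric]
    by (intro sum.cong) (simp_all add: insert.prems(2) left_diff_distrib)
  also have "\<dots> = 0" using sum[of "insert m M"] insert.hyps(1) insert.prems(3) \<theta>0 by simp
  finally have "(\<Sum>l\<in>M. (l - m) * b l) = 0" using insert.hyps by simp
  moreover have "\<theta> ((l - m) * b l) = l * ((l - m) * b l)" if "l \<in> M" for l
  proof -
    have lm: "l - m \<in> K" using subring_diff[OF K(1) MK[OF that] mK] .
    have "\<theta> ((l - m) * b l) = ((l - m) * l) * b l"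
      using lin[OF lm] insert.prems(2)[of l] that by (simp add: mult.assoc)
    then show ?thesis using K(2)[OF lm MK[OF that]] by (simp add: mult.assoc)
  qed
  ultimately have "\<forall>l\<in>M. (l - m) * b l = 0"
    using insert.IH[of "\<lambda>l. (l - m) * b l"] MK by blast
  then have "\<forall>l\<in>M. b l = 0" using insert.hyps(2) by auto
  then show ?case using insert.prems(3) insert.hyps by simp
qed simp

section \<open>Clearing denominators in the coefficients\<close>

lemma left_polys_sum:
  assumes "range c \<subseteq> S"
  shows "(\<Sum>i<n. c i * y ^ i) \<in> left_polys S y n"
proof (induction n)
  case (Suc n)
  have "c n \<in> S" using assms by blast
  then have "c n * y ^ n + (\<Sum>i<n. c i * y ^ i) \<in> left_polys S y (Suc n)" using Suc by auto
  then show ?case by (simp only: sum.lessThan_Suc add.commute)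
qed simp

lemma left_polys_coefficients:
  assumes "0 \<in> S" "a \<in> left_polys S y n"
  shows "\<exists>c. range c \<subseteq> S \<and> (\<forall>i\<ge>n. c i = 0) \<and> a = (\<Sum>i<n. c i * y ^ i)"
  using assms(2)
proof (induction n arbitrary: a)
  case 0
  then show ?case using assms(1) by (intro exI[of _ "\<lambda>_. 0"]) auto
next
  case (Suc n)
  then obtain s w where a: "s \<in> S" "w \<in> left_polys S y n" "a = s * y ^ n + w" by auto
  obtain c where c: "range c \<subseteq> S" "\<forall>i\<ge>n. c i = 0" "w = (\<Sum>i<n. c i * y ^ i)" using Suc.IH[OF a(2)] by blast
  have "(\<Sum>i<n. (c(n := s)) i * y ^ i) = w" unfolding c(3) by (intro sum.cong) auto
  then have "a = (\<Sum>i<Suc n. (c(n := s)) i * y ^ i)" unfolding a(3) by (simp add: add.commute)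
  moreover have "range (c(n := s)) \<subseteq> S" "\<forall>i\<ge>Suc n. (c(n := s)) i = 0" using c a(1) by auto
  ultimately show ?case by blast
qed

lemma left_polys_scale:
  assumes "subring S" "s \<in> S" "a \<in> left_polys S y n"
  shows "s * a \<in> left_polys S y n"
  using assms(3)
proof (induction n arbitrary: a)
  case (Suc n)
  then obtain c w where a: "c \<in> S" "w \<in> left_polys S y n" "a = c * y ^ n + w" by auto
  have "s * a = (s * c) * y ^ n + s * w" unfolding a by (simp add: algebra_simps)
  then show ?case using Suc.IH[OF a(2)] subring_mult[OF assms(1,2) a(1)] by auto
qed simp

lemma left_polys_common_denominator:
  assumes S: "left_noetherian S" and a: "a \<in> left_polys (left_fractions S) y n"
  shows "\<exists>s\<in>S. s \<noteq> 0 \<and> s * a \<in> left_polys S y n"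
  using a
proof (induction n arbitrary: a)
  case 0
  then show ?case using S subring_one unfolding left_noetherian_def by force
next
  case (Suc n)
  have sr: "subring S" using S unfolding left_noetherian_def by blast
  obtain d w where a: "d \<in> left_fractions S" "w \<in> left_polys (left_fractions S) y n" "a = d * y ^ n + w"
    using Suc.prems by auto
  obtain s where s: "s \<in> S" "s \<noteq> 0" "s * w \<in> left_polys S y n" using Suc.IH[OF a(2)] by blast
  have "s * d \<in> left_fractions S"
    using left_fractions_division_subring[OF S] left_fractions_sub[OF sr] a(1) s(1) subring_mult
    unfolding division_subring_def by blast
  then obtain t where t: "t \<in> S" "t \<noteq> 0" "t * (s * d) \<in> S" unfolding left_fractions_def by blast
  have "(t * s) * a = (t * (s * d)) * y ^ n + t * (s * w)" unfolding a(3) by (simp add: algebra_simps)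
  moreover have "t * (s * w) \<in> left_polys S y n" by (rule left_polys_scale[OF sr t(1) s(3)])
  ultimately have "(t * s) * a \<in> left_polys S y (Suc n)" using t(3) by auto
  then show ?case using s t subring_mult[OF sr t(1) s(1)] by (intro bexI[of _ "t * s"]) auto
qed

lemma left_polys_mono_coefficients: "S \<subseteq> D \<Longrightarrow> left_polys S y n \<subseteq> left_polys D y n"
  by (induction n) auto

lemma skew_polynomials_left_polys:
  assumes "skew_polynomial_ring S y \<tau> \<delta> S'" "t \<in> S'"
  shows "\<exists>n. t \<in> left_polys S y n"
proof -
  obtain c where c: "range c \<subseteq> S" "finite {i. c i \<noteq> 0}" "t = (\<Sum>i | c i \<noteq> 0. c i * y ^ i)"
    using assms unfolding skew_polynomial_ring_def by blast
  obtain n where n: "{i. c i \<noteq> 0} \<subseteq> {..<n}" using c(2) finite_nat_iff_bounded by blast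
  have "t = (\<Sum>i<n. c i * y ^ i)"
    unfolding c(3) using n by (intro sum.mono_neutral_left) auto
  then show ?thesis using left_polys_sum[OF c(1)] by metis
qed

text \<open>
  A relation over the fractions becomes, after multiplication by a common denominator \<open>s\<close>, a second
  expansion of \<open>s y\<^sup>n\<close> with coefficients in \<open>S\<close>, contrary to uniqueness.
\<close>

lemma powers_left_independent:
  assumes R: "skew_polynomial_ring S y \<tau> \<delta> S'" and S: "left_noetherian S"
  shows "y ^ n \<notin> left_polys (left_fractions S) y n"
proof
  have sr: "subring S" using S unfolding left_noetherian_def by blast
  assume "y ^ n \<in> left_polys (left_fractions S) y n"
  then obtain s where s: "s \<in> S" "s \<noteq> 0" "s * y ^ n \<in> left_polys S y n"
    using left_polys_common_denominator[OF S] by blast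
  obtain c where c: "range c \<subseteq> S" "\<forall>i\<ge>n. c i = 0" "s * y ^ n = (\<Sum>i<n. c i * y ^ i)"
    using left_polys_coefficients[OF subring_zero[OF sr] s(3)] by blast
  define b where "b i = (if i = n then s else 0)" for i
  have sup: "{i. c i \<noteq> 0} \<subseteq> {..<n}" using c(2) by (auto simp: not_le[symmetric])
  then have fin: "finite {i. c i \<noteq> 0}" using finite_subset by blast
  have csum: "s * y ^ n = (\<Sum>i | c i \<noteq> 0. c i * y ^ i)"
    unfolding c(3) using sup by (intro sum.mono_neutral_right) auto
  have "{i. b i \<noteq> 0} = {n}" unfolding b_def using s(2) by auto
  then have b: "range b \<subseteq> S" "finite {i. b i \<noteq> 0}" "s * y ^ n = (\<Sum>i | b i \<noteq> 0. b i * y ^ i)"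
    using s(1) subring_zero[OF sr] by (auto simp: b_def)
  have "s * y ^ n \<in> S'"
    using skew_polynomial_ringD[OF R] s(1) by (intro subring_mult subring_power) auto
  then have "\<exists>!c. range c \<subseteq> S \<and> finite {i. c i \<noteq> 0} \<and> s * y ^ n = (\<Sum>i | c i \<noteq> 0. c i * y ^ i)"
    using R unfolding skew_polynomial_ring_def by blast
  then have "b = c" using b c(1) fin csum by blast
  then show False using c(2) s(2) by (metis b_def order_refl)
qed

lemma skew_fraction_ringI:
  assumes R: "skew_polynomial_ring S y \<tau> \<delta> S'" and S: "left_noetherian S"
    and q: "\<And>q. \<exists>a\<in>S'. \<exists>b\<in>S'. b \<noteq> 0 \<and> q = inverse b * a"
    and T: "\<And>d. d \<in> left_fractions S \<Longrightarrow> T d \<in> left_fractions S"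
      "\<And>d. d \<noteq> 0 \<Longrightarrow> T d \<noteq> 0"
    and \<Delta>: "\<And>d. d \<in> left_fractions S \<Longrightarrow> \<Delta> d \<in> left_fractions S"
    and rel: "\<And>d. y * d = T d * y + \<Delta> d"
  shows "skew_fraction_ring (left_fractions S) y T \<Delta>"
proof
  have sr: "subring S" using S unfolding left_noetherian_def by blast
  show "division_subring (left_fractions S)" by (rule left_fractions_division_subring[OF S])
  show "y ^ n \<notin> left_polys (left_fractions S) y n" for n by (rule powers_left_independent[OF R S])
  show "\<exists>n. \<exists>b\<in>left_polys (left_fractions S) y n. b \<noteq> 0 \<and> (\<exists>m. b * q \<in> left_polys (left_fractions S) y m)" for q
  proof -
    obtain a b where ab: "a \<in> S'" "b \<in> S'" "b \<noteq> 0" "q = inverse b * a" using q by blast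
    have "b * q = a" unfolding ab(4) using ab(3) by (simp add: mult.assoc[symmetric])
    moreover have "\<exists>n. t \<in> left_polys (left_fractions S) y n" if "t \<in> S'" for t
      using skew_polynomials_left_polys[OF R that] left_polys_mono_coefficients[OF left_fractions_sub[OF sr]]
      by blast
    ultimately show ?thesis using ab by metis
  qed
qed (use T \<Delta> rel in auto)

section \<open>The fraction ring is not affine\<close>

context iterated_fractions
begin

text \<open>
  The argument common to both cases. The hypothesis \<open>eigen\<close> says that the element produced by two
  constants \<open>c, c'\<close> belonging to the same atom is homogeneous of degree \<open>c/c'\<close>, written in the
  group \<open>U\<close>.
\<close>

lemma not_affine_of_grading:
  assumes n: "n \<ge> 1"
    and "skew_fraction_ring (left_fractions (R (n - 1))) (x n) T \<Delta>"
    and "division_grading U gop e ginv B" and UK: "U \<subseteq> K" and KB: "K \<subseteq> B e"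
    and inf: "comm_group_on.infinitely_generated U gop e ginv"
    and eigen: "\<And>c c' d. c \<in> U \<Longrightarrow> c' \<in> U \<Longrightarrow> T d * c' + \<Delta> d = c * d \<Longrightarrow> d \<in> B (gop c (ginv c'))"
  shows "\<not> affine_over K"
proof
  interpret G: division_grading U gop e ginv B by fact
  interpret F: skew_fraction_ring "left_fractions (R (n - 1))" "x n" T \<Delta> by fact
  let ?D = "left_fractions (R (n - 1))"
  assume "affine_over K"
  then obtain X where X: "finite X" "subring hull (K \<union> X) = UNIV" unfolding affine_over_def by blast
  have KD: "K \<subseteq> ?D"
    using K_sub_R[of "n - 1"] left_fractions_sub[OF R_subring[of "n - 1"]] by auto
  then have "subring hull (K \<union> X) \<subseteq> subring hull (?D \<union> X)" by (intro hull_mono) blast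
  then have "subring hull (?D \<union> X) = UNIV" using X(2) by blast
  then obtain P where P: "finite P" "\<And>p. p \<in> P \<Longrightarrow> F.atom p"
      "\<And>c. c \<in> ?D \<Longrightarrow> \<exists>p\<in>P. \<not> F.injective_at c p"
    using F.finitely_many_singular_atoms[OF X(1)] by blast
  obtain f H where fH: "\<And>j::nat. G.subgrp (H j)" "\<And>j. f j \<in> U" "\<And>j. f j \<notin> H j"
      "\<And>i j. i < j \<Longrightarrow> f i \<in> H j"
    using inf unfolding G.infinitely_generated_def by blast
  have fD: "f j \<in> ?D" for j using fH(2) UK KD by blast
  then have "\<forall>j\<in>UNIV. \<exists>p\<in>P. \<not> F.injective_at (f j) p" using P(3) by blast
  from pigeonhole_infinite_rel[OF infinite_UNIV_nat P(1) this]
  obtain p where p: "p \<in> P" and "infinite {j \<in> UNIV. \<not> F.injective_at (f j) p}" by (rule bexE)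
  then have J: "infinite {j. \<not> F.injective_at (f j) p}" (is "infinite ?J") by simp
  \<comment> \<open>A subsequence all of whose members belong to the same atom; it still escapes because its
    indices increase.\<close>
  define r where "r = enumerate ?J"
  have r: "\<not> F.injective_at (f (r i)) p" for i
    using enumerate_in_set[OF J, of i] unfolding r_def by simp
  have r_less: "r i < r j" if "i < j" for i j
    unfolding r_def by (rule enumerate_mono[OF that J])
  have "\<forall>i. \<exists>d. d \<noteq> 0 \<and> T d * f (r 0) + \<Delta> d = f (r i) * d"
    using F.singular_atom_eigenvector[OF P(2)[OF p] fD r fD r] by blast
  then obtain d where "\<forall>i. d i \<noteq> 0 \<and> T (d i) * f (r 0) + \<Delta> (d i) = f (r i) * d i"
    by (rule choice[THEN exE])
  then have d: "\<And>i. d i \<noteq> 0" "\<And>i. T (d i) * f (r 0) + \<Delta> (d i) = f (r i) * d i" by auto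
  define l where "l i = gop (f (r i)) (ginv (f (r 0)))" for i
  have dB: "d i \<in> B (l i)" for i unfolding l_def by (rule eigen[OF fH(2) fH(2) d(2)])
  obtain m where m: "\<And>D. division_subring D \<Longrightarrow> K \<subseteq> D \<Longrightarrow> (\<And>i. i \<le> m \<Longrightarrow> d i \<in> D) \<Longrightarrow> d (Suc m) \<in> D"
    using division_subring_acc[of d] by blast
  let ?H = "H (r (Suc m))"
  note HD = G.subgrpD[OF fH(1)[of "r (Suc m)"]]
  have f0: "f (r 0) \<in> ?H" by (rule fH(4)[OF r_less]) simp
  have lH: "l i \<in> ?H" if "i < Suc m" for i
    unfolding l_def by (rule HD(3)[OF fH(4)[OF r_less[OF that]] HD(4)[OF f0]])
  have lU: "l (Suc m) \<in> U" unfolding l_def using fH(2) G.comp_closed G.inv_closed by blast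
  have "l (Suc m) \<notin> ?H"
  proof
    assume "l (Suc m) \<in> ?H"
    then have "gop (l (Suc m)) (f (r 0)) \<in> ?H" using HD(3) f0 by blast
    moreover have "gop (l (Suc m)) (f (r 0)) = gop (f (r (Suc m))) (gop (f (r 0)) (ginv (f (r 0))))"
      unfolding l_def using fH(2) G.inv_closed by (simp add: G.ac)
    then have "gop (l (Suc m)) (f (r 0)) = f (r (Suc m))"
      using G.inverse[OF fH(2)] G.unit[OF fH(2)] by simp
    ultimately show False using fH(3) by simp
  qed
  then obtain D' where D': "division_subring D'" "B e \<subseteq> D'" "\<forall>i<Suc m. d i \<in> D'" "d (Suc m) \<notin> D'"
    using G.separating_division_subring[OF fH(1), of "Suc m" l _ d "l (Suc m)" "d (Suc m)"] lH lU dB d(1) by blast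
  then have "d (Suc m) \<in> D'" using KB by (intro m) auto
  then show False using D'(4) by blast
qed

lemma K_infinite_subfield: "infinite K \<Longrightarrow> infinite_subfield K"
  by unfold_locales (use K_division_subring K_commute in auto)

lemma eigenspace_grading:
  assumes "comm_group_on U gop e ginv" "U \<subseteq> K"
    and add: "\<And>a b. \<theta> (a + b) = \<theta> a + \<theta> b" and lin: "\<And>c a. c \<in> K \<Longrightarrow> \<theta> (c * a) = c * \<theta> a"
    and "\<And>l m a b. l \<in> U \<Longrightarrow> m \<in> U \<Longrightarrow> \<theta> a = l * a \<Longrightarrow> \<theta> b = m * b \<Longrightarrow> \<theta> (a * b) = gop l m * (a * b)"
    and "\<And>l a. l \<in> U \<Longrightarrow> a \<noteq> 0 \<Longrightarrow> \<theta> a = l * a \<Longrightarrow> \<theta> (inverse a) = ginv l * inverse a"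
    and "\<theta> 1 = e"
  shows "division_grading U gop e ginv (\<lambda>l. {b. \<theta> b = l * b})"
proof (intro division_grading.intro division_grading_axioms.intro)
  have zero: "\<theta> 0 = 0" using add[of 0 0] by simp
  have diff: "\<theta> (a - b) = \<theta> a - \<theta> b" for a b using add[of "a - b" b] by simp
  show "0 \<in> {b. \<theta> b = l * b}" for l using zero by simp
  show "a - b \<in> {b. \<theta> b = l * b}" if "a \<in> {b. \<theta> b = l * b}" "b \<in> {b. \<theta> b = l * b}" for l a b
    using that by (simp add: diff right_diff_distrib)
  show "inverse a \<in> {b. \<theta> b = ginv l * b}" if "l \<in> U" "a \<in> {b. \<theta> b = l * b}" for l a
    using that assms(6) zero by (cases "a = 0") simp_all
  show "\<forall>l\<in>M. b l = 0"
    if "finite M" "M \<subseteq> U" "\<And>l. l \<in> M \<Longrightarrow> b l \<in> {b. \<theta> b = l * b}" "(\<Sum>l\<in>M. b l) = 0" for M b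
  proof (rule eigenvectors_independent[OF K_subring K_commute add lin that(1) _ _ that(4)])
    show "M \<subseteq> K" using that(2) assms(2) by (rule order_trans)
    show "\<theta> (b l) = l * b l" if "l \<in> M" for l using \<open>\<And>l. l \<in> M \<Longrightarrow> b l \<in> _\<close>[OF that] by simp
  qed
qed (use assms(1,5,7) in simp_all)

lemma left_fractions_closed:
  assumes "i \<le> n"
  shows "division_subring (left_fractions (R i))"
  by (rule left_fractions_division_subring[OF left_noetherian_R[OF assms]])

lemma K_inverse_cancel: "c \<in> K \<Longrightarrow> c \<noteq> 0 \<Longrightarrow> a * c = b \<Longrightarrow> a = b * inverse c"
  by (auto simp: mult.assoc)

lemma not_affine_zero_derivation:
  assumes n: "n \<ge> 1" and inf: "infinite K" and \<delta>: "\<And>s. s \<in> R (n - 1) \<Longrightarrow> \<delta> n s = 0"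
  shows "\<not> affine_over K"
proof -
  interpret K: infinite_subfield K by (rule K_infinite_subfield[OF inf])
  let ?S = "R (n - 1)" and ?y = "x n"
  let ?D = "left_fractions ?S"
  have R: "skew_polynomial_ring ?S ?y (\<tau> n) (\<delta> n) (R n)" using step(1)[of "n - 1"] n by simp
  note RD = skew_polynomial_ringD[OF R]
  have S: "left_noetherian ?S" by (rule left_noetherian_R) simp
  have "?y ^ 1 \<notin> left_polys ?D ?y 1" by (rule powers_left_independent[OF R S])
  moreover have "0 \<in> left_polys ?D ?y 1"
    using subring_zero[of ?D] left_fractions_closed[of "n - 1"] unfolding division_subring_def by force
  ultimately have y: "?y \<noteq> 0" by (metis power_one_right)
  define T where "T d = ?y * d * inverse ?y" for d
  have T_mult: "T (a * b) = T a * T b" for a b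
    unfolding T_def using y by (simp add: mult.assoc) (simp add: mult.assoc[symmetric])
  have T_inverse: "T (inverse a) = inverse (T a)" for a
    unfolding T_def using y by (cases "a = 0") (simp_all add: nonzero_inverse_mult_distrib mult.assoc)
  have T_nonzero: "T a \<noteq> 0" if "a \<noteq> 0" for a unfolding T_def using y that by simp
  have T_S: "T s \<in> ?S" if "s \<in> ?S" for s
  proof -
    have "T s = \<tau> n s" unfolding T_def using RD(6)[OF that] \<delta>[OF that] y by (simp add: mult.assoc)
    then show ?thesis using RD(4) that unfolding bij_betw_def by auto
  qed
  have "skew_fraction_ring ?D ?y T (\<lambda>_. 0)"
  proof (rule skew_fraction_ringI[OF R S])
    show "\<exists>a\<in>R n. \<exists>b\<in>R n. b \<noteq> 0 \<and> q = inverse b * a" for q by (rule left_fraction)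
    show "T d \<in> ?D" if d: "d \<in> ?D" for d
    proof -
      obtain p where p: "p \<in> ?S" "p \<noteq> 0" "p * d \<in> ?S" using d unfolding left_fractions_def by blast
      then have "T p \<in> ?S" "T p \<noteq> 0" "T p * T d \<in> ?S"
        using T_S[OF p(1)] T_S[OF p(3)] T_nonzero T_mult by auto
      then show ?thesis unfolding left_fractions_def by blast
    qed
    show "0 \<in> ?D" using left_fractions_closed[of "n - 1"] subring_zero[of ?D] unfolding division_subring_def by simp
    show "?y * d = T d * ?y + 0" for d unfolding T_def using y by (simp add: mult.assoc)
  qed (rule T_nonzero)
  moreover have T_lin: "T (c * a) = c * T a" if "c \<in> K" for c a
    unfolding T_def using K_central[OF that, of ?y] by (simp add: mult.assoc[symmetric])
  have "division_grading (K - {0}) (*) 1 inverse (\<lambda>l. {b. T b = l * b})"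
  proof (rule eigenspace_grading[OF K.units.comm_group_on_axioms _ _ T_lin])
    show "T (a + b) = T a + T b" for a b unfolding T_def by (simp add: algebra_simps)
    show "T (a * b) = l * m * (a * b)" if "m \<in> K - {0}" "T a = l * a" "T b = m * b" for l m a b
    proof -
      have "T (a * b) = l * (a * m) * b" by (simp add: T_mult that mult.assoc)
      also have "a * m = m * a" using K_central[of m a] that(1) by simp
      finally show ?thesis by (simp add: mult.assoc)
    qed
    show "T (inverse a) = inverse l * inverse a" if "l \<in> K - {0}" "a \<noteq> 0" "T a = l * a" for l a
    proof -
      have "inverse l * inverse a = inverse a * inverse l" using K_central K_inverse that(1) by blast
      then show ?thesis using that by (simp add: T_inverse nonzero_inverse_mult_distrib)
    qed
  qed (use y in \<open>auto simp: T_def\<close>)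
  ultimately show ?thesis
  proof (rule not_affine_of_grading[OF n])
    show "K - {0} \<subseteq> K" by blast
    have "T 1 = 1" unfolding T_def using y by simp
    then show "K \<subseteq> {b. T b = 1 * b}" using T_lin[of _ 1] by auto
    show "comm_group_on.infinitely_generated (K - {0}) (*) 1 inverse"
      by (rule K.multiplicative_infinitely_generated)
    fix c c' d assume c: "c \<in> K - {0}" "c' \<in> K - {0}" and "T d * c' + 0 = c * d"
    then have "T d = c * d * inverse c'" by (intro K_inverse_cancel) auto
    also have "\<dots> = c * inverse c' * d" using K_central[of "inverse c'" d] K_inverse c by (simp add: mult.assoc)
    finally show "d \<in> {b. T b = c * inverse c' * b}" by simp
  qed
qed

lemma not_affine_identity_automorphism:
  assumes n: "n \<ge> 1" and inf: "infinite K" and \<tau>: "\<And>s. s \<in> R (n - 1) \<Longrightarrow> \<tau> n s = s"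
  shows "\<not> affine_over K"
proof -
  interpret K: infinite_subfield K by (rule K_infinite_subfield[OF inf])
  let ?S = "R (n - 1)" and ?y = "x n"
  let ?D = "left_fractions ?S"
  have R: "skew_polynomial_ring ?S ?y (\<tau> n) (\<delta> n) (R n)" using step(1)[of "n - 1"] n by simp
  note RD = skew_polynomial_ringD[OF R]
  have S: "left_noetherian ?S" by (rule left_noetherian_R) simp
  have Dsub: "subring ?D" and Dinv: "\<And>d. d \<in> ?D \<Longrightarrow> inverse d \<in> ?D"
    using left_fractions_closed[of "n - 1"] unfolding division_subring_def by auto
  have SD: "?S \<subseteq> ?D" by (rule left_fractions_sub[OF RD(1)])
  define \<theta> where "\<theta> d = ?y * d - d * ?y" for d
  have \<theta>_mult: "\<theta> (a * b) = \<theta> a * b + a * \<theta> b" for a b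
    unfolding \<theta>_def by (simp add: algebra_simps)
  have \<theta>_inverse: "\<theta> (inverse a) = - (inverse a * \<theta> a * inverse a)" if "a \<noteq> 0" for a
    unfolding \<theta>_def using that by (simp add: algebra_simps) (simp add: mult.assoc[symmetric])
  have \<theta>_K: "\<theta> c = 0" if "c \<in> K" for c unfolding \<theta>_def using K_central[OF that, of ?y] by simp
  have \<theta>_S: "\<theta> s \<in> ?S" if "s \<in> ?S" for s
    unfolding \<theta>_def using RD(5)[OF that] RD(6)[OF that] \<tau>[OF that] by simp
  have "skew_fraction_ring ?D ?y (\<lambda>d. d) \<theta>"
  proof (rule skew_fraction_ringI[OF R S])
    show "\<exists>a\<in>R n. \<exists>b\<in>R n. b \<noteq> 0 \<and> q = inverse b * a" for q by (rule left_fraction)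
    show "\<theta> d \<in> ?D" if d: "d \<in> ?D" for d
    proof -
      obtain p where p: "p \<in> ?S" "p \<noteq> 0" "p * d \<in> ?S" using d unfolding left_fractions_def by blast
      have "\<theta> (p * d) - \<theta> p * d = p * \<theta> d" by (simp add: \<theta>_mult)
      then have "\<theta> d = inverse p * (\<theta> (p * d) - \<theta> p * d)"
        using p(2) by (simp only: mult.assoc[symmetric]) simp
      also have "\<dots> \<in> ?D"
        using SD \<theta>_S[OF p(1)] \<theta>_S[OF p(3)] p(1) d Dinv
        by (intro subring_mult[OF Dsub] subring_diff[OF Dsub]) auto
      finally show ?thesis .
    qed
    show "?y * d = d * ?y + \<theta> d" for d unfolding \<theta>_def by simp
  qed auto
  moreover have "division_grading K (+) 0 uminus (\<lambda>l. {b. \<theta> b = l * b})"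
  proof (rule eigenspace_grading[OF K.additive.comm_group_on_axioms order_refl])
    show "\<theta> (a + b) = \<theta> a + \<theta> b" for a b unfolding \<theta>_def by (simp add: algebra_simps)
    show "\<theta> (c * a) = c * \<theta> a" if "c \<in> K" for c a using \<theta>_mult \<theta>_K[OF that] by simp
    show "\<theta> (a * b) = (l + m) * (a * b)" if "m \<in> K" "\<theta> a = l * a" "\<theta> b = m * b" for l m a b
    proof -
      have "\<theta> (a * b) = l * a * b + (a * m) * b" by (simp add: \<theta>_mult that mult.assoc)
      also have "a * m = m * a" using K_central[OF that(1), of a] by simp
      finally show ?thesis by (simp add: distrib_right mult.assoc)
    qed
    show "\<theta> (inverse a) = - l * inverse a" if "l \<in> K" "a \<noteq> 0" "\<theta> a = l * a" for l a
      using \<theta>_inverse[OF that(2)] that K_central[of l "inverse a"] by (simp add: mult.assoc)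
  qed (simp add: \<theta>_def)
  ultimately show ?thesis
  proof (rule not_affine_of_grading[OF n])
    show "K \<subseteq> K" by blast
    show "K \<subseteq> {b. \<theta> b = 0 * b}" using \<theta>_K by auto
    show "comm_group_on.infinitely_generated K (+) 0 uminus"
      by (rule K.additive_infinitely_generated)
    fix c c' d assume c: "c \<in> K" "c' \<in> K" and "d * c' + \<theta> d = c * d"
    then have "\<theta> d = c * d - d * c'" by (simp add: algebra_simps)
    then show "d \<in> {b. \<theta> b = (c + - c') * b}"
      using K_central[OF c(2), of d] by (simp add: left_diff_distrib)
  qed
qed

end

theorem theorem4p2:
  fixes K :: "'a::division_ring set"
    and n :: nat
    and x :: "nat \<Rightarrow> 'a"
    and \<tau> \<delta> :: "nat \<Rightarrow> 'a \<Rightarrow> 'a"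
    and R :: "nat \<Rightarrow> 'a set"
  assumes "n \<ge> 1"
    and "infinite K"
    and "iterated_skew_polynomial_algebra K n x \<tau> \<delta> R"
    and "(\<forall>s\<in>R (n - 1). \<delta> n s = 0) \<or> (\<forall>s\<in>R (n - 1). \<tau> n s = s)"
    and "division_ring_of_fractions (R n)"
  shows "\<not> affine_over K"
proof -
  interpret iterated_fractions K n x \<tau> \<delta> R
    by unfold_locales fact+
  from assms(4) show ?thesis
    using not_affine_zero_derivation[OF assms(1,2)] not_affine_identity_automorphism[OF assms(1,2)] by blast
qed

end
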